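(* Let $k\ge 1$ be an integer and let $r=\langle r_1,\dots,r_k\rangle$ be a monotone decreasing (i.e. $r_1\ge r_2\ge\cdots\ge r_k$) sequence of $k$ nonnegative integers, and put $\|r\|_1:=r_1+\cdots+r_k$. Consider the statement (S) For every finite positive definite metric space $X$ with $\#X=k$ and every sequence $(X_n)_{n\ge1}$ of finite positive definite metric spaces such that each $X_n$ is clustered in type $r$ and $\lim_{n\to\infty}X_n=X$ in Gromov–Hausdorff distance, one has $\lim_{n\to\infty}|X_n|=|X|$. Then (S) is true if and only if either $\|r\|_1\le 2$ (with $k\geq 1$ arbitrary), or $\|r\|_1=3$ and $k=1$.
   Context: For a finite metric space $X=\{x_1,\dots,x_k\}$ with distance $d$, the zeta matrix is $\zeta_X=(e^{-d(x_i,x_j)})_{1\le i,j\le k}$. $X$ is positive definite if $\zeta_X$ is a positive definite matrix. The magnitude $|X|$ of a finite positive definite metric space $X$ is the sum of all entries of $\zeta_X^{-1}$. $\#X$ denotes cardinality. A finite metric space $X$ is clustered in type $r=\langle r_1,\dots,r_m\rangle$ (a finite monotone decreasing sequence of nonnegative integers) if there exists $\varepsilon>0$ such that the relation $\{(x_1,x_2)\in X\times X: d(x_1,x_2)<\varepsilon\}$ is an equivalence relation on $X$ with exactly $m$ equivalence classes, of respective cardinalities $r_1+1,\dots,r_m+1$. *)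

theory Defs
  imports
    "HOL-Analysis.Abstract_Metric_Spaces"
    "HOL-Library.Infinite_Typeclass"
    "Jordan_Normal_Form.Gauss_Jordan_Elimination"
begin

(* An arbitrary enumeration x_0, ..., x_{k-1} of a finite metric space.  The choice only permutes
   rows and columns of the zeta matrix simultaneously, so it affects neither positive definiteness
   nor the magnitude. *)
definition enum_points :: "'a metric \<Rightarrow> 'a list" where
  "enum_points X = (SOME xs. distinct xs \<and> set xs = mspace X)"

definition zeta_matrix :: "'a metric \<Rightarrow> real mat" where
  "zeta_matrix X = mat (card (mspace X)) (card (mspace X))
     (\<lambda>(i, j). exp (- mdist X (enum_points X ! i) (enum_points X ! j)))"

definition positive_definite_mat :: "real mat \<Rightarrow> bool" where
  "positive_definite_mat A \<longleftrightarrow> square_mat A \<and> transpose_mat A = A \<and>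
     (\<forall>v \<in> carrier_vec (dim_row A). v \<noteq> 0\<^sub>v (dim_row A) \<longrightarrow> v \<bullet> (A *\<^sub>v v) > 0)"

definition positive_definite_space :: "'a metric \<Rightarrow> bool" where
  "positive_definite_space X \<longleftrightarrow> finite (mspace X) \<and> positive_definite_mat (zeta_matrix X)"

(* Meaningful when the zeta matrix is invertible, in particular for positive definite spaces. *)
definition magnitude :: "'a metric \<Rightarrow> real" where
  "magnitude X = (let B = the (mat_inverse (zeta_matrix X))
     in \<Sum>i<dim_row B. \<Sum>j<dim_col B. B $$ (i, j))"

(* Cs enumerates the equivalence classes without repetition, so that there are exactly
   length r of them, the i-th one having r ! i + 1 elements. *)
definition clustered_in_type :: "nat list \<Rightarrow> 'a metric \<Rightarrow> bool" where
  "clustered_in_type r X \<longleftrightarrow>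
     (\<exists>\<epsilon>>0. let E = {(x, y). x \<in> mspace X \<and> y \<in> mspace X \<and> mdist X x y < \<epsilon>} in
        equiv (mspace X) E \<and>
        (\<exists>Cs. distinct Cs \<and> set Cs = mspace X // E \<and> map card Cs = map (\<lambda>s. s + 1) r))"

definition hausdorff_distance :: "'a metric \<Rightarrow> 'a set \<Rightarrow> 'a set \<Rightarrow> real" where
  "hausdorff_distance Z A B = Inf {\<epsilon>. \<epsilon> > 0 \<and>
     (\<forall>a\<in>A. \<exists>b\<in>B. mdist Z a b < \<epsilon>) \<and> (\<forall>b\<in>B. \<exists>a\<in>A. mdist Z a b < \<epsilon>)}"

definition isometric_embedding :: "'a metric \<Rightarrow> 'b metric \<Rightarrow> ('a \<Rightarrow> 'b) \<Rightarrow> bool" where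
  "isometric_embedding X Z f \<longleftrightarrow> f \<in> mspace X \<rightarrow> mspace Z \<and>
     (\<forall>x \<in> mspace X. \<forall>y \<in> mspace X. mdist Z (f x) (f y) = mdist X x y)"

(* The infimum of the Hausdorff distances of the images of X and Y under isometric embeddings f
   and g into a common metric space Z.  Only the points of f(X) and g(Y) matter, so it suffices to
   let Z range over the metric spaces whose points are in the sum type.  For nonempty bounded X
   and Y the infima here and in hausdorff_distance are over nonempty sets bounded below by 0. *)
definition gromov_hausdorff_distance :: "'a metric \<Rightarrow> 'b metric \<Rightarrow> real" where
  "gromov_hausdorff_distance X Y = Inf {hausdorff_distance Z (f ` mspace X) (g ` mspace Y) |
     (Z :: ('a + 'b) metric) f g. isometric_embedding X Z f \<and> isometric_embedding Y Z g}"

end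

(* The magnitude of a positive definite space is the maximum of (sum v)^2 / Q(v), where Q is the
   quadratic form of the zeta matrix. Testing with the weighting of X on a set of representatives
   gives liminf |X_n| >= |X| in all cases.

   Stability: if X_n has at most two more points than X, move the mass of the extra points to the
   representatives of their clusters. The self-energy of the resulting at most two dipoles dominates
   their interaction with the other points: two dipoles at the same representative are compared
   through the tripod spanned by three points, and dipoles at different representatives are almost
   orthogonal. Hence Q on X_n is at least (1 - o(1)) times Q on X. If X is a point and X_n has four
   points, 1 - exp(-d) is a metric on four points, hence a nonnegative combination of cut metrics,
   and this bounds Q from below.

   Instability: for the types <4>, <3,0>, <2,1>, <1,1,1> there are explicit families whose forms
   degenerate to first order, so that large masses of opposite signs decrease Q by a fixed amount.
   Instability survives adding a distant point and doubling a point, and all remaining types arise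
   in this way. *)
theory Submission
  imports Defs "Jordan_Normal_Form.Determinant"
begin

section \<open>Magnitude and quadratic forms\<close>

text \<open>The natural scale is \<open>1 - S\<close>, itself a pseudometric, of size at most \<eta>
  on a cluster. A vector whose mass cancels inside every cluster has energy of first order in this
  scale, and its interaction with the remaining mass is of first order too. While the energy stays
  comparable to the scale, completing the square changes the form by O(\<eta>) only. The obstacle is
  a direction whose first-order energy vanishes: with energy \<open>\<lambda> * t^2 * x^2\<close>
  and interaction \<open>- \<mu> * t * x\<close>, a mass \<open>x\<close> of order
  \<open>1 / t\<close> lowers the form by \<open>\<mu>^2 / (4 * \<lambda>)\<close>, however small
  \<open>t\<close> is. For a single cluster this is related to negative type: every metric on four
  points embeds into l_1, while on five points the path metric of the graph K_{2,3} is not even of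
  negative type. In each counterexample the linear coefficients in \<open>t\<close> are tuned to
  give exactly one null direction among the vectors with mass zero in every cluster, one that does
  interact with the remaining mass; the terms in \<open>t^2\<close> keep the form positive
  definite.\<close>

definition bform :: "'i set \<Rightarrow> ('i \<Rightarrow> 'i \<Rightarrow> real) \<Rightarrow> ('i \<Rightarrow> real) \<Rightarrow> ('i \<Rightarrow> real) \<Rightarrow> real" where
  "bform I S u v = (\<Sum>x\<in>I. \<Sum>y\<in>I. S x y * u x * v y)"

abbreviation qform :: "'i set \<Rightarrow> ('i \<Rightarrow> 'i \<Rightarrow> real) \<Rightarrow> ('i \<Rightarrow> real) \<Rightarrow> real" where
  "qform I S v \<equiv> bform I S v v"

definition pos_def :: "'i set \<Rightarrow> ('i \<Rightarrow> 'i \<Rightarrow> real) \<Rightarrow> bool" where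
  "pos_def I S \<longleftrightarrow> (\<forall>v. (\<exists>x\<in>I. v x \<noteq> 0) \<longrightarrow> qform I S v > 0)"

definition sim :: "'a metric \<Rightarrow> 'a \<Rightarrow> 'a \<Rightarrow> real" where
  "sim X x y = exp (- mdist X x y)"

lemma pos_def_nonneg:
  assumes "pos_def I S" shows "qform I S v \<ge> 0"
proof (cases "\<exists>x\<in>I. v x \<noteq> 0")
  case True
  then show ?thesis using assms unfolding pos_def_def by fastforce
next
  case False
  then show ?thesis by (simp add: bform_def)
qed

lemma bform_cong:
  assumes "\<And>x. x \<in> I \<Longrightarrow> u x = u' x" "\<And>x. x \<in> I \<Longrightarrow> v x = v' x"
  shows "bform I S u v = bform I S u' v'"
  unfolding bform_def using assms by (intro sum.cong refl) auto

lemma bform_sym: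
  assumes "\<And>x y. x \<in> I \<Longrightarrow> y \<in> I \<Longrightarrow> S x y = S y x"
  shows "bform I S u v = bform I S v u"
proof -
  have "bform I S u v = (\<Sum>y\<in>I. \<Sum>x\<in>I. S x y * u x * v y)"
    unfolding bform_def by (rule sum.swap)
  also have "\<dots> = bform I S v u"
    unfolding bform_def using assms by (intro sum.cong refl) (auto simp: mult_ac)
  finally show ?thesis .
qed

lemma bform_add_left: "bform I S (\<lambda>x. u x + u' x) v = bform I S u v + bform I S u' v"
  by (simp add: bform_def algebra_simps sum.distrib)

lemma bform_add_right: "bform I S u (\<lambda>x. v x + v' x) = bform I S u v + bform I S u v'"
  by (simp add: bform_def algebra_simps sum.distrib)

lemma bform_scale_left: "bform I S (\<lambda>x. c * u x) v = c * bform I S u v"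
  by (simp add: bform_def sum_distrib_left mult_ac)

lemma bform_scale_right: "bform I S u (\<lambda>x. c * v x) = c * bform I S u v"
  by (simp add: bform_def sum_distrib_left mult_ac)

lemma bform_weighted:
  assumes "\<And>x. x \<in> I \<Longrightarrow> (\<Sum>y\<in>I. S x y * w y) = f x"
  shows "bform I S u w = (\<Sum>x\<in>I. f x * u x)"
proof -
  have "bform I S u w = (\<Sum>x\<in>I. u x * (\<Sum>y\<in>I. S x y * w y))"
    unfolding bform_def by (simp add: sum_distrib_left mult_ac)
  then show ?thesis using assms by (simp add: mult.commute)
qed

lemma bform_Cauchy_Schwarz:
  assumes pd: "pos_def I S" and sym: "\<And>x y. x \<in> I \<Longrightarrow> y \<in> I \<Longrightarrow> S x y = S y x"
  shows "(bform I S u w)\<^sup>2 \<le> qform I S u * qform I S w"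
proof -
  let ?a = "qform I S w" and ?b = "bform I S u w" and ?c = "qform I S u"
  have swap: "bform I S w u = ?b"
    using sym by (rule bform_sym)
  have key: "p^2 * ?c - 2 * p * q * ?b + q^2 * ?a \<ge> 0" for p q
  proof -
    have "qform I S (\<lambda>x. p * u x + (- q) * w x) \<ge> 0"
      by (rule pos_def_nonneg[OF pd])
    also have "qform I S (\<lambda>x. p * u x + (- q) * w x) = p^2 * ?c - 2 * p * q * ?b + q^2 * ?a"
      unfolding bform_add_left bform_add_right bform_scale_left bform_scale_right swap
      by (simp add: power2_eq_square algebra_simps)
    finally show ?thesis .
  qed
  show ?thesis
  proof (cases "?a = 0")
    case True
    have "?b = 0"
    proof (cases "\<exists>x\<in>I. w x \<noteq> 0")
      case True
      then show ?thesis using pd \<open>?a = 0\<close> unfolding pos_def_def by fastforce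
    next
      case False
      then show ?thesis by (simp add: bform_def)
    qed
    then show ?thesis using True by simp
  next
    case False
    then have a: "?a > 0" using pos_def_nonneg[OF pd, of w] by simp
    \<comment> \<open>This is the minimizing combination \<open>u - (?b / ?a) * w\<close>, scaled by
      \<open>?a\<close> to avoid a division.\<close>
    from key[of ?a ?b] have "?a * (?a * ?c - ?b^2) \<ge> 0"
      by (simp add: power2_eq_square algebra_simps)
    then have "?a * ?c - ?b^2 \<ge> 0" using a by (simp add: zero_le_mult_iff)
    then show ?thesis by (simp add: mult.commute)
  qed
qed

section \<open>The zeta matrix as a quadratic form on the points\<close>

context
  fixes X :: "'a metric"
  assumes fin: "finite (mspace X)"
begin

lemma enum_points: "distinct (enum_points X)" "set (enum_points X) = mspace X"
proof -
  have "\<exists>xs. distinct xs \<and> set xs = mspace X"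
    using finite_distinct_list[OF fin] by blast
  then have "distinct (enum_points X) \<and> set (enum_points X) = mspace X"
    unfolding enum_points_def by (rule someI_ex)
  then show "distinct (enum_points X)" "set (enum_points X) = mspace X" by auto
qed

lemma length_enum_points: "length (enum_points X) = card (mspace X)"
  using enum_points distinct_card by metis

lemma enum_points_bij: "bij_betw ((!) (enum_points X)) {..<card (mspace X)} (mspace X)"
  using bij_betw_nth[OF enum_points(1) refl, of "mspace X"] enum_points(2) length_enum_points
  by simp

lemma sum_enum_points: "(\<Sum>i<card (mspace X). f (enum_points X ! i)) = (\<Sum>x\<in>mspace X. f x)"
  by (rule sum.reindex_bij_betw[OF enum_points_bij])

lemma zeta_matrix_mult_vec:
  assumes "i < card (mspace X)"
  shows "(zeta_matrix X *\<^sub>v vec (card (mspace X)) (\<lambda>i. u (enum_points X ! i))) $ i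
       = (\<Sum>y\<in>mspace X. sim X (enum_points X ! i) y * u y)"
proof -
  have "(zeta_matrix X *\<^sub>v vec (card (mspace X)) (\<lambda>i. u (enum_points X ! i))) $ i
     = (\<Sum>j<card (mspace X). sim X (enum_points X ! i) (enum_points X ! j) * u (enum_points X ! j))"
    using assms by (simp add: zeta_matrix_def scalar_prod_def sim_def lessThan_atLeast0)
  then show ?thesis by (simp only: sum_enum_points[of "\<lambda>y. sim X (enum_points X ! i) y * u y"])
qed

lemma vec_enum_points:
  assumes "v \<in> carrier_vec (card (mspace X))"
  obtains u where "v = vec (card (mspace X)) (\<lambda>i. u (enum_points X ! i))"
proof
  let ?g = "inv_into {..<card (mspace X)} ((!) (enum_points X))"
  show "v = vec (card (mspace X)) (\<lambda>i. (\<lambda>x. v $ ?g x) (enum_points X ! i))"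
    using assms bij_betw_inv_into_left[OF enum_points_bij] by (auto intro!: eq_vecI)
qed

lemma zeta_matrix_qform:
  fixes u :: "'a \<Rightarrow> real"
  defines "v \<equiv> \<lambda>u. vec (card (mspace X)) (\<lambda>i. u (enum_points X ! i))"
  shows "v u \<bullet> (zeta_matrix X *\<^sub>v v u) = qform (mspace X) (sim X) u"
proof -
  let ?n = "card (mspace X)" and ?e = "(!) (enum_points X)"
  have dim: "dim_vec (zeta_matrix X *\<^sub>v v u) = ?n" by (simp add: zeta_matrix_def)
  have "v u \<bullet> (zeta_matrix X *\<^sub>v v u) = (\<Sum>i<?n. u (?e i) * (zeta_matrix X *\<^sub>v v u) $ i)"
    unfolding scalar_prod_def dim lessThan_atLeast0 by (rule sum.cong) (auto simp: v_def)
  also have "\<dots> = (\<Sum>i<?n. (\<lambda>x. u x * (\<Sum>y\<in>mspace X. sim X x y * u y)) (?e i))"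
    unfolding v_def by (rule sum.cong) (auto simp: zeta_matrix_mult_vec)
  also have "\<dots> = (\<Sum>x\<in>mspace X. u x * (\<Sum>y\<in>mspace X. sim X x y * u y))"
    by (rule sum_enum_points)
  finally show ?thesis unfolding bform_def by (simp add: sum_distrib_left mult_ac)
qed

lemma vec_enum_points_eq_0:
  fixes u :: "'a \<Rightarrow> real"
  shows "vec (card (mspace X)) (\<lambda>i. u (enum_points X ! i)) = 0\<^sub>v (card (mspace X))
   \<longleftrightarrow> (\<forall>x\<in>mspace X. u x = 0)"
proof -
  have "vec (card (mspace X)) (\<lambda>i. u (enum_points X ! i)) = 0\<^sub>v (card (mspace X))
     \<longleftrightarrow> (\<forall>i<card (mspace X). u (enum_points X ! i) = 0)"
    by (auto simp: vec_eq_iff)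
  also have "\<dots> \<longleftrightarrow> (\<forall>x \<in> (!) (enum_points X) ` {..<card (mspace X)}. u x = 0)" by auto
  finally show ?thesis using enum_points_bij by (simp only: bij_betw_def)
qed

lemma zeta_matrix_carrier: "zeta_matrix X \<in> carrier_mat (card (mspace X)) (card (mspace X))"
  by (simp add: zeta_matrix_def)

lemma sim_commute: "sim X x y = sim X y x"
  by (simp add: sim_def mdist_commute)

lemma positive_definite_space_iff:
  "positive_definite_space X \<longleftrightarrow> pos_def (mspace X) (sim X)"
proof
  assume L: "positive_definite_space X"
  show "pos_def (mspace X) (sim X)"
    unfolding pos_def_def
  proof (intro allI impI)
    fix u :: "'a \<Rightarrow> real"
    assume "\<exists>x\<in>mspace X. u x \<noteq> 0"
    then have "vec (card (mspace X)) (\<lambda>i. u (enum_points X ! i)) \<noteq> 0\<^sub>v (card (mspace X))"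
      unfolding vec_enum_points_eq_0[of u] by auto
    with L show "qform (mspace X) (sim X) u > 0"
      unfolding positive_definite_space_def positive_definite_mat_def zeta_matrix_qform[symmetric]
      using zeta_matrix_carrier by auto
  qed
next
  assume R: "pos_def (mspace X) (sim X)"
  have "v \<bullet> (zeta_matrix X *\<^sub>v v) > 0"
    if v: "v \<in> carrier_vec (card (mspace X))" "v \<noteq> 0\<^sub>v (card (mspace X))" for v
  proof -
    obtain u where u: "v = vec (card (mspace X)) (\<lambda>i. u (enum_points X ! i))"
      using vec_enum_points[OF v(1)] .
    show ?thesis using v(2) R unfolding u zeta_matrix_qform vec_enum_points_eq_0 pos_def_def by auto
  qed
  moreover have "transpose_mat (zeta_matrix X) = zeta_matrix X"
    by (rule eq_matI) (auto simp: zeta_matrix_def mdist_commute)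
  ultimately show "positive_definite_space X"
    unfolding positive_definite_space_def positive_definite_mat_def
    using fin zeta_matrix_carrier by auto
qed

section \<open>Weightings and the variational formula for the magnitude\<close>

context
  assumes pd: "positive_definite_space X"
begin

text \<open>A kernel vector would have energy 0, so the determinant is nonzero and
  \<open>mat_inverse\<close> cannot return \<open>None\<close>. Thus the operator \<open>the\<close>
  in \<open>magnitude\<close> is applied to a genuine inverse.\<close>

lemma zeta_matrix_inverse:
  obtains B where "mat_inverse (zeta_matrix X) = Some B"
    "zeta_matrix X * B = 1\<^sub>m (card (mspace X))"
    "B \<in> carrier_mat (card (mspace X)) (card (mspace X))"
proof -
  let ?n = "card (mspace X)"
  have pdm: "\<And>v. v \<in> carrier_vec ?n \<Longrightarrow> v \<noteq> 0\<^sub>v ?n \<Longrightarrow> v \<bullet> (zeta_matrix X *\<^sub>v v) > 0"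
    using pd zeta_matrix_carrier
    unfolding positive_definite_space_def positive_definite_mat_def by auto
  have "det (zeta_matrix X) \<noteq> 0"
  proof
    assume "det (zeta_matrix X) = 0"
    then obtain v where "v \<in> carrier_vec ?n" "v \<noteq> 0\<^sub>v ?n" "zeta_matrix X *\<^sub>v v = 0\<^sub>v ?n"
      using det_0_iff_vec_prod_zero_field[OF zeta_matrix_carrier] by blast
    with pdm[of v] show False by simp
  qed
  then have "zeta_matrix X \<in> Units (ring_mat TYPE(real) ?n ())"
    by (rule det_non_zero_imp_unit[OF zeta_matrix_carrier])
  then obtain B where "mat_inverse (zeta_matrix X) = Some B"
    using mat_inverse(1)[OF zeta_matrix_carrier, where b = "()"] by (cases "mat_inverse (zeta_matrix X)") auto
  with mat_inverse(2)[OF zeta_matrix_carrier this] that show thesis by blast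
qed

text \<open>The right-hand side is arbitrary because two kinds are needed: the constant 1 gives the
  weighting, and indicators of points give the dual vectors behind \<open>l1_bound\<close>.\<close>

lemma weighting_exists: "\<exists>w. \<forall>x\<in>mspace X. (\<Sum>y\<in>mspace X. sim X x y * w y) = f x"
proof -
  let ?n = "card (mspace X)" and ?e = "(!) (enum_points X)"
  obtain B where B: "zeta_matrix X * B = 1\<^sub>m ?n" "B \<in> carrier_mat ?n ?n"
    using zeta_matrix_inverse by blast
  let ?f = "vec ?n (\<lambda>i. f (?e i))"
  have "B *\<^sub>v ?f \<in> carrier_vec ?n" using B(2) by auto
  then obtain w where w: "B *\<^sub>v ?f = vec ?n (\<lambda>i. w (?e i))" using vec_enum_points by blast
  have eq: "zeta_matrix X *\<^sub>v vec ?n (\<lambda>i. w (?e i)) = ?f"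
    unfolding w[symmetric]
    using assoc_mult_mat_vec[OF zeta_matrix_carrier B(2), of ?f] B(1) by simp
  have "(\<Sum>y\<in>mspace X. sim X x y * w y) = f x" if x: "x \<in> mspace X" for x
  proof -
    obtain i where i: "i < ?n" "x = ?e i"
      using x enum_points_bij unfolding bij_betw_def by auto
    have "(\<Sum>y\<in>mspace X. sim X x y * w y) = ?f $ i"
      using zeta_matrix_mult_vec[OF i(1), of w] unfolding eq i(2) by simp
    then show ?thesis using i by simp
  qed
  then show ?thesis by blast
qed

lemma magnitude_weighting:
  assumes w: "\<And>x. x \<in> mspace X \<Longrightarrow> (\<Sum>y\<in>mspace X. sim X x y * w y) = 1"
  shows "magnitude X = (\<Sum>x\<in>mspace X. w x)"
proof -
  let ?n = "card (mspace X)" and ?e = "(!) (enum_points X)"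
  obtain B where B: "mat_inverse (zeta_matrix X) = Some B"
    "zeta_matrix X * B = 1\<^sub>m ?n" "B \<in> carrier_mat ?n ?n"
    using zeta_matrix_inverse by blast
  have BZ: "B * zeta_matrix X = 1\<^sub>m ?n"
    using mat_inverse(2)[OF zeta_matrix_carrier B(1)] by simp
  let ?w = "vec ?n (\<lambda>i. w (?e i))" and ?one = "vec ?n (\<lambda>i. 1::real)"
  have Zw: "zeta_matrix X *\<^sub>v ?w = ?one"
  proof (rule eq_vecI)
    fix i assume "i < dim_vec ?one"
    then have i: "i < ?n" by simp
    then have "?e i \<in> mspace X" using enum_points_bij unfolding bij_betw_def by auto
    then show "(zeta_matrix X *\<^sub>v ?w) $ i = ?one $ i"
      unfolding zeta_matrix_mult_vec[OF i] using i w by simp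
  qed (simp add: zeta_matrix_def)
  have "B *\<^sub>v ?one = ?w"
    using assoc_mult_mat_vec[OF B(3) zeta_matrix_carrier, of ?w] BZ unfolding Zw by simp
  moreover have "(B *\<^sub>v ?one) $ i = (\<Sum>j<?n. B $$ (i, j))" if "i < ?n" for i
    using that B(3) by (simp add: scalar_prod_def lessThan_atLeast0)
  ultimately have row: "(\<Sum>j<?n. B $$ (i, j)) = w (?e i)" if "i < ?n" for i
    using that by fastforce
  have "magnitude X = (\<Sum>i<?n. \<Sum>j<?n. B $$ (i, j))"
    unfolding magnitude_def Let_def B(1) using B(3) by auto
  also have "\<dots> = (\<Sum>i<?n. w (?e i))" using row by (intro sum.cong) auto
  also have "\<dots> = (\<Sum>x\<in>mspace X. w x)" by (rule sum_enum_points)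
  finally show ?thesis .
qed

lemma pos_def_sim: "pos_def (mspace X) (sim X)"
  using pd positive_definite_space_iff by blast

text \<open>The weighting represents the functional "total mass" with respect to the form. Hence it
  is the equality case of the Cauchy-Schwarz argument in \<open>magnitude_bound\<close>.\<close>

lemma maximizing_weighting:
  obtains w where "(\<Sum>x\<in>mspace X. w x) = magnitude X"
    "qform (mspace X) (sim X) w = magnitude X"
    "\<And>v. bform (mspace X) (sim X) v w = (\<Sum>x\<in>mspace X. v x)"
proof -
  obtain w where w: "\<forall>x\<in>mspace X. (\<Sum>y\<in>mspace X. sim X x y * w y) = 1"
    using weighting_exists[of "\<lambda>_. 1"] by auto
  show thesis
  proof
    show 1: "(\<Sum>x\<in>mspace X. w x) = magnitude X"
      using magnitude_weighting[of w] w by simp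
    show 2: "bform (mspace X) (sim X) v w = (\<Sum>x\<in>mspace X. v x)" for v
      using bform_weighted[of "mspace X" "sim X" w "\<lambda>_. 1" v] w by simp
    show "qform (mspace X) (sim X) w = magnitude X" using 1 2[of w] by simp
  qed
qed

lemma magnitude_nonneg: "magnitude X \<ge> 0"
  using maximizing_weighting pos_def_nonneg[OF pos_def_sim] by metis

lemma magnitude_bound: "(\<Sum>x\<in>mspace X. v x)\<^sup>2 \<le> magnitude X * qform (mspace X) (sim X) v"
proof -
  obtain w where w: "(\<Sum>x\<in>mspace X. w x) = magnitude X"
    "qform (mspace X) (sim X) w = magnitude X"
    "\<And>v. bform (mspace X) (sim X) v w = (\<Sum>x\<in>mspace X. v x)"
    using maximizing_weighting by blast
  have "(bform (mspace X) (sim X) v w)\<^sup>2 \<le> qform (mspace X) (sim X) v * qform (mspace X) (sim X) w"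
    by (rule bform_Cauchy_Schwarz[OF pos_def_sim]) (rule sim_commute)
  then show ?thesis unfolding w by (simp add: mult.commute)
qed

text \<open>For the weighting, mass and energy both equal the magnitude \<open>M\<close>, so the
  hypothesis becomes \<open>c * M^2 \<le> M\<close>.\<close>

lemma magnitude_le:
  assumes "c > 0" "\<And>v. c * (\<Sum>x\<in>mspace X. v x)\<^sup>2 \<le> qform (mspace X) (sim X) v"
  shows "magnitude X \<le> 1 / c"
proof -
  obtain w where w: "(\<Sum>x\<in>mspace X. w x) = magnitude X"
    "qform (mspace X) (sim X) w = magnitude X" using maximizing_weighting by blast
  have "c * (magnitude X)\<^sup>2 \<le> magnitude X" using assms(2)[of w] w by simp
  then have "magnitude X * (1 - c * magnitude X) \<ge> 0"
    by (simp add: power2_eq_square algebra_simps)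
  then have "c * magnitude X \<le> 1"
    using magnitude_nonneg assms(1) by (cases "magnitude X = 0") (auto simp: zero_le_mult_iff)
  then show ?thesis using assms(1) by (simp add: field_simps)
qed

text \<open>Evaluation at a point is represented by a dual vector, so Cauchy-Schwarz bounds each
  coordinate by the form. Perturbation errors are measured in the l1 norm, and this constant, which
  depends on the limit space alone, turns them into relative errors.\<close>

lemma l1_bound: "\<exists>C>0. \<forall>v. (\<Sum>x\<in>mspace X. \<bar>v x\<bar>)\<^sup>2 \<le> C * qform (mspace X) (sim X) v"
proof -
  let ?I = "mspace X" and ?S = "sim X"
  have "\<forall>a\<in>?I. \<exists>w. \<forall>v. bform ?I ?S v w = v a"
  proof
    fix a assume a: "a \<in> ?I"
    obtain w where w: "\<forall>x\<in>?I. (\<Sum>y\<in>?I. ?S x y * w y) = (if x = a then 1 else 0)"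
      using weighting_exists[of "\<lambda>x. if x = a then 1 else 0"] by auto
    have "bform ?I ?S v w = v a" for v
    proof -
      have "bform ?I ?S v w = (\<Sum>x\<in>?I. (if x = a then 1 else 0) * v x)"
        using w by (intro bform_weighted) auto
      also have "\<dots> = (\<Sum>x\<in>?I. if x = a then v x else 0)" by (rule sum.cong) auto
      finally show ?thesis using a fin by simp
    qed
    then show "\<exists>w. \<forall>v. bform ?I ?S v w = v a" by blast
  qed
  then obtain w where w: "\<And>a v. a \<in> ?I \<Longrightarrow> bform ?I ?S v (w a) = v a" by metis
  define M where "M = (\<Sum>a\<in>?I. qform ?I ?S (w a))"
  have nn: "qform ?I ?S v \<ge> 0" for v by (rule pos_def_nonneg[OF pos_def_sim])
  have sq: "(v a)\<^sup>2 \<le> qform ?I ?S (w a) * qform ?I ?S v" if "a \<in> ?I" for a v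
    using bform_Cauchy_Schwarz[OF pos_def_sim, of v "w a"] sim_commute w[OF that, of v]
    by (simp add: mult.commute)
  \<comment> \<open>The summand 1 keeps the constant positive even for the empty space.\<close>
  have "(\<Sum>x\<in>?I. \<bar>v x\<bar>)\<^sup>2 \<le> (real (card ?I) * M + 1) * qform ?I ?S v" for v
  proof -
    have "(\<Sum>x\<in>?I. \<bar>v x\<bar>)\<^sup>2 \<le> real (card ?I) * (\<Sum>x\<in>?I. (v x)\<^sup>2)"
      using sum_squared_le_sum_of_squares[of "\<lambda>x. \<bar>v x\<bar>" ?I] by (simp add: mult.commute)
    also have "\<dots> \<le> real (card ?I) * (\<Sum>x\<in>?I. qform ?I ?S (w x) * qform ?I ?S v)"
      using sq by (intro mult_left_mono sum_mono) auto
    also have "\<dots> = real (card ?I) * M * qform ?I ?S v"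
      unfolding M_def by (simp add: sum_distrib_right)
    also have "\<dots> \<le> (real (card ?I) * M + 1) * qform ?I ?S v"
      using nn by (intro mult_right_mono) auto
    finally show ?thesis .
  qed
  moreover have "real (card ?I) * M + 1 > 0"
    unfolding M_def using nn by (simp add: add_nonneg_pos sum_nonneg)
  ultimately show ?thesis by blast
qed

end

end

section \<open>Gromov-Hausdorff distance of finite spaces\<close>

lemma mdist_self: "x \<in> mspace X \<Longrightarrow> mdist X x x = 0"
  by simp

section \<open>Gluing two spaces by prescribing cross-distances\<close>

fun glued_dist :: "('a \<Rightarrow> 'a \<Rightarrow> real) \<Rightarrow> ('b \<Rightarrow> 'b \<Rightarrow> real) \<Rightarrow> ('a \<Rightarrow> 'b \<Rightarrow> real) \<Rightarrow>
    'a + 'b \<Rightarrow> 'a + 'b \<Rightarrow> real" where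
  "glued_dist d d' c (Inl x) (Inl x') = d x x'"
| "glued_dist d d' c (Inl x) (Inr y) = c x y"
| "glued_dist d d' c (Inr y) (Inl x) = c x y"
| "glued_dist d d' c (Inr y) (Inr y') = d' y y'"

text \<open>Cross-distances are strictly positive because points of different summands are never
  equal. The other conditions are the triangle inequalities with two vertices in one space and one
  in the other.\<close>

definition gluing :: "'a metric \<Rightarrow> 'b metric \<Rightarrow> ('a \<Rightarrow> 'b \<Rightarrow> real) \<Rightarrow> bool" where
  "gluing X Y c \<longleftrightarrow> (\<forall>x y. c x y > 0) \<and>
     (\<forall>x\<in>mspace X. \<forall>x'\<in>mspace X. \<forall>y\<in>mspace Y.
        c x y \<le> mdist X x x' + c x' y \<and> mdist X x x' \<le> c x y + c x' y) \<and>
     (\<forall>x\<in>mspace X. \<forall>y\<in>mspace Y. \<forall>y'\<in>mspace Y.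
        c x y \<le> c x y' + mdist Y y y' \<and> mdist Y y y' \<le> c x y + c x y')"

lemma Metric_space_glued:
  assumes "gluing X Y c"
  shows "Metric_space (mspace X <+> mspace Y) (glued_dist (mdist X) (mdist Y) c)"
proof
  have pos: "c x y > 0" for x y using assms unfolding gluing_def by blast
  show "0 \<le> glued_dist (mdist X) (mdist Y) c p q" for p q
    using pos by (cases p; cases q) (auto intro: less_imp_le)
  show "glued_dist (mdist X) (mdist Y) c p q = glued_dist (mdist X) (mdist Y) c q p" for p q
    by (cases p; cases q) (auto simp: mdist_commute)
  show "(glued_dist (mdist X) (mdist Y) c p q = 0) = (p = q)"
    if "p \<in> mspace X <+> mspace Y" "q \<in> mspace X <+> mspace Y" for p q
    using that pos less_imp_neq[OF pos] by auto
  have 1: "c x y \<le> mdist X x x' + c x' y" "c x' y \<le> c x y + mdist X x x'"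
    "mdist X x x' \<le> c x y + c x' y"
    if "x \<in> mspace X" "x' \<in> mspace X" "y \<in> mspace Y" for x x' y
  proof -
    have "c x y \<le> mdist X x x' + c x' y \<and> mdist X x x' \<le> c x y + c x' y"
      using assms that unfolding gluing_def by blast
    moreover have "c x' y \<le> mdist X x' x + c x y"
      using assms that unfolding gluing_def by blast
    ultimately show "c x y \<le> mdist X x x' + c x' y" "c x' y \<le> c x y + mdist X x x'"
      "mdist X x x' \<le> c x y + c x' y"
      by (auto simp: mdist_commute[of X x' x] add.commute)
  qed
  have 2: "c x y \<le> mdist Y y y' + c x y'" "c x y' \<le> c x y + mdist Y y y'"
    "mdist Y y y' \<le> c x y + c x y'"
    if "x \<in> mspace X" "y \<in> mspace Y" "y' \<in> mspace Y" for x y y'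
  proof -
    have "c x y \<le> c x y' + mdist Y y y' \<and> mdist Y y y' \<le> c x y + c x y'"
      using assms that unfolding gluing_def by blast
    moreover have "c x y' \<le> c x y + mdist Y y' y"
      using assms that unfolding gluing_def by blast
    ultimately show "c x y \<le> mdist Y y y' + c x y'" "c x y' \<le> c x y + mdist Y y y'"
      "mdist Y y y' \<le> c x y + c x y'"
      by (auto simp: mdist_commute[of Y y' y] add.commute)
  qed
  show "glued_dist (mdist X) (mdist Y) c p s
      \<le> glued_dist (mdist X) (mdist Y) c p q + glued_dist (mdist X) (mdist Y) c q s"
    if "p \<in> mspace X <+> mspace Y" "q \<in> mspace X <+> mspace Y" "s \<in> mspace X <+> mspace Y" for p q s
    using that by (elim PlusE; hypsubst; simp add: mdist_triangle 1 2)
qed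

lemma finite_mspace_bounded:
  assumes "finite (mspace X)"
  obtains D where "D > 0" "\<And>x x'. x \<in> mspace X \<Longrightarrow> x' \<in> mspace X \<Longrightarrow> mdist X x x' < D"
proof
  let ?D = "1 + (\<Sum>x\<in>mspace X. \<Sum>x'\<in>mspace X. mdist X x x')"
  show "?D > 0" by (intro add_pos_nonneg sum_nonneg) auto
  fix x x' assume x: "x \<in> mspace X" "x' \<in> mspace X"
  have "mdist X x x' \<le> (\<Sum>x'\<in>mspace X. mdist X x x')"
    using x assms by (intro member_le_sum) auto
  also have "\<dots> \<le> (\<Sum>x\<in>mspace X. \<Sum>x'\<in>mspace X. mdist X x x')"
    using x assms by (intro member_le_sum sum_nonneg) auto
  finally show "mdist X x x' < ?D" by simp
qed

section \<open>Hausdorff distance of finite sets\<close>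

definition hausdorff_close :: "'a metric \<Rightarrow> 'a set \<Rightarrow> 'a set \<Rightarrow> real \<Rightarrow> bool" where
  "hausdorff_close Z A B \<epsilon> \<longleftrightarrow>
     (\<forall>a\<in>A. \<exists>b\<in>B. mdist Z a b < \<epsilon>) \<and> (\<forall>b\<in>B. \<exists>a\<in>A. mdist Z a b < \<epsilon>)"

lemma hausdorff_distance_alt:
  "hausdorff_distance Z A B = Inf {\<epsilon>. \<epsilon> > 0 \<and> hausdorff_close Z A B \<epsilon>}"
  by (simp add: hausdorff_distance_def hausdorff_close_def)

lemma hausdorff_distance_le:
  assumes "\<epsilon> > 0" "hausdorff_close Z A B \<epsilon>"
  shows "hausdorff_distance Z A B \<le> \<epsilon>"
  unfolding hausdorff_distance_alt by (rule cInf_lower) (use assms in \<open>auto intro!: bdd_belowI[of _ 0]\<close>)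

text \<open>Puts an element into the set whose infimum is the Hausdorff distance; the infimum of an
  empty set of reals would carry no information.\<close>

lemma hausdorff_close_exists:
  assumes "finite A" "finite B" "A \<noteq> {}" "B \<noteq> {}"
  shows "\<exists>\<epsilon>>0. hausdorff_close Z A B \<epsilon>"
proof -
  let ?D = "1 + (\<Sum>a\<in>A. \<Sum>b\<in>B. mdist Z a b)"
  have "mdist Z a b < ?D" if x: "a \<in> A" "b \<in> B" for a b
  proof -
    have "mdist Z a b \<le> (\<Sum>b\<in>B. mdist Z a b)"
      using x assms by (intro member_le_sum) auto
    also have "\<dots> \<le> (\<Sum>a\<in>A. \<Sum>b\<in>B. mdist Z a b)"
      using x assms by (intro member_le_sum[of a A "\<lambda>a. \<Sum>b\<in>B. mdist Z a b"] sum_nonneg) auto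
    finally show ?thesis by simp
  qed
  then have "hausdorff_close Z A B ?D" using assms unfolding hausdorff_close_def by blast
  moreover have "?D > 0" by (intro add_pos_nonneg sum_nonneg) auto
  ultimately show ?thesis by blast
qed

lemma hausdorff_distance_nonneg:
  assumes "finite A" "finite B" "A \<noteq> {}" "B \<noteq> {}"
  shows "hausdorff_distance Z A B \<ge> 0"
  unfolding hausdorff_distance_alt
  by (rule cInf_greatest) (use hausdorff_close_exists[OF assms, of Z] in auto)

lemma hausdorff_distance_lessD:
  assumes "finite A" "finite B" "A \<noteq> {}" "B \<noteq> {}" "hausdorff_distance Z A B < \<rho>"
  shows "hausdorff_close Z A B \<rho>"
proof -
  obtain \<epsilon> where "hausdorff_close Z A B \<epsilon>" "\<epsilon> < \<rho>"
    using cInf_lessD[OF _ assms(5)[unfolded hausdorff_distance_alt]]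
      hausdorff_close_exists[OF assms(1-4), of Z] by auto
  then show ?thesis unfolding hausdorff_close_def by (meson less_trans)
qed

section \<open>Gromov-Hausdorff distance: gluings from above, approximations from below\<close>

definition embedding_distances :: "'a metric \<Rightarrow> 'b metric \<Rightarrow> real set" where
  "embedding_distances X Y = {hausdorff_distance Z (f ` mspace X) (g ` mspace Y) |
     (Z :: ('a + 'b) metric) f g. isometric_embedding X Z f \<and> isometric_embedding Y Z g}"

lemma gromov_hausdorff_distance_alt:
  "gromov_hausdorff_distance X Y = Inf (embedding_distances X Y)"
  by (simp add: gromov_hausdorff_distance_def embedding_distances_def)

context
  fixes X :: "'a metric" and Y :: "'b metric"
  assumes fin: "finite (mspace X)" "finite (mspace Y)" "mspace X \<noteq> {}" "mspace Y \<noteq> {}"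
begin

text \<open>The sum type in the definition of the distance is the carrier of a gluing, with
  \<open>Inl\<close> and \<open>Inr\<close> as isometric embeddings.\<close>

lemma embedding_distances_gluing:
  assumes "gluing X Y c" "\<epsilon> > 0" "\<forall>x\<in>mspace X. \<exists>y\<in>mspace Y. c x y < \<epsilon>"
    "\<forall>y\<in>mspace Y. \<exists>x\<in>mspace X. c x y < \<epsilon>"
  shows "\<exists>\<delta>\<in>embedding_distances X Y. \<delta> \<le> \<epsilon>"
proof -
  interpret G: Metric_space "mspace X <+> mspace Y" "glued_dist (mdist X) (mdist Y) c"
    by (rule Metric_space_glued[OF assms(1)])
  let ?Z = "metric (mspace X <+> mspace Y, glued_dist (mdist X) (mdist Y) c)"
  have "isometric_embedding X ?Z Inl" "isometric_embedding Y ?Z Inr"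
    by (auto simp: isometric_embedding_def)
  then have "hausdorff_distance ?Z (Inl ` mspace X) (Inr ` mspace Y) \<in> embedding_distances X Y"
    unfolding embedding_distances_def by blast
  moreover have "hausdorff_close ?Z (Inl ` mspace X) (Inr ` mspace Y) \<epsilon>"
    using assms unfolding hausdorff_close_def by auto
  ultimately show ?thesis using hausdorff_distance_le[OF assms(2)] by blast
qed

lemma embedding_distances_nonneg: "\<delta> \<in> embedding_distances X Y \<Longrightarrow> \<delta> \<ge> 0"
  unfolding embedding_distances_def
  by (auto intro!: hausdorff_distance_nonneg simp: fin)

lemma embedding_distances_nonempty: "embedding_distances X Y \<noteq> {}"
proof -
  obtain D where D: "D > 0" "\<And>x x'. x \<in> mspace X \<Longrightarrow> x' \<in> mspace X \<Longrightarrow> mdist X x x' < D"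
    using finite_mspace_bounded fin(1) by blast
  obtain E where E: "E > 0" "\<And>x x'. x \<in> mspace Y \<Longrightarrow> x' \<in> mspace Y \<Longrightarrow> mdist Y x x' < E"
    using finite_mspace_bounded fin(2) by blast
  \<comment> \<open>A constant cross-distance is a gluing as soon as its double bounds both
    diameters.\<close>
  have "gluing X Y (\<lambda>_ _. D + E)"
    unfolding gluing_def
  proof (intro conjI ballI allI)
    show "mdist X x x' \<le> D + E + (D + E)" if "x \<in> mspace X" "x' \<in> mspace X" for x x'
      using D(2)[OF that] D(1) E(1) by linarith
    show "mdist Y y y' \<le> D + E + (D + E)" if "y \<in> mspace Y" "y' \<in> mspace Y" for y y'
      using E(2)[OF that] D(1) E(1) by linarith
  qed (use D(1) E(1) in auto)
  then have "\<exists>\<delta>\<in>embedding_distances X Y. \<delta> \<le> D + E + 1"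
    using fin D(1) E(1) by (intro embedding_distances_gluing) auto
  then show ?thesis by blast
qed

lemma gromov_hausdorff_distance_nonneg: "gromov_hausdorff_distance X Y \<ge> 0"
  unfolding gromov_hausdorff_distance_alt
  using embedding_distances_nonempty embedding_distances_nonneg by (rule cInf_greatest)

lemma gromov_hausdorff_distance_le:
  assumes "gluing X Y c" "\<epsilon> > 0" "\<forall>x\<in>mspace X. \<exists>y\<in>mspace Y. c x y < \<epsilon>"
    "\<forall>y\<in>mspace Y. \<exists>x\<in>mspace X. c x y < \<epsilon>"
  shows "gromov_hausdorff_distance X Y \<le> \<epsilon>"
proof -
  obtain \<delta> where \<delta>: "\<delta> \<in> embedding_distances X Y" "\<delta> \<le> \<epsilon>"
    using embedding_distances_gluing[OF assms] by blast
  have "gromov_hausdorff_distance X Y \<le> \<delta>"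
    unfolding gromov_hausdorff_distance_alt
    by (rule cInf_lower) (use \<delta> embedding_distances_nonneg in \<open>auto intro!: bdd_belowI[of _ 0]\<close>)
  then show ?thesis using \<delta> by simp
qed

text \<open>In the application \<open>X\<close> is the approximating space and \<open>Y\<close> the
  limit. A point \<open>y\<close> is within \<rho> of some \<open>x\<close>, which is within \<rho>
  of \<open>p x\<close>; as points of \<open>Y\<close> are \<open>2 * \<rho>\<close> apart,
  \<open>y = p x\<close>, so \<open>p\<close> is onto.\<close>

lemma gromov_hausdorff_approximation:
  assumes less: "gromov_hausdorff_distance X Y < \<rho>"
    and sep: "\<And>y y'. y \<in> mspace Y \<Longrightarrow> y' \<in> mspace Y \<Longrightarrow> y \<noteq> y' \<Longrightarrow> 2 * \<rho> \<le> mdist Y y y'"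
  obtains p where "p ` mspace X = mspace Y"
    "\<And>x x'. x \<in> mspace X \<Longrightarrow> x' \<in> mspace X \<Longrightarrow> \<bar>mdist X x x' - mdist Y (p x) (p x')\<bar> < 2 * \<rho>"
proof -
  obtain \<delta> where \<delta>: "\<delta> \<in> embedding_distances X Y" "\<delta> < \<rho>"
    using less embedding_distances_nonempty cInf_lessD unfolding gromov_hausdorff_distance_alt by blast
  then obtain Z :: "('a + 'b) metric" and f g where
    emb: "isometric_embedding X Z f" "isometric_embedding Y Z g"
    and h: "hausdorff_distance Z (f ` mspace X) (g ` mspace Y) < \<rho>"
    unfolding embedding_distances_def by blast
  define c where "c x y = mdist Z (f x) (g y)" for x y
  have close: "hausdorff_close Z (f ` mspace X) (g ` mspace Y) \<rho>"
    by (rule hausdorff_distance_lessD[OF _ _ _ _ h]) (use fin in auto)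
  then have "\<forall>x\<in>mspace X. \<exists>y\<in>mspace Y. c x y < \<rho>"
    unfolding hausdorff_close_def c_def by blast
  then obtain p where p: "\<And>x. x \<in> mspace X \<Longrightarrow> p x \<in> mspace Y" "\<And>x. x \<in> mspace X \<Longrightarrow> c x (p x) < \<rho>"
    by metis
  have dist: "\<bar>mdist X x x' - mdist Y y y'\<bar> \<le> c x y + c x' y'"
    if "x \<in> mspace X" "x' \<in> mspace X" "y \<in> mspace Y" "y' \<in> mspace Y" for x x' y y'
  proof -
    have Z: "f x \<in> mspace Z" "f x' \<in> mspace Z" "g y \<in> mspace Z" "g y' \<in> mspace Z"
      using that emb unfolding isometric_embedding_def by auto
    have "mdist X x x' = mdist Z (f x) (f x')" "mdist Y y y' = mdist Z (g y) (g y')"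
      using that emb unfolding isometric_embedding_def by auto
    moreover have "mdist Z (f x) (f x') \<le> c x y + (mdist Z (g y) (g y') + c x' y')"
      using mdist_triangle[OF Z(1,3,2)] mdist_triangle[OF Z(3,4,2)]
        mdist_commute[of Z "f x'"] unfolding c_def by auto
    moreover have "mdist Z (g y) (g y') \<le> c x y + (mdist Z (f x) (f x') + c x' y')"
      using mdist_triangle[OF Z(3,1,4)] mdist_triangle[OF Z(1,2,4)]
        mdist_commute[of Z "g y"] unfolding c_def by auto
    ultimately show ?thesis by linarith
  qed
  show thesis
  proof
    have "y \<in> p ` mspace X" if y: "y \<in> mspace Y" for y
    proof -
      obtain x where x: "x \<in> mspace X" "c x y < \<rho>"
        using close y unfolding hausdorff_close_def c_def by blast
      have "\<bar>mdist X x x - mdist Y y (p x)\<bar> < 2 * \<rho>"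
        using dist[OF x(1) x(1) y p(1)[OF x(1)]] x(2) p(2)[OF x(1)] by linarith
      moreover have "mdist X x x = 0" using x(1) by simp
      ultimately have "mdist Y y (p x) < 2 * \<rho>" by simp
      then have "y = p x" using sep[OF y p(1)[OF x(1)]] by force
      then show ?thesis using x(1) by blast
    qed
    then show "p ` mspace X = mspace Y" using p(1) by blast
    show "\<bar>mdist X x x' - mdist Y (p x) (p x')\<bar> < 2 * \<rho>" if "x \<in> mspace X" "x' \<in> mspace X" for x x'
      using dist[OF that p(1)[OF that(1)] p(1)[OF that(2)]] p(2)[OF that(1)] p(2)[OF that(2)] by linarith
  qed
qed

end

section \<open>Stability of the magnitude\<close>

definition similarity :: "'i set \<Rightarrow> ('i \<Rightarrow> 'i \<Rightarrow> real) \<Rightarrow> bool" where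
  "similarity I S \<longleftrightarrow>
     (\<forall>x\<in>I. S x x = 1) \<and> (\<forall>x\<in>I. \<forall>y\<in>I. S x y = S y x \<and> 0 < S x y \<and> S x y \<le> 1) \<and>
     (\<forall>x\<in>I. \<forall>y\<in>I. \<forall>z\<in>I. S x y * S y z \<le> S x z)"

lemma similarity_sim: "similarity (mspace X) (sim X)"
  unfolding similarity_def sim_def
proof (intro conjI ballI)
  show "exp (- mdist X x y) * exp (- mdist X y z) \<le> exp (- mdist X x z)"
    if "x \<in> mspace X" "y \<in> mspace X" "z \<in> mspace X" for x y z
    using mdist_triangle[OF that] by (simp flip: exp_add)
qed (auto simp: mdist_commute)
lemma similarityD:
  assumes "similarity I S" "x \<in> I" "y \<in> I"
  shows "S x x = 1" "S x y = S y x" "0 < S x y" "S x y \<le> 1"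
    "z \<in> I \<Longrightarrow> S x y * S y z \<le> S x z"
  using assms unfolding similarity_def by blast+

text \<open>The factor \<open>max (S e z) (S q z)\<close> improves on the Lipschitz bound
  \<open>1 - S e q\<close>. It is at most \<tau> < 1 when \<open>z\<close> lies over another limit
  point, and so keeps the interaction of dipoles over different points strictly below their
  self-energies.\<close>

lemma similarity_diff_le:
  assumes "similarity I S" "e \<in> I" "q \<in> I" "z \<in> I"
  shows "\<bar>S e z - S q z\<bar> \<le> max (S e z) (S q z) * (1 - S e q)"
proof -
  have "S e q * S q z \<le> S e z" "S q e * S e z \<le> S q z" "S q e = S e q" "S e q \<le> 1"
    using assms similarityD by metis+
  then have "S q z - S e z \<le> S q z * (1 - S e q)" "S e z - S q z \<le> S e z * (1 - S e q)"
    by (simp_all add: algebra_simps)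
  moreover have "S q z * (1 - S e q) \<le> max (S e z) (S q z) * (1 - S e q)"
    "S e z * (1 - S e q) \<le> max (S e z) (S q z) * (1 - S e q)"
    using \<open>S e q \<le> 1\<close> by (auto intro: mult_right_mono)
  ultimately show ?thesis by linarith
qed

text \<open>Expanding \<open>(1 - S x y) * (1 - S y z) \<ge> 0\<close> makes the multiplicative
  triangle inequality additive. The tripod and cut arguments are then applied to the pseudometric
  \<open>1 - S\<close>.\<close>

lemma similarity_complement_triangle:
  assumes "similarity I S" "x \<in> I" "y \<in> I" "z \<in> I"
  shows "1 - S x z \<le> (1 - S x y) + (1 - S y z)"
proof -
  have "S x y * S y z \<le> S x z" "(1 - S x y) * (1 - S y z) \<ge> 0"
    using similarityD[OF assms(1)] assms by auto
  then show ?thesis by (simp add: algebra_simps)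
qed

lemma sum_sq_le3: "(x + y + z)\<^sup>2 \<le> 3 * (x\<^sup>2 + y\<^sup>2 + z\<^sup>2)" for x y z :: real
proof -
  have "0 \<le> (x - y)\<^sup>2 + (y - z)\<^sup>2 + (x - z)\<^sup>2" by simp
  then show ?thesis by (simp add: power2_eq_square algebra_simps)
qed

text \<open>For two dipoles at the same representative: \<open>a\<close>, \<open>b\<close>,
  \<open>c\<close> are the \<open>1 - S\<close> distances among the representative and the two extra
  points, \<open>D1\<close> and \<open>D2\<close> the changes of potential at some point,
  \<open>s1\<close> and \<open>s2\<close> the moved masses. The last factor is the energy of the
  dipoles.\<close>

lemma tripod_bound:
  fixes a b c D1 D2 s1 s2 \<eta> :: real
  assumes tri: "c \<le> a + b" "a \<le> b + c" "b \<le> a + c" and le: "a \<le> \<eta>" "b \<le> \<eta>"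
    and D: "\<bar>D1\<bar> \<le> a" "\<bar>D2\<bar> \<le> b" "\<bar>D1 - D2\<bar> \<le> c"
  shows "(s1 * D1 + s2 * D2)\<^sup>2 \<le> (3 / 2 * \<eta>) * (2 * s1\<^sup>2 * a + 2 * s2\<^sup>2 * b + 2 * s1 * s2 * (a + b - c))"
proof -
  \<comment> \<open>A metric on three points is a tripod with these legs; Helly's theorem for intervals
    gives the value \<open>m\<close> at its centre.\<close>
  define p q r where "p = (a + b - c) / 2" and "q = (a + c - b) / 2" and "r = (b + c - a) / 2"
  have abc: "a = p + q" "b = p + r" "c = q + r" by (simp_all add: p_def q_def r_def field_simps)
  have nn: "p \<ge> 0" "q \<ge> 0" "r \<ge> 0" using tri by (simp_all add: p_def q_def r_def)
  define m where "m = max (- p) (max (D1 - q) (D2 - r))"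
  have m: "\<bar>m\<bar> \<le> p" "\<bar>D1 - m\<bar> \<le> q" "\<bar>D2 - m\<bar> \<le> r"
    using D nn unfolding m_def abc by linarith+
  have le': "p \<le> \<eta>" "q \<le> \<eta>" "r \<le> \<eta>" using le nn abc by linarith+
  have sq: "t\<^sup>2 * x\<^sup>2 \<le> \<eta> * (t\<^sup>2 * y)" if "\<bar>x\<bar> \<le> y" "y \<le> \<eta>" for t x y :: real
  proof -
    have "x\<^sup>2 \<le> y\<^sup>2" using that by (metis abs_le_square_iff abs_ge_zero abs_of_nonneg order_trans)
    also have "\<dots> \<le> \<eta> * y" using that by (auto simp: power2_eq_square intro: mult_right_mono)
    finally show ?thesis using mult_left_mono[of "x\<^sup>2" "\<eta> * y" "t\<^sup>2"] by (simp add: mult_ac)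
  qed
  \<comment> \<open>Each summand is now controlled by one leg of the tripod, and the energy is
    \<open>2 * (p * (s1 + s2)^2 + q * s1^2 + r * s2^2)\<close>, with the same coefficients.\<close>
  have "s1 * D1 + s2 * D2 = (s1 + s2) * m + s1 * (D1 - m) + s2 * (D2 - m)"
    by (simp add: algebra_simps)
  then have "(s1 * D1 + s2 * D2)\<^sup>2
      \<le> 3 * (((s1 + s2) * m)\<^sup>2 + (s1 * (D1 - m))\<^sup>2 + (s2 * (D2 - m))\<^sup>2)"
    using sum_sq_le3 by metis
  also have "\<dots> \<le> 3 * (\<eta> * ((s1 + s2)\<^sup>2 * p) + \<eta> * (s1\<^sup>2 * q) + \<eta> * (s2\<^sup>2 * r))"
    unfolding power_mult_distrib
    by (intro mult_left_mono add_mono sq) (use m le' in auto)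
  also have "\<dots> = (3 / 2 * \<eta>) * (2 * s1\<^sup>2 * a + 2 * s2\<^sup>2 * b + 2 * s1 * s2 * (a + b - c))"
    unfolding abc by (simp add: power2_eq_square algebra_simps)
  finally show ?thesis .
qed

text \<open>By \<open>2 * \<bar>s1 * s2\<bar> \<le> s1^2 + s2^2\<close> and the two bounds on
  \<open>g\<close>, the cross term takes at most the fraction \<tau> of the self-energies, so the
  fraction \<open>1 - \<tau>\<close> remains.\<close>

lemma separated_bound:
  fixes a b g D1 D2 s1 s2 \<eta> \<tau> :: real
  assumes \<tau>: "0 \<le> \<tau>" "\<tau> < 1" and le: "0 \<le> a" "a \<le> \<eta>" "0 \<le> b" "b \<le> \<eta>"
    and g: "\<bar>g\<bar> \<le> 2 * \<tau> * a" "\<bar>g\<bar> \<le> 2 * \<tau> * b"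
    and D: "\<bar>D1\<bar> \<le> a" "\<bar>D2\<bar> \<le> b"
  shows "(s1 * D1 + s2 * D2)\<^sup>2 \<le> (\<eta> / (1 - \<tau>)) * (2 * s1\<^sup>2 * a + 2 * s2\<^sup>2 * b + 2 * s1 * s2 * g)"
proof -
  have sq: "(s * D)\<^sup>2 \<le> \<eta> * (s\<^sup>2 * x)" if "\<bar>D\<bar> \<le> x" "0 \<le> x" "x \<le> \<eta>" for s D x :: real
  proof -
    have "D\<^sup>2 \<le> x\<^sup>2" using that by (metis abs_le_square_iff abs_of_nonneg)
    also have "\<dots> \<le> \<eta> * x" using that by (auto simp: power2_eq_square intro: mult_right_mono)
    finally show ?thesis using mult_left_mono[of "D\<^sup>2" "\<eta> * x" "s\<^sup>2"] by (simp add: power_mult_distrib mult_ac)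
  qed
  have "(s1 * D1 + s2 * D2)\<^sup>2 \<le> 2 * ((s1 * D1)\<^sup>2 + (s2 * D2)\<^sup>2)"
    using zero_le_power2[of "s1 * D1 - s2 * D2"] by (simp add: power2_eq_square algebra_simps)
  also have "\<dots> \<le> 2 * (\<eta> * (s1\<^sup>2 * a) + \<eta> * (s2\<^sup>2 * b))"
    by (intro mult_left_mono add_mono sq) (use D le in auto)
  also have "\<dots> = (\<eta> / (1 - \<tau>)) * ((1 - \<tau>) * (2 * s1\<^sup>2 * a + 2 * s2\<^sup>2 * b))"
    using \<tau> by (simp add: field_simps)
  also have "\<dots> \<le> (\<eta> / (1 - \<tau>)) * (2 * s1\<^sup>2 * a + 2 * s2\<^sup>2 * b + 2 * s1 * s2 * g)"
  proof (intro mult_left_mono)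
    have "\<bar>2 * s1 * s2 * g\<bar> \<le> (s1\<^sup>2 + s2\<^sup>2) * \<bar>g\<bar>"
    proof -
      have "2 * \<bar>s1\<bar> * \<bar>s2\<bar> \<le> s1\<^sup>2 + s2\<^sup>2"
        using zero_le_power2[of "\<bar>s1\<bar> - \<bar>s2\<bar>"] by (simp add: power2_eq_square algebra_simps)
      from mult_right_mono[OF this, of "\<bar>g\<bar>"] show ?thesis by (simp add: abs_mult)
    qed
    also have "\<dots> = s1\<^sup>2 * \<bar>g\<bar> + s2\<^sup>2 * \<bar>g\<bar>" by (simp add: algebra_simps)
    also have "\<dots> \<le> s1\<^sup>2 * (2 * \<tau> * a) + s2\<^sup>2 * (2 * \<tau> * b)"
      by (intro add_mono mult_left_mono g) auto
    finally show "(1 - \<tau>) * (2 * s1\<^sup>2 * a + 2 * s2\<^sup>2 * b) \<le> 2 * s1\<^sup>2 * a + 2 * s2\<^sup>2 * b + 2 * s1 * s2 * g"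
      by (simp add: algebra_simps)
  qed (use le \<tau> in auto)
  finally show ?thesis .
qed

text \<open>One choice of points and coefficients serves every \<open>f\<close>, so it can be
  applied to potentials and to energies alike. Fewer than two outside points are covered by
  repeating a point and by zero coefficients.\<close>

lemma sum_two_outside:
  fixes v :: "'i \<Rightarrow> real"
  assumes "finite I" "I \<noteq> {}" "card (I - K) \<le> 2"
  obtains e1 e2 s1 s2 where "e1 \<in> I" "e2 \<in> I"
    "\<forall>f :: 'i \<Rightarrow> real. (\<forall>x\<in>I \<inter> K. f x = 0) \<longrightarrow> (\<Sum>x\<in>I. v x * f x) = s1 * f e1 + s2 * f e2"
proof -
  have E: "(\<Sum>x\<in>I. v x * f x) = (\<Sum>x\<in>I - K. v x * f x)"
    if "\<And>x. x \<in> I \<Longrightarrow> x \<in> K \<Longrightarrow> f x = 0" for f :: "'i \<Rightarrow> real"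
    by (rule sum.mono_neutral_right) (use assms(1) that in auto)
  obtain e where e: "e \<in> I" using assms(2) by blast
  consider "card (I - K) = 0" | "card (I - K) = 1" | "card (I - K) = 2" using assms(3) by linarith
  then show thesis
  proof cases
    case 1
    then have "I - K = {}" using assms(1) by simp
    with E show thesis by (intro that[OF e e, of 0 0]) auto
  next
    case 2
    then obtain e1 where e1: "I - K = {e1}" by (rule card_1_singletonE)
    show thesis
    proof (rule that)
      show "e1 \<in> I" "e1 \<in> I" using e1 by auto
      show "\<forall>f. (\<forall>x\<in>I \<inter> K. f x = 0) \<longrightarrow> (\<Sum>x\<in>I. v x * f x) = v e1 * f e1 + 0 * f e1"
        using E e1 by simp
    qed
  next
    case 3
    then obtain e1 e2 where e12: "I - K = {e1, e2}" "e1 \<noteq> e2" by (auto simp: card_2_iff)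
    show thesis
    proof (rule that)
      show "e1 \<in> I" "e2 \<in> I" using e12 by auto
      show "\<forall>f. (\<forall>x\<in>I \<inter> K. f x = 0) \<longrightarrow> (\<Sum>x\<in>I. v x * f x) = v e1 * f e1 + v e2 * f e2"
        using E e12 by simp
    qed
  qed
qed

lemma qform_diff_le:
  assumes "finite I" "\<And>x y. x \<in> I \<Longrightarrow> y \<in> I \<Longrightarrow> \<bar>S x y - T x y\<bar> \<le> \<eta>"
  shows "\<bar>qform I S v - qform I T v\<bar> \<le> \<eta> * (\<Sum>x\<in>I. \<bar>v x\<bar>)\<^sup>2"
proof -
  have "qform I S v - qform I T v = (\<Sum>x\<in>I. \<Sum>y\<in>I. (S x y - T x y) * v x * v y)"
    by (simp add: bform_def sum_subtractf left_diff_distrib)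
  also have "\<bar>\<dots>\<bar> \<le> (\<Sum>x\<in>I. \<Sum>y\<in>I. \<bar>(S x y - T x y) * v x * v y\<bar>)"
    by (intro order_trans[OF sum_abs] sum_mono order_refl)
  also have "\<dots> \<le> (\<Sum>x\<in>I. \<Sum>y\<in>I. \<eta> * \<bar>v x\<bar> * \<bar>v y\<bar>)"
    unfolding abs_mult by (intro sum_mono mult_right_mono assms) auto
  also have "\<dots> = \<eta> * (\<Sum>x\<in>I. \<bar>v x\<bar>)\<^sup>2"
    by (simp add: power2_eq_square sum_product sum_distrib_left mult_ac)
  finally show ?thesis .
qed

lemma sum_pushforward:
  fixes v :: "'i \<Rightarrow> real"
  assumes "finite I" "finite J" "p ` I \<subseteq> J"
  shows "(\<Sum>x\<in>I. v x * f (p x)) = (\<Sum>j\<in>J. (\<Sum>x\<in>{x\<in>I. p x = j}. v x) * f j)"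
proof -
  have "(\<Sum>x\<in>I. v x * f (p x)) = (\<Sum>j\<in>J. \<Sum>x\<in>{x\<in>I. p x = j}. v x * f (p x))"
    using sum.group[OF assms, of "\<lambda>x. v x * f (p x)"] by simp
  also have "\<dots> = (\<Sum>j\<in>J. (\<Sum>x\<in>{x\<in>I. p x = j}. v x) * f j)"
    by (simp add: sum_distrib_right)
  finally show ?thesis .
qed

section \<open>Moving mass to chosen representatives\<close>

locale approximation_pair =
  fixes I :: "'i set" and S :: "'i \<Rightarrow> 'i \<Rightarrow> real"
    and J :: "'j set" and T :: "'j \<Rightarrow> 'j \<Rightarrow> real" and p :: "'i \<Rightarrow> 'j" and \<eta> \<tau> :: real
  assumes fin: "finite I" and S: "similarity I S" and T: "\<And>j. j \<in> J \<Longrightarrow> T j j = 1"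
    and p: "p ` I = J"
    and close: "\<And>x y. x \<in> I \<Longrightarrow> y \<in> I \<Longrightarrow> \<bar>S x y - T (p x) (p y)\<bar> \<le> \<eta>"
    and sep: "\<And>x y. x \<in> I \<Longrightarrow> y \<in> I \<Longrightarrow> p x \<noteq> p y \<Longrightarrow> S x y \<le> \<tau>"
    and \<tau>: "0 \<le> \<tau>" "\<tau> < 1" and ne: "I \<noteq> {}"
begin

definition y :: "'j \<Rightarrow> 'i" where "y = (SOME y. \<forall>j\<in>J. y j \<in> I \<and> p (y j) = j)"

lemma y: "j \<in> J \<Longrightarrow> y j \<in> I" "j \<in> J \<Longrightarrow> p (y j) = j"
proof -
  have "\<exists>y. \<forall>j\<in>J. y j \<in> I \<and> p (y j) = j" using p by (intro bchoice) auto
  then have "\<forall>j\<in>J. y j \<in> I \<and> p (y j) = j" unfolding y_def by (rule someI_ex)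
  then show "j \<in> J \<Longrightarrow> y j \<in> I" "j \<in> J \<Longrightarrow> p (y j) = j" by auto
qed

lemma finJ: "finite J" using fin p by blast

lemma eta_nonneg: "\<eta> \<ge> 0" using close ne by (meson abs_ge_zero ex_in_conv order_trans)

definition q :: "'i \<Rightarrow> 'i" where "q x = y (p x)"

lemma q: "x \<in> I \<Longrightarrow> q x \<in> I" "x \<in> I \<Longrightarrow> p (q x) = p x"
  using y p unfolding q_def by auto

lemma q_fixed: "x \<in> y ` J \<Longrightarrow> q x = x"
  using y unfolding q_def by auto

lemma inj_y: "inj_on y J" using y by (metis inj_onI)

lemma same_fibre:
  assumes "x \<in> I" shows "0 \<le> 1 - S x (q x)" "1 - S x (q x) \<le> \<eta>"
proof -
  have "p x \<in> J" using assms p by blast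
  then show "1 - S x (q x) \<le> \<eta>"
    using close[OF assms q(1)[OF assms]] q(2)[OF assms] T by (auto simp: abs_le_iff)
  show "0 \<le> 1 - S x (q x)" using similarityD(4)[OF S assms q(1)[OF assms]] by simp
qed

definition D :: "'i \<Rightarrow> 'i \<Rightarrow> real" where "D x z = S x z - S (q x) z"

definition g :: "'i \<Rightarrow> 'i \<Rightarrow> real" where "g x x' = D x x' - D x (q x')"

definition push :: "('i \<Rightarrow> real) \<Rightarrow> 'j \<Rightarrow> real" where "push v j = (\<Sum>x\<in>{x\<in>I. p x = j}. v x)"

lemma D_le:
  assumes "x \<in> I" "z \<in> I" shows "\<bar>D x z\<bar> \<le> 1 - S x (q x)"
proof -
  have "\<bar>D x z\<bar> \<le> max (S x z) (S (q x) z) * (1 - S x (q x))"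
    unfolding D_def using similarity_diff_le[OF S assms(1) q(1)[OF assms(1)] assms(2)] .
  also have "\<dots> \<le> 1 * (1 - S x (q x))"
    using similarityD(4)[OF S] assms q same_fibre by (intro mult_right_mono) auto
  finally show ?thesis by simp
qed

text \<open>\<open>q x\<close> lies in the fibre of \<open>x\<close> and is thus separated from
  \<open>z\<close> too, so both similarities in the maximum of \<open>similarity_diff_le\<close> are
  at most \<tau>.\<close>

lemma D_le_separated:
  assumes "x \<in> I" "z \<in> I" "p x \<noteq> p z" shows "\<bar>D x z\<bar> \<le> \<tau> * (1 - S x (q x))"
proof -
  have "\<bar>D x z\<bar> \<le> max (S x z) (S (q x) z) * (1 - S x (q x))"
    unfolding D_def using similarity_diff_le[OF S assms(1) q(1)[OF assms(1)] assms(2)] .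
  also have "\<dots> \<le> \<tau> * (1 - S x (q x))"
    using sep assms q same_fibre by (intro mult_right_mono) auto
  finally show ?thesis .
qed

lemma g_sym: "x \<in> I \<Longrightarrow> x' \<in> I \<Longrightarrow> g x x' = g x' x"
  unfolding g_def D_def using similarityD(2)[OF S] q by (smt (verit))

lemma g_diag: "x \<in> I \<Longrightarrow> g x x = 2 * (1 - S x (q x))"
  unfolding g_def D_def using similarityD[OF S] q by (smt (verit))

lemma push_total: "(\<Sum>j\<in>J. push v j) = (\<Sum>x\<in>I. v x)"
  using sum_pushforward[OF fin finJ, of p v "\<lambda>_. 1"] p by (simp add: push_def)

text \<open>Move the mass of each point \<open>x\<close> to the chosen point \<open>q x\<close> of its fibre. \<open>D x\<close> is the change of the
  potential and \<open>g\<close> the energy of the dipoles created in this way; both vanish at chosen points.\<close>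

lemma qform_decomposition:
  "qform I S v = (\<Sum>x\<in>I. v x * (\<Sum>x'\<in>I. v x' * g x x'))
     + 2 * (\<Sum>j\<in>J. push v j * (\<Sum>x\<in>I. v x * D x (y j)))
     + qform J (\<lambda>i j. S (y i) (y j)) (push v)"
proof -
  have "S x x' * v x * v x' = v x * (v x' * g x x') + v x' * (v x * D x (q x'))
      + v x * (v x' * D x' (q x)) + v x * (v x' * S (q x) (q x'))"
    if "x \<in> I" "x' \<in> I" for x x'
  proof -
    have "S x x' = g x x' + D x (q x') + D x' (q x) + S (q x) (q x')"
      unfolding g_def D_def
      using similarityD(2)[OF S, of x' "q x"] similarityD(2)[OF S, of "q x'" "q x"] q that by simp
    then show ?thesis by (simp add: algebra_simps)
  qed
  then have "qform I S v = (\<Sum>x\<in>I. \<Sum>x'\<in>I. v x * (v x' * g x x') + v x' * (v x * D x (q x'))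
      + v x * (v x' * D x' (q x)) + v x * (v x' * S (q x) (q x')))"
    unfolding bform_def by (intro sum.cong refl) auto
  also have "\<dots> = (\<Sum>x\<in>I. v x * (\<Sum>x'\<in>I. v x' * g x x'))
      + (\<Sum>x\<in>I. \<Sum>x'\<in>I. v x' * (v x * D x (q x')))
      + (\<Sum>x\<in>I. v x * (\<Sum>x'\<in>I. v x' * D x' (q x)))
      + (\<Sum>x\<in>I. v x * (\<Sum>x'\<in>I. v x' * S (q x) (q x')))"
    by (simp add: sum.distrib sum_distrib_left)
  also have "(\<Sum>x\<in>I. \<Sum>x'\<in>I. v x' * (v x * D x (q x')))
      = (\<Sum>x'\<in>I. v x' * (\<Sum>x\<in>I. v x * D x (q x')))"
    by (subst sum.swap) (simp add: sum_distrib_left)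
  also have "(\<Sum>x'\<in>I. v x' * (\<Sum>x\<in>I. v x * D x (q x')))
      = (\<Sum>j\<in>J. push v j * (\<Sum>x\<in>I. v x * D x (y j)))"
    using sum_pushforward[OF fin finJ, of p v "\<lambda>j. \<Sum>x\<in>I. v x * D x (y j)"] p
    by (simp add: push_def q_def)
  also have "(\<Sum>x\<in>I. v x * (\<Sum>x'\<in>I. v x' * S (q x) (q x')))
      = (\<Sum>j\<in>J. push v j * (\<Sum>x'\<in>I. v x' * S (y j) (q x')))"
    using sum_pushforward[OF fin finJ, of p v "\<lambda>j. \<Sum>x'\<in>I. v x' * S (y j) (q x')"] p
    by (simp add: push_def q_def)
  also have "\<dots> = (\<Sum>i\<in>J. push v i * (\<Sum>j\<in>J. push v j * S (y i) (y j)))"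
    using sum_pushforward[OF fin finJ, of p v "\<lambda>j. S (y i) (y j)" for i] p
    by (simp add: push_def q_def)
  also have "\<dots> = qform J (\<lambda>i j. S (y i) (y j)) (push v)"
    unfolding bform_def by (simp add: sum_distrib_left mult_ac)
  finally show ?thesis by (simp add: algebra_simps)
qed

text \<open>The square of the dipole potential is O(\<eta>) times the dipole energy, which is what
  allows completing the square in \<open>qform_lower_bound\<close>.\<close>

lemma two_point_bound:
  assumes e: "e1 \<in> I" "e2 \<in> I" and z: "z \<in> I"
  shows "(s1 * D e1 z + s2 * D e2 z)\<^sup>2
    \<le> (2 * \<eta> / (1 - \<tau>)) * (s1\<^sup>2 * g e1 e1 + s2\<^sup>2 * g e2 e2 + 2 * s1 * s2 * g e1 e2)"
    (is "?l \<le> _ * ?G")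
    and "0 \<le> s1\<^sup>2 * g e1 e1 + s2\<^sup>2 * g e2 e2 + 2 * s1 * s2 * g e1 e2"
proof -
  let ?a = "1 - S e1 (q e1)" and ?b = "1 - S e2 (q e2)"
  note ab = same_fibre[OF e(1)] same_fibre[OF e(2)]
  note qe = q(1)[OF e(1)] q(1)[OF e(2)]
  have G: "?G = 2 * s1\<^sup>2 * ?a + 2 * s2\<^sup>2 * ?b + 2 * s1 * s2 * g e1 e2"
    unfolding g_diag[OF e(1)] g_diag[OF e(2)] by (simp add: algebra_simps)
  \<comment> \<open>The constants are \<open>3 / 2\<close> within one fibre and
    \<open>1 / (1 - \<tau>)\<close> across fibres; \<open>2 / (1 - \<tau>)\<close> dominates
    both.\<close>
  have "\<exists>\<theta>>0. \<theta> \<le> 2 / (1 - \<tau>) \<and> ?l \<le> (\<theta> * \<eta>) * ?G \<and> ?G \<ge> 0"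
  proof (cases "p e1 = p e2")
    case True
    then have qq: "q e2 = q e1" by (simp add: q_def)
    let ?c = "1 - S e1 e2"
    have g12: "g e1 e2 = ?a + ?b - ?c"
      using similarityD(1)[OF S qe(1) qe(1)] similarityD(2)[OF S e(2) qe(1)]
      unfolding g_def D_def qq by simp
    have tri: "?c \<le> ?a + ?b" "?a \<le> ?b + ?c" "?b \<le> ?a + ?c"
      using similarity_complement_triangle[OF S e(1) qe(1) e(2)]
        similarity_complement_triangle[OF S e(1) e(2) qe(1)]
        similarity_complement_triangle[OF S e(2) e(1) qe(1)]
        similarityD(2)[OF S] e qe qq by (smt (verit))+
    have "\<bar>D e1 z - D e2 z\<bar> \<le> ?c"
    proof -
      have "\<bar>S e1 z - S e2 z\<bar> \<le> max (S e1 z) (S e2 z) * ?c"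
        by (rule similarity_diff_le[OF S e z])
      also have "\<dots> \<le> 1 * ?c"
        using similarityD(4)[OF S] e z by (intro mult_right_mono) auto
      finally show ?thesis unfolding D_def qq by simp
    qed
    then have "?l \<le> (3 / 2 * \<eta>) * ?G"
      unfolding G unfolding g12 using tri D_le[OF e(1) z] D_le[OF e(2) z] ab by (intro tripod_bound) auto
    \<comment> \<open>The coefficients are twice the legs of the tripod, so the energy is visibly
      nonnegative.\<close>
    moreover have "?G = (?a + ?b - ?c) * (s1 + s2)\<^sup>2 + (?a + ?c - ?b) * s1\<^sup>2 + (?b + ?c - ?a) * s2\<^sup>2"
      unfolding G unfolding g12 by (simp add: power2_eq_square algebra_simps)
    then have "?G \<ge> 0" using tri by simp
    moreover have "3 / 2 \<le> 2 / (1 - \<tau>)" using \<tau> by (simp add: field_simps)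
    ultimately show ?thesis by (intro exI[of _ "3/2"]) auto
  next
    case False
    have g1: "\<bar>g e1 e2\<bar> \<le> 2 * \<tau> * ?a"
      using D_le_separated[OF e False] D_le_separated[OF e(1) qe(2)] False
      unfolding g_def q(2)[OF e(2)] by linarith
    have "\<bar>g e2 e1\<bar> \<le> 2 * \<tau> * ?b"
      using D_le_separated[OF e(2,1)] D_le_separated[OF e(2) qe(1)] False[symmetric]
      unfolding g_def q(2)[OF e(1)] by linarith
    then have g2: "\<bar>g e1 e2\<bar> \<le> 2 * \<tau> * ?b" using g_sym[OF e] by simp
    have l: "?l \<le> (\<eta> / (1 - \<tau>)) * ?G"
      unfolding G using D_le[OF e(1) z] D_le[OF e(2) z] ab g1 g2 \<tau> by (intro separated_bound) auto
    have 1: "?G \<ge> 0"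
    proof -
      have "\<bar>g e1 e2\<bar> \<le> 2 * ?a" "\<bar>g e1 e2\<bar> \<le> 2 * ?b"
        using g1 g2 mult_right_mono[of \<tau> 1 ?a] mult_right_mono[of \<tau> 1 ?b] ab \<tau> by linarith+
      then have "s1\<^sup>2 * \<bar>g e1 e2\<bar> \<le> s1\<^sup>2 * (2 * ?a)" "s2\<^sup>2 * \<bar>g e1 e2\<bar> \<le> s2\<^sup>2 * (2 * ?b)"
        by (auto intro: mult_left_mono)
      moreover have "\<bar>2 * s1 * s2 * g e1 e2\<bar> \<le> (s1\<^sup>2 + s2\<^sup>2) * \<bar>g e1 e2\<bar>"
      proof -
        have "2 * \<bar>s1\<bar> * \<bar>s2\<bar> \<le> s1\<^sup>2 + s2\<^sup>2"
          using zero_le_power2[of "\<bar>s1\<bar> - \<bar>s2\<bar>"] by (simp add: power2_eq_square algebra_simps)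
        from mult_right_mono[OF this, of "\<bar>g e1 e2\<bar>"] show ?thesis by (simp add: abs_mult)
      qed
      ultimately show ?thesis unfolding G by (simp add: algebra_simps)
    qed
    show ?thesis using l 1 \<tau> by (intro exI[of _ "1 / (1 - \<tau>)"]) (auto simp: field_simps)
  qed
  then obtain \<theta> where th: "\<theta> > 0" "\<theta> \<le> 2 / (1 - \<tau>)" "?l \<le> (\<theta> * \<eta>) * ?G" "?G \<ge> 0" by blast
  then show "0 \<le> ?G" by blast
  have "(\<theta> * \<eta>) * ?G \<le> (2 / (1 - \<tau>) * \<eta>) * ?G"
    using th eta_nonneg by (intro mult_right_mono) auto
  then show "?l \<le> (2 * \<eta> / (1 - \<tau>)) * ?G" using th(3) by simp
qed

text \<open>The representatives miss at most two points, so all dipoles sit at two places. With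
  \<open>U\<close> the l1 norm of \<open>push v\<close> and \<open>G\<close> the dipole energy, the
  interaction is at most \<open>2 * U * sqrt (\<theta> * G)\<close>; hence dipoles of any strength
  lower the form by at most \<open>\<theta> * U^2\<close>.\<close>

lemma qform_lower_bound:
  assumes card: "card I \<le> card J + 2"
  shows "qform J T (push v) - (\<eta> + 2 * \<eta> / (1 - \<tau>)) * (\<Sum>j\<in>J. \<bar>push v j\<bar>)\<^sup>2 \<le> qform I S v"
proof -
  define u where "u = push v"
  define \<theta> where "\<theta> = 2 * \<eta> / (1 - \<tau>)"
  have th: "\<theta> \<ge> 0" unfolding \<theta>_def using \<tau> eta_nonneg by simp
  have "y ` J \<subseteq> I" using y by auto
  then have "card (I - y ` J) \<le> 2"
    using card card_image[OF inj_y] finJ by (simp add: card_Diff_subset)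
  then obtain e1 e2 s1 s2 where e: "e1 \<in> I" "e2 \<in> I" and
    es: "\<forall>f :: 'i \<Rightarrow> real. (\<forall>x\<in>I \<inter> y ` J. f x = 0) \<longrightarrow> (\<Sum>x\<in>I. v x * f x) = s1 * f e1 + s2 * f e2"
    by (rule sum_two_outside[OF fin ne, of "y ` J" v])
  have D0: "D x z = 0" if "x \<in> y ` J" for x z using q_fixed[OF that] by (simp add: D_def)
  have F: "(\<Sum>x\<in>I. v x * D x z) = s1 * D e1 z + s2 * D e2 z" for z
    using D0 by (intro es[rule_format]) auto
  define G where "G = s1\<^sup>2 * g e1 e1 + s2\<^sup>2 * g e2 e2 + 2 * s1 * s2 * g e1 e2"
  have "(\<Sum>x\<in>I. v x * (\<Sum>x'\<in>I. v x' * g x x'))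
      = s1 * (\<Sum>x'\<in>I. v x' * g e1 x') + s2 * (\<Sum>x'\<in>I. v x' * g e2 x')"
    using D0 by (intro es[rule_format]) (auto simp: g_def)
  also have "(\<Sum>x'\<in>I. v x' * g e1 x') = s1 * g e1 e1 + s2 * g e1 e2"
    by (rule es[rule_format]) (auto simp: g_def q_fixed)
  also have "(\<Sum>x'\<in>I. v x' * g e2 x') = s1 * g e2 e1 + s2 * g e2 e2"
    by (rule es[rule_format]) (auto simp: g_def q_fixed)
  finally have GG: "(\<Sum>x\<in>I. v x * (\<Sum>x'\<in>I. v x' * g x x')) = G"
    using g_sym[OF e] unfolding G_def by (simp add: power2_eq_square algebra_simps)
  have G0: "G \<ge> 0" unfolding G_def using two_point_bound(2)[OF e e(1)] .
  have Fb: "\<bar>s1 * D e1 (y j) + s2 * D e2 (y j)\<bar> \<le> sqrt (\<theta> * G)" if "j \<in> J" for j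
    using two_point_bound(1)[OF e y(1)[OF that]] unfolding \<theta>_def G_def
    by (intro real_le_rsqrt) (simp add: power2_abs)
  let ?U = "\<Sum>j\<in>J. \<bar>u j\<bar>"
  have "\<bar>\<Sum>j\<in>J. u j * (s1 * D e1 (y j) + s2 * D e2 (y j))\<bar> \<le> (\<Sum>j\<in>J. \<bar>u j\<bar> * sqrt (\<theta> * G))"
    by (intro order_trans[OF sum_abs] sum_mono) (auto simp: abs_mult intro: mult_left_mono Fb)
  then have "(\<Sum>j\<in>J. u j * (s1 * D e1 (y j) + s2 * D e2 (y j))) \<ge> - (?U * (sqrt \<theta> * sqrt G))"
    by (simp add: sum_distrib_right real_sqrt_mult)
  moreover have "G - 2 * (?U * (sqrt \<theta> * sqrt G)) \<ge> - \<theta> * ?U\<^sup>2"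
  proof -
    have "(sqrt G - sqrt \<theta> * ?U)\<^sup>2 \<ge> 0" by simp
    then show ?thesis using G0 th by (simp add: power2_diff power_mult_distrib algebra_simps)
  qed
  moreover have "qform J (\<lambda>i j. S (y i) (y j)) u \<ge> qform J T u - \<eta> * ?U\<^sup>2"
  proof -
    have "\<bar>qform J (\<lambda>i j. S (y i) (y j)) u - qform J T u\<bar> \<le> \<eta> * ?U\<^sup>2"
      using close y by (intro qform_diff_le[OF finJ]) (metis)
    then show ?thesis by linarith
  qed
  ultimately show ?thesis
    unfolding qform_decomposition[of v] F GG u_def[symmetric] \<theta>_def[symmetric]
    by (simp add: algebra_simps)
qed

text \<open>The transfer in the other direction: mass on \<open>J\<close> is placed on the
  representatives. It works for any number of extra points and gives the lower bound for the
  magnitude.\<close>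

lemma qform_section:
  defines "v \<equiv> \<lambda>w x. if x \<in> y ` J then w (p x) else 0"
  shows "(\<Sum>x\<in>I. v w x) = (\<Sum>j\<in>J. w j)"
    and "qform I S (v w) \<le> qform J T w + \<eta> * (\<Sum>j\<in>J. \<bar>w j\<bar>)\<^sup>2"
proof -
  have yI: "y ` J \<subseteq> I" using y by auto
  have s: "(\<Sum>x\<in>I. v w x * f x) = (\<Sum>j\<in>J. w j * f (y j))" for f :: "'i \<Rightarrow> real"
  proof -
    have "(\<Sum>x\<in>I. v w x * f x) = (\<Sum>x\<in>y ` J. v w x * f x)"
      by (rule sum.mono_neutral_right) (use fin yI in \<open>auto simp: v_def\<close>)
    also have "\<dots> = (\<Sum>j\<in>J. v w (y j) * f (y j))" using inj_y by (simp add: sum.reindex)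
    finally show ?thesis using y by (simp add: v_def)
  qed
  show "(\<Sum>x\<in>I. v w x) = (\<Sum>j\<in>J. w j)" using s[of "\<lambda>_. 1"] by simp
  have "qform I S (v w) = (\<Sum>x\<in>I. v w x * (\<Sum>x'\<in>I. v w x' * S x x'))"
    unfolding bform_def by (simp add: sum_distrib_left mult_ac)
  also have "\<dots> = qform J (\<lambda>i j. S (y i) (y j)) w"
    unfolding s bform_def by (simp add: sum_distrib_left mult_ac)
  also have "\<dots> \<le> qform J T w + \<eta> * (\<Sum>j\<in>J. \<bar>w j\<bar>)\<^sup>2"
  proof -
    have "\<bar>qform J (\<lambda>i j. S (y i) (y j)) w - qform J T w\<bar> \<le> \<eta> * (\<Sum>j\<in>J. \<bar>w j\<bar>)\<^sup>2"
      using close y by (intro qform_diff_le[OF finJ]) (metis)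
    then show ?thesis by linarith
  qed
  finally show "qform I S (v w) \<le> qform J T w + \<eta> * (\<Sum>j\<in>J. \<bar>w j\<bar>)\<^sup>2" .
qed

end

section \<open>Four points shrinking to one\<close>

lemma four_point_bound_aux:
  fixes a b c d :: real
  assumes le: "dab \<le> \<eta>" "dac \<le> \<eta>" "dad \<le> \<eta>" "dbc \<le> \<eta>" "dbd \<le> \<eta>" "dcd \<le> \<eta>"
    and nn: "dab \<ge> 0" "dac \<ge> 0" "dad \<ge> 0" "dbc \<ge> 0" "dbd \<ge> 0" "dcd \<ge> 0"
    and tri: "dbc \<le> dab + dac" "dad \<le> dab + dbd" "dad \<le> dac + dcd" "dbc \<le> dbd + dcd"
    and max: "dab + dcd \<le> dad + dbc" "dac + dbd \<le> dad + dbc"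
  shows "2 * (dab * a * b + dac * a * c + dad * a * d + dbc * b * c + dbd * b * d + dcd * c * d)
    \<le> 3 * \<eta> * (a + b + c + d)\<^sup>2"
proof -
  \<comment> \<open>Decomposition of a four-point metric into cut metrics: four cuts split off one point,
    the other two correspond to the smaller two of the three sums of opposite sides.\<close>
  define N where "N = a + b + c + d"
  \<comment> \<open>A cut with weight \<open>l\<close> splitting the total \<open>N\<close> into
    \<open>x\<close> and \<open>z\<close> contributes at most \<open>l * N^2 / 2\<close>. Six cuts
    of weight at most \<eta> give the factor 3.\<close>
  have cut: "2 * (l * x * z) \<le> 1 / 2 * \<eta> * N\<^sup>2" if "l \<ge> 0" "l \<le> \<eta>" "x + z = N" for l x z
  proof -
    have "4 * (x * z) \<le> N\<^sup>2"
      using zero_le_power2[of "x - z"] unfolding that(3)[symmetric] by (simp add: power2_eq_square algebra_simps)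
    then have "l * (4 * (x * z)) \<le> l * N\<^sup>2" using that(1) by (rule mult_left_mono)
    also have "\<dots> \<le> \<eta> * N\<^sup>2" using that(2) by (intro mult_right_mono) auto
    finally show ?thesis by simp
  qed
  have "2 * (dab * a * b + dac * a * c + dad * a * d + dbc * b * c + dbd * b * d + dcd * c * d)
    = 2 * ((dab + dac - dbc) / 2 * a * (b + c + d)) + 2 * ((dab + dbd - dad) / 2 * b * (a + c + d))
      + 2 * ((dac + dcd - dad) / 2 * c * (a + b + d)) + 2 * ((dbd + dcd - dbc) / 2 * d * (a + b + c))
      + 2 * ((dad + dbc - dab - dcd) / 2 * (a + b) * (c + d))
      + 2 * ((dad + dbc - dac - dbd) / 2 * (a + c) * (b + d))"
    by (simp add: field_simps)
  also have "\<dots> \<le> 1 / 2 * \<eta> * N\<^sup>2 + 1 / 2 * \<eta> * N\<^sup>2 + 1 / 2 * \<eta> * N\<^sup>2 + 1 / 2 * \<eta> * N\<^sup>2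
      + 1 / 2 * \<eta> * N\<^sup>2 + 1 / 2 * \<eta> * N\<^sup>2"
    by (intro add_mono cut; (simp add: N_def)?; use le nn tri max in linarith)
  finally show ?thesis by (simp add: N_def)
qed

lemma four_point_bound:
  assumes S: "similarity I S" and I: "card I = 4" and close: "\<And>x y. x \<in> I \<Longrightarrow> y \<in> I \<Longrightarrow> 1 - S x y \<le> \<eta>"
  shows "(1 - 3 * \<eta>) * (\<Sum>x\<in>I. v x)\<^sup>2 \<le> qform I S v"
proof -
  define d where "d x y = 1 - S x y" for x y
  have d: "0 \<le> d x y" "d x y \<le> \<eta>" "d x x = 0" "d x y = d y x" if "x \<in> I" "y \<in> I" for x y
    using similarityD(1-4)[OF S that] close[OF that] unfolding d_def by auto
  have tri: "d x z \<le> d x y + d y z" if "x \<in> I" "y \<in> I" "z \<in> I" for x y z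
    using similarity_complement_triangle[OF S that] unfolding d_def .
  \<comment> \<open>The points are named so that \<open>d a e + d b c\<close> is the largest of the
    three sums of opposite sides; this makes the weights of the two balanced cuts nonnegative. The
    final case distinction renames the points.\<close>
  have main: "(1 - 3 * \<eta>) * (\<Sum>x\<in>I. v x)\<^sup>2 \<le> qform I S v"
    if abcd: "I = {a, b, c, e}" "distinct [a, b, c, e]"
      and max: "d a b + d c e \<le> d a e + d b c" "d a c + d b e \<le> d a e + d b c" for a b c e
  proof -
    have m: "a \<in> I" "b \<in> I" "c \<in> I" "e \<in> I" using abcd by auto
    have sum: "(\<Sum>x\<in>I. f x) = f a + f b + f c + f e" for f :: "'a \<Rightarrow> real"
      using abcd by (simp add: add.assoc)
    have "qform I S v = (\<Sum>x\<in>I. \<Sum>y\<in>I. v x * v y) - (\<Sum>x\<in>I. \<Sum>y\<in>I. d x y * v x * v y)"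
      unfolding bform_def d_def by (simp add: sum_subtractf algebra_simps)
    also have "(\<Sum>x\<in>I. \<Sum>y\<in>I. v x * v y) = (\<Sum>x\<in>I. v x)\<^sup>2"
      by (simp add: power2_eq_square sum_product)
    also have "(\<Sum>x\<in>I. \<Sum>y\<in>I. d x y * v x * v y)
      = 2 * (d a b * v a * v b + d a c * v a * v c + d a e * v a * v e + d b c * v b * v c
        + d b e * v b * v e + d c e * v c * v e)"
      unfolding sum using m d(3) d(4)[of b a] d(4)[of c a] d(4)[of e a] d(4)[of c b] d(4)[of e b] d(4)[of e c]
      by simp
    finally have Q: "qform I S v = (\<Sum>x\<in>I. v x)\<^sup>2
      - 2 * (d a b * v a * v b + d a c * v a * v c + d a e * v a * v e + d b c * v b * v c
        + d b e * v b * v e + d c e * v c * v e)" .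
    have "2 * (d a b * v a * v b + d a c * v a * v c + d a e * v a * v e + d b c * v b * v c
        + d b e * v b * v e + d c e * v c * v e) \<le> 3 * \<eta> * (v a + v b + v c + v e)\<^sup>2"
      using max m d(1,2) tri[of b a c] tri[of a b e] tri[of a c e] tri[of b e c] d(4)[of b a] d(4)[of e c]
      by (intro four_point_bound_aux) auto
    then show ?thesis unfolding Q unfolding sum left_diff_distrib by linarith
  qed
  obtain a b c e where abcd: "I = {a, b, c, e}" "distinct [a, b, c, e]"
  proof -
    obtain xs where xs: "distinct xs" "set xs = I" "length xs = 4"
      using I finite_distinct_list[of I] distinct_card card.infinite
      by (metis zero_neq_numeral)
    then obtain a b c e where "xs = [a, b, c, e]"
      by (auto simp: numeral_eq_Suc length_Suc_conv)
    with xs that show thesis by auto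
  qed
  have m: "a \<in> I" "b \<in> I" "c \<in> I" "e \<in> I" using abcd by auto
  consider "d a b + d c e \<le> d a e + d b c" "d a c + d b e \<le> d a e + d b c"
    | "d a c + d b e \<le> d a b + d c e" "d a e + d b c \<le> d a b + d c e"
    | "d a b + d c e \<le> d a c + d b e" "d a e + d b c \<le> d a c + d b e" by linarith
  then show ?thesis
  proof cases
    case 1
    then show ?thesis using main[OF abcd] by simp
  next
    case 2
    show ?thesis
    proof (rule main)
      show "I = {a, c, e, b}" "distinct [a, c, e, b]" using abcd by auto
      show "d a c + d e b \<le> d a b + d c e" "d a e + d c b \<le> d a b + d c e"
        using 2 d(4)[OF m(4,2)] d(4)[OF m(3,2)] by linarith+
    qed
  next
    case 3
    show ?thesis
    proof (rule main)
      show "I = {a, b, e, c}" "distinct [a, b, e, c]" using abcd by auto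
      show "d a b + d e c \<le> d a c + d b e" "d a e + d b c \<le> d a c + d b e"
        using 3 d(4)[OF m(4,3)] by linarith+
    qed
  qed
qed

text \<open>The stability half uses the type only through this count: an approximating space has
  \<open>sum_list r\<close> more points than its limit.\<close>

lemma card_clustered:
  assumes "clustered_in_type r X" "finite (mspace X)"
  shows "card (mspace X) = sum_list r + length r"
proof -
  obtain \<epsilon> Cs where eq: "equiv (mspace X) {(x, y). x \<in> mspace X \<and> y \<in> mspace X \<and> mdist X x y < \<epsilon>}"
    and Cs: "distinct Cs"
      "set Cs = mspace X // {(x, y). x \<in> mspace X \<and> y \<in> mspace X \<and> mdist X x y < \<epsilon>}"
      "map card Cs = map (\<lambda>s. s + 1) r"
    using assms(1) unfolding clustered_in_type_def Let_def by blast
  have "card (mspace X) = card (\<Union>(set Cs))"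
    unfolding Cs(2) using Union_quotient[OF eq] by simp
  also have "\<dots> = (\<Sum>C\<in>set Cs. card C)"
  proof (rule card_Union_disjoint)
    show "pairwise disjnt (set Cs)"
      unfolding Cs(2) pairwise_def disjnt_def using quotient_disj[OF eq] by blast
    show "finite A" if "A \<in> set Cs" for A
    proof -
      have "A \<subseteq> mspace X" using that Union_quotient[OF eq] unfolding Cs(2) by blast
      then show ?thesis using assms(2) by (rule finite_subset)
    qed
  qed
  also have "\<dots> = sum_list (map card Cs)" using Cs(1) by (simp add: sum.distinct_set_conv_list)
  also have "\<dots> = sum_list r + length r" unfolding Cs(3) by (induction r) auto
  finally show ?thesis .
qed

text \<open>The function \<open>exp (- s)\<close> is 1-Lipschitz for
  \<open>s \<ge> 0\<close>.\<close>

lemma sim_diff_le: "\<bar>sim X x x' - sim Y y y'\<bar> \<le> \<bar>mdist X x x' - mdist Y y y'\<bar>"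
proof -
  have "exp (- s) - exp (- t) \<le> t - s" if "s \<le> t" "0 \<le> s" for s t :: real
  proof -
    have "exp (- s) - exp (- t) = exp (- s) * (1 - exp (- (t - s)))"
      by (simp add: algebra_simps flip: exp_add)
    also have "\<dots> \<le> 1 * (1 - exp (- (t - s)))"
      using that by (intro mult_right_mono) auto
    also have "\<dots> \<le> t - s" using exp_ge_add_one_self[of "s - t"] unfolding mult_1 minus_diff_eq by linarith
    finally show ?thesis .
  qed
  moreover have "exp (- t) \<le> exp (- s)" if "s \<le> t" for s t :: real using that by simp
  ultimately show ?thesis
    unfolding sim_def by (cases "mdist X x x' \<le> mdist Y y y'") (smt (verit) mdist_nonneg)+
qed

section \<open>Two-sided bounds and the limit of magnitudes\<close>

context
  fixes X :: "'a metric" and Y :: "'b metric" and p :: "'b \<Rightarrow> 'a" and \<eta> \<tau> :: real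
  assumes pd: "positive_definite_space X" "positive_definite_space Y"
    and pair: "approximation_pair (mspace Y) (sim Y) (mspace X) (sim X) p \<eta> \<tau>"
begin

interpretation A: approximation_pair "mspace Y" "sim Y" "mspace X" "sim X" p \<eta> \<tau>
  by (rule pair)

lemma finite_spaces: "finite (mspace X)" "finite (mspace Y)"
  using pd unfolding positive_definite_space_def by auto

lemma magnitude_lower_bound:
  assumes w: "(\<Sum>x\<in>mspace X. w x) = magnitude X" "qform (mspace X) (sim X) w = magnitude X"
  shows "(magnitude X)\<^sup>2 \<le> magnitude Y * (magnitude X + \<eta> * (\<Sum>x\<in>mspace X. \<bar>w x\<bar>)\<^sup>2)"
proof -
  let ?v = "\<lambda>x. if x \<in> A.y ` mspace X then w (p x) else 0"
  have "(magnitude X)\<^sup>2 = (\<Sum>x\<in>mspace Y. ?v x)\<^sup>2"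
    unfolding A.qform_section(1) w(1) ..
  also have "\<dots> \<le> magnitude Y * qform (mspace Y) (sim Y) ?v"
    by (rule magnitude_bound[OF finite_spaces(2) pd(2)])
  also have "\<dots> \<le> magnitude Y * (magnitude X + \<eta> * (\<Sum>x\<in>mspace X. \<bar>w x\<bar>)\<^sup>2)"
    using A.qform_section(2)[of w] magnitude_nonneg[OF finite_spaces(2) pd(2)]
    unfolding w(2) by (rule mult_left_mono)
  finally show ?thesis .
qed

text \<open>\<open>push\<close> preserves the total mass, and by \<open>C\<close> the error of
  \<open>qform_lower_bound\<close> is a fixed fraction of the form on \<open>X\<close>. So the form
  on \<open>Y\<close> is at least that fraction short of the one on \<open>X\<close>, for equal
  mass.\<close>

lemma magnitude_upper_bound:
  assumes card: "card (mspace Y) \<le> card (mspace X) + 2"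
    and C: "\<And>v. (\<Sum>x\<in>mspace X. \<bar>v x\<bar>)\<^sup>2 \<le> C * qform (mspace X) (sim X) v" "C > 0"
    and small: "(\<eta> + 2 * \<eta> / (1 - \<tau>)) * C < 1" and pos: "magnitude X > 0"
  shows "magnitude Y \<le> magnitude X / (1 - (\<eta> + 2 * \<eta> / (1 - \<tau>)) * C)"
proof -
  define \<delta> where "\<delta> = \<eta> + 2 * \<eta> / (1 - \<tau>)"
  have \<delta>: "\<delta> \<ge> 0" using A.eta_nonneg A.\<tau> unfolding \<delta>_def by simp
  have "magnitude Y \<le> 1 / ((1 - \<delta> * C) / magnitude X)"
  proof (rule magnitude_le[OF finite_spaces(2) pd(2)])
    show "(1 - \<delta> * C) / magnitude X > 0" using small pos unfolding \<delta>_def by simp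
    fix v
    let ?u = "A.push v"
    let ?Q = "qform (mspace X) (sim X) ?u"
    have "(1 - \<delta> * C) / magnitude X * (\<Sum>x\<in>mspace Y. v x)\<^sup>2
        = (1 - \<delta> * C) / magnitude X * (\<Sum>x\<in>mspace X. ?u x)\<^sup>2"
      unfolding A.push_total ..
    also have "\<dots> \<le> (1 - \<delta> * C) / magnitude X * (magnitude X * ?Q)"
      using magnitude_bound[OF finite_spaces(1) pd(1)] small pos
      unfolding \<delta>_def by (intro mult_left_mono) auto
    also have "\<dots> = ?Q - \<delta> * (C * ?Q)" using pos by (simp add: field_simps)
    also have "\<dots> \<le> ?Q - \<delta> * (\<Sum>x\<in>mspace X. \<bar>?u x\<bar>)\<^sup>2"
      using mult_left_mono[OF C(1)[of ?u] \<delta>] by simp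
    also have "\<dots> \<le> qform (mspace Y) (sim Y) v"
      unfolding \<delta>_def by (rule A.qform_lower_bound[OF card])
    finally show "(1 - \<delta> * C) / magnitude X * (\<Sum>x\<in>mspace Y. v x)\<^sup>2 \<le> qform (mspace Y) (sim Y) v" .
  qed
  then show ?thesis unfolding \<delta>_def by simp
qed

lemma magnitude_upper_bound_four_points:
  assumes card: "card (mspace X) = 1" "card (mspace Y) = 4" and small: "3 * \<eta> < 1"
  shows "magnitude Y \<le> 1 / (1 - 3 * \<eta>)"
proof (rule magnitude_le[OF finite_spaces(2) pd(2)])
  obtain a where a: "mspace X = {a}" using card(1) by (auto simp: card_1_singleton_iff)
  have "1 - sim Y x y \<le> \<eta>" if "x \<in> mspace Y" "y \<in> mspace Y" for x y
  proof -
    have "p x = a" "p y = a" using A.p that a by auto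
    then have "sim X (p x) (p y) = 1" using A.T[of a] a by simp
    then show ?thesis using A.close[OF that] by linarith
  qed
  then show "(1 - 3 * \<eta>) * (\<Sum>x\<in>mspace Y. v x)\<^sup>2 \<le> qform (mspace Y) (sim Y) v" for v
    using four_point_bound[OF A.S card(2)] by blast
qed (use small in simp)

end

lemma magnitude_pos:
  assumes "positive_definite_space X" "mspace X \<noteq> {}"
  shows "magnitude X > 0"
proof -
  have fin: "finite (mspace X)" using assms unfolding positive_definite_space_def by auto
  have "(\<Sum>x\<in>mspace X. 1)\<^sup>2 \<le> magnitude X * qform (mspace X) (sim X) (\<lambda>_. 1)"
    by (rule magnitude_bound[OF fin assms(1)])
  moreover have "(\<Sum>x\<in>mspace X. 1::real)\<^sup>2 > 0" using fin assms(2) by (simp add: card_gt_0_iff)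
  ultimately have "magnitude X \<noteq> 0" by auto
  then show ?thesis using magnitude_nonneg[OF fin assms(1)] by simp
qed

lemma magnitude_singleton:
  assumes "positive_definite_space X" "card (mspace X) = 1"
  shows "magnitude X = 1"
proof -
  obtain a where a: "mspace X = {a}" using assms(2) by (auto simp: card_1_singleton_iff)
  have "magnitude X = (\<Sum>x\<in>mspace X. 1)"
    by (rule magnitude_weighting) (use assms a in \<open>auto simp: sim_def\<close>)
  then show ?thesis using a by simp
qed

theorem magnitude_tendsto:
  fixes X :: "'a metric" and Xs :: "nat \<Rightarrow> 'b metric"
  assumes pd: "positive_definite_space X" "\<And>n. positive_definite_space (Xs n)"
    and ne: "mspace X \<noteq> {}" "\<And>n. mspace (Xs n) \<noteq> {}"
    and card: "(\<forall>n. card (mspace (Xs n)) \<le> card (mspace X) + 2) \<or>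
      card (mspace X) = 1 \<and> (\<forall>n. card (mspace (Xs n)) = 4)"
    and lim: "(\<lambda>n. gromov_hausdorff_distance (Xs n) X) \<longlonglongrightarrow> 0"
  shows "(\<lambda>n. magnitude (Xs n)) \<longlonglongrightarrow> magnitude X"
proof -
  let ?M = "magnitude X"
  have fin: "finite (mspace X)" "finite (mspace (Xs n))" for n
    using pd unfolding positive_definite_space_def by auto
  note M = magnitude_pos[OF pd(1) ne(1)]
  obtain w where w: "(\<Sum>x\<in>mspace X. w x) = ?M" "qform (mspace X) (sim X) w = ?M"
    using maximizing_weighting[OF fin(1) pd(1)] by metis
  obtain C where C: "C > 0" "\<And>v. (\<Sum>x\<in>mspace X. \<bar>v x\<bar>)\<^sup>2 \<le> C * qform (mspace X) (sim X) v"
    using l1_bound[OF fin(1) pd(1)] by blast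
  define W where "W = (\<Sum>x\<in>mspace X. \<bar>w x\<bar>)\<^sup>2"
  \<comment> \<open>The smallest distance in \<open>X\<close>; the inserted 1 makes the minimum
    meaningful for a one-point space.\<close>
  obtain m where m: "m > 0" "\<And>x x'. x \<in> mspace X \<Longrightarrow> x' \<in> mspace X \<Longrightarrow> x \<noteq> x' \<Longrightarrow> m \<le> mdist X x x'"
  proof -
    let ?A = "insert 1 ((\<lambda>(x, x'). mdist X x x') ` {(x, x') \<in> mspace X \<times> mspace X. x \<noteq> x'})"
    have A: "finite ?A" "?A \<noteq> {}"
      using fin(1) by (auto intro: finite_subset[of _ "mspace X \<times> mspace X"])
    have "Min ?A \<in> ?A" using A by (rule Min_in)
    then have "Min ?A > 0" by (auto simp: less_le)
    moreover have "Min ?A \<le> mdist X x x'" if "x \<in> mspace X" "x' \<in> mspace X" "x \<noteq> x'" for x x'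
      using A(1) that by (intro Min_le) auto
    ultimately show thesis using that by blast
  qed
  define \<tau>0 where "\<tau>0 = exp (- m)"
  have \<tau>0: "0 < \<tau>0" "\<tau>0 < 1" using m(1) by (auto simp: \<tau>0_def)
  \<comment> \<open>Halfway between the largest similarity of distinct points of \<open>X\<close>
    and 1, leaving room for the approximation error.\<close>
  define \<tau> where "\<tau> = (1 + \<tau>0) / 2"
  have \<tau>: "0 \<le> \<tau>" "\<tau> < 1" "\<tau>0 < \<tau>" using \<tau>0 by (auto simp: \<tau>_def)
  \<comment> \<open>The added \<open>1 / real (Suc n)\<close> yields the strict inequality required
    by \<open>gromov_hausdorff_approximation\<close>, also at distance 0.\<close>
  define \<rho> where "\<rho> n = gromov_hausdorff_distance (Xs n) X + 1 / real (Suc n)" for n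
  have "\<rho> \<longlonglongrightarrow> 0 + 0"
    unfolding \<rho>_def by (intro tendsto_add lim LIMSEQ_Suc lim_1_over_n)
  then have \<rho>_lim: "\<rho> \<longlonglongrightarrow> 0" by simp
  have \<eta>_lim: "(\<lambda>n. 2 * \<rho> n) \<longlonglongrightarrow> 0" using tendsto_mult_right_zero[OF \<rho>_lim] .
  define \<delta> where "\<delta> n = (2 * \<rho> n + 2 * (2 * \<rho> n) / (1 - \<tau>)) * C" for n
  have \<delta>_lim: "\<delta> \<longlonglongrightarrow> 0"
  proof -
    have "\<delta> \<longlonglongrightarrow> (0 + 2 * 0 / (1 - \<tau>)) * C"
      unfolding \<delta>_def using \<tau> by (intro tendsto_intros \<eta>_lim) auto
    then show ?thesis by simp
  qed
  have ev: "\<forall>\<^sub>F n in sequentially. 2 * \<rho> n < min (min m (1 - \<tau>)) (min (\<tau> - \<tau>0) (1 / 3))"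
    using \<eta>_lim by (rule order_tendstoD) (use m(1) \<tau> in auto)
  have ev': "\<forall>\<^sub>F n in sequentially. \<delta> n < 1" using \<delta>_lim by (rule order_tendstoD) simp
  define hi where "hi n = (if card (mspace X) = 1 \<and> (\<forall>n. card (mspace (Xs n)) = 4)
    then ?M / (1 - 3 * (2 * \<rho> n)) else ?M / (1 - \<delta> n))" for n
  have bounds: "\<forall>\<^sub>F n in sequentially.
      ?M\<^sup>2 / (?M + 2 * \<rho> n * W) \<le> magnitude (Xs n) \<and> magnitude (Xs n) \<le> hi n"
    using ev ev'
  proof eventually_elim
    fix n
    assume small: "2 * \<rho> n < min (min m (1 - \<tau>)) (min (\<tau> - \<tau>0) (1 / 3))" and \<delta>: "\<delta> n < 1"
    have less: "gromov_hausdorff_distance (Xs n) X < \<rho> n" unfolding \<rho>_def by simp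
    have \<rho>0: "\<rho> n > 0"
      using gromov_hausdorff_distance_nonneg[OF fin(2)[of n] fin(1) ne(2) ne(1)]
      unfolding \<rho>_def by (intro add_nonneg_pos) auto
    have sep: "2 * \<rho> n \<le> mdist X x x'" if "x \<in> mspace X" "x' \<in> mspace X" "x \<noteq> x'" for x x'
      using m(2)[OF that] small by simp
    obtain p where p: "p ` mspace (Xs n) = mspace X"
      "\<And>x x'. x \<in> mspace (Xs n) \<Longrightarrow> x' \<in> mspace (Xs n) \<Longrightarrow>
        \<bar>mdist (Xs n) x x' - mdist X (p x) (p x')\<bar> < 2 * \<rho> n"
      using gromov_hausdorff_approximation[OF fin(2)[of n] fin(1) ne(2) ne(1) less sep] by metis
    have close: "\<bar>sim (Xs n) x x' - sim X (p x) (p x')\<bar> \<le> 2 * \<rho> n"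
      if "x \<in> mspace (Xs n)" "x' \<in> mspace (Xs n)" for x x'
      using sim_diff_le[of "Xs n" x x' X "p x" "p x'"] p(2)[OF that] by linarith
    have pair: "approximation_pair (mspace (Xs n)) (sim (Xs n)) (mspace X) (sim X) p (2 * \<rho> n) \<tau>"
    proof
      show "sim (Xs n) x x' \<le> \<tau>"
        if "x \<in> mspace (Xs n)" "x' \<in> mspace (Xs n)" "p x \<noteq> p x'" for x x'
      proof -
        have "sim X (p x) (p x') \<le> \<tau>0"
          using m(2)[of "p x" "p x'"] p(1) that unfolding sim_def \<tau>0_def by auto
        then show ?thesis using close[OF that(1,2)] small by linarith
      qed
      show "similarity (mspace (Xs n)) (sim (Xs n))" by (rule similarity_sim)
      show "sim X x x = 1" if "x \<in> mspace X" for x using that by (simp add: sim_def)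
    qed (use fin ne close p(1) \<tau> in auto)
    have "?M + 2 * \<rho> n * W > 0" using M \<rho>0 unfolding W_def by (intro add_pos_nonneg) auto
    then have "?M\<^sup>2 / (?M + 2 * \<rho> n * W) \<le> magnitude (Xs n)"
      using magnitude_lower_bound[OF pd pair w] unfolding W_def by (simp add: field_simps)
    moreover have "magnitude (Xs n) \<le> hi n"
    proof (cases "card (mspace X) = 1 \<and> (\<forall>n. card (mspace (Xs n)) = 4)")
      case True
      then show ?thesis
        using magnitude_upper_bound_four_points[OF pd pair] small magnitude_singleton[OF pd(1)]
        unfolding hi_def by simp
    next
      case False
      then have "card (mspace (Xs n)) \<le> card (mspace X) + 2" using card by blast
      from magnitude_upper_bound[OF pd pair this C(2,1) _ M] \<delta> show ?thesis
        unfolding hi_def if_not_P[OF False] \<delta>_def by simp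
    qed
    ultimately show "?M\<^sup>2 / (?M + 2 * \<rho> n * W) \<le> magnitude (Xs n) \<and> magnitude (Xs n) \<le> hi n" ..
  qed
  have "(\<lambda>n. ?M\<^sup>2 / (?M + 2 * \<rho> n * W)) \<longlonglongrightarrow> ?M\<^sup>2 / (?M + 0 * W)"
    using M by (intro tendsto_intros \<eta>_lim) auto
  then have lo_lim: "(\<lambda>n. ?M\<^sup>2 / (?M + 2 * \<rho> n * W)) \<longlonglongrightarrow> ?M"
    using M by (simp add: power2_eq_square)
  have "(\<lambda>n. ?M / (1 - 3 * (2 * \<rho> n))) \<longlonglongrightarrow> ?M / (1 - 3 * 0)"
    by (intro tendsto_intros \<eta>_lim) auto
  moreover have "(\<lambda>n. ?M / (1 - \<delta> n)) \<longlonglongrightarrow> ?M / (1 - 0)"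
    by (intro tendsto_intros \<delta>_lim) auto
  ultimately have lims: "(\<lambda>n. ?M / (1 - 3 * (2 * \<rho> n))) \<longlonglongrightarrow> ?M" "(\<lambda>n. ?M / (1 - \<delta> n)) \<longlonglongrightarrow> ?M"
    by simp_all
  then have hi_lim: "hi \<longlonglongrightarrow> ?M"
  proof (cases "card (mspace X) = 1 \<and> (\<forall>n. card (mspace (Xs n)) = 4)")
    case True
    then show ?thesis unfolding hi_def if_P[OF True] using lims(1) by simp
  next
    case False
    then show ?thesis unfolding hi_def if_not_P[OF False] using lims(2) by simp
  qed
  show ?thesis
    by (rule tendsto_sandwich[OF _ _ lo_lim hi_lim]) (use bounds in \<open>auto elim: eventually_mono\<close>)
qed

section \<open>Instability of the magnitude\<close>

definition strict_similarity :: "'i set \<Rightarrow> ('i \<Rightarrow> 'i \<Rightarrow> real) \<Rightarrow> bool" where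
  "strict_similarity I S \<longleftrightarrow> similarity I S \<and> (\<forall>x\<in>I. \<forall>y\<in>I. x \<noteq> y \<longrightarrow> S x y < 1)"

text \<open>A type entry \<open>s\<close> stands for \<open>s + 1\<close> points, hence
  \<open>\<le>\<close>; in particular \<open>(i, 0)\<close> is always present and can serve as the
  base point of its cluster.\<close>

definition pts :: "nat list \<Rightarrow> (nat \<times> nat) set" where
  "pts r = {(i, j). i < length r \<and> j \<le> r ! i}"

text \<open>\<open>S\<close> and \<open>T\<close> are matrices of similarities \<open>exp (- d)\<close>; the points \<open>(i, j)\<close> of a type form the cluster
  that shrinks to the point \<open>i\<close>. The inequality \<open>S x y \<le> T (fst x) (fst y)\<close> makes it possible to glue
  both spaces along the map \<open>fst\<close>, and \<open>1 / \<alpha>\<close>, \<open>1 / \<beta>\<close> bound the magnitudes of the limit from above and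
  of the approximating spaces from below. The uniform constants \<open>m\<close> and \<open>c\<close> leave room for an additional
  distant point.\<close>

definition fattening :: "nat list \<Rightarrow> (nat \<Rightarrow> nat \<Rightarrow> real) \<Rightarrow> real \<Rightarrow> real \<Rightarrow> real \<Rightarrow>
    (nat \<times> nat \<Rightarrow> nat \<times> nat \<Rightarrow> real) \<Rightarrow> bool" where
  "fattening r T m c \<beta> S \<longleftrightarrow> strict_similarity (pts r) S \<and> pos_def (pts r) S \<and>
     (\<forall>x\<in>pts r. \<forall>y\<in>pts r. m \<le> S x y \<and> S x y \<le> T (fst x) (fst y)) \<and>
     (\<forall>v. c * (\<Sum>x\<in>pts r. v x)\<^sup>2 \<le> qform (pts r) S v) \<and>
     (\<exists>v. (\<Sum>x\<in>pts r. v x) = 1 \<and> qform (pts r) S v \<le> \<beta>)"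

definition unstable :: "nat list \<Rightarrow> bool" where
  "unstable r \<longleftrightarrow> (\<exists>T S \<alpha> \<beta> c m. 0 < m \<and> 0 < c \<and> \<beta> < \<alpha> \<and>
     strict_similarity {..<length r} T \<and> pos_def {..<length r} T \<and>
     (\<forall>u. \<alpha> * (\<Sum>i<length r. u i)\<^sup>2 \<le> qform {..<length r} T u) \<and>
     (\<forall>n. fattening r T m c \<beta> (S n)) \<and>
     (\<forall>x\<in>pts r. \<forall>y\<in>pts r. (\<lambda>n::nat. S n x y) \<longlonglongrightarrow> T (fst x) (fst y)))"

lemma finite_pts: "finite (pts r)"
proof -
  have "pts r = (SIGMA i:{..<length r}. {..r ! i})" by (auto simp: pts_def)
  then show ?thesis by simp
qed

section \<open>Adding a distant point\<close>

definition extend :: "'i \<Rightarrow> ('i \<Rightarrow> real) \<Rightarrow> ('i \<Rightarrow> 'i \<Rightarrow> real) \<Rightarrow> 'i \<Rightarrow> 'i \<Rightarrow> real" where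
  "extend z h S x y = (if x = z then if y = z then 1 else h y else if y = z then h x else S x y)"

text \<open>The essential new triangles contain \<open>z\<close> either as an end
  (\<open>tri\<close>) or in the middle (\<open>tri'\<close>).\<close>

lemma strict_similarity_extend:
  assumes S: "strict_similarity I S" and z: "z \<notin> I"
    and h: "\<And>x. x \<in> I \<Longrightarrow> 0 < h x \<and> h x < 1"
    and tri: "\<And>x y. x \<in> I \<Longrightarrow> y \<in> I \<Longrightarrow> h x * S x y \<le> h y"
    and tri': "\<And>x y. x \<in> I \<Longrightarrow> y \<in> I \<Longrightarrow> h x * h y \<le> S x y"
  shows "strict_similarity (insert z I) (extend z h S)"
proof -
  have sim: "similarity I S" and lt: "\<And>x y. x \<in> I \<Longrightarrow> y \<in> I \<Longrightarrow> x \<noteq> y \<Longrightarrow> S x y < 1"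
    using S unfolding strict_similarity_def by auto
  have ne: "x \<noteq> z" if "x \<in> I" for x using that z by auto
  have h1: "h x * h x \<le> 1" if "x \<in> I" for x
    using tri'[OF that that] similarityD(1)[OF sim that that] by simp
  have s1: "h x \<le> 1" if "x \<in> I" for x using h[OF that] by simp
  have tri2: "S x y * h y \<le> h x" if "x \<in> I" "y \<in> I" for x y
    using tri[OF that(2,1)] similarityD(2)[OF sim that] by (simp add: mult.commute)
  show ?thesis
    unfolding strict_similarity_def similarity_def
  proof (intro conjI ballI impI)
    fix x y
    assume xy: "x \<in> insert z I" "y \<in> insert z I"
    show "extend z h S x y = extend z h S y x"
      using xy similarityD(2)[OF sim] by (auto simp: extend_def)
    show "0 < extend z h S x y" using xy h similarityD(3)[OF sim] by (auto simp: extend_def)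
    show "extend z h S x y \<le> 1" using xy s1 similarityD(4)[OF sim] by (auto simp: extend_def)
    show "extend z h S x y < 1" if "x \<noteq> y" using xy h lt that by (auto simp: extend_def)
    show "extend z h S x x = 1" using xy similarityD(1)[OF sim] by (auto simp: extend_def)
    fix w assume "w \<in> insert z I"
    then show "extend z h S x y * extend z h S y w \<le> extend z h S x w"
      using xy tri tri' tri2 h1 similarityD(5)[OF sim] ne by (auto simp: extend_def)
  qed
qed

lemma bform_extend:
  assumes "finite I" "z \<notin> I"
  shows "qform (insert z I) (extend z h S) v
    = qform I S v + 2 * v z * (\<Sum>x\<in>I. h x * v x) + (v z)\<^sup>2"
proof -
  have ne: "x \<noteq> z" if "x \<in> I" for x using that assms(2) by auto
  have row: "(\<Sum>y\<in>insert z I. extend z h S z y * v z * v y) = (v z)\<^sup>2 + v z * (\<Sum>y\<in>I. h y * v y)"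
    using assms ne by (simp add: extend_def power2_eq_square sum_distrib_left mult_ac cong: sum.cong)
  have row': "(\<Sum>y\<in>insert z I. extend z h S x y * v x * v y) = v z * (h x * v x) + (\<Sum>y\<in>I. S x y * v x * v y)"
    if "x \<in> I" for x
    using assms ne that by (simp add: extend_def mult_ac cong: sum.cong)
  have "qform (insert z I) (extend z h S) v
      = (\<Sum>y\<in>insert z I. extend z h S z y * v z * v y)
        + (\<Sum>x\<in>I. \<Sum>y\<in>insert z I. extend z h S x y * v x * v y)"
    unfolding bform_def by (rule sum.insert[OF assms])
  also have "\<dots> = (v z)\<^sup>2 + v z * (\<Sum>y\<in>I. h y * v y)
      + (\<Sum>x\<in>I. v z * (h x * v x) + (\<Sum>y\<in>I. S x y * v x * v y))"
    unfolding row by (simp only: row' cong: sum.cong)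
  finally have "qform (insert z I) (extend z h S) v = (v z)\<^sup>2 + v z * (\<Sum>y\<in>I. h y * v y)
      + (\<Sum>x\<in>I. v z * (h x * v x) + (\<Sum>y\<in>I. S x y * v x * v y))" .
  then show ?thesis by (simp add: sum.distrib sum_distrib_left[symmetric] bform_def)
qed

text \<open>Adding a point with similarity \<open>s\<close> to all other points turns the minimum \<open>a\<close> of the quadratic
  form on vectors with coordinate sum 1 into \<open>(a - s\<^sup>2) / (a + 1 - 2 * s)\<close>, an increasing function of \<open>a\<close>.\<close>

lemma far_point_bound:
  fixes a q s t U :: real
  assumes "a * U\<^sup>2 \<le> q" "s\<^sup>2 < a" "0 < s" "s < 1"
  shows "0 < a + 1 - 2 * s" and "(a - s\<^sup>2) / (a + 1 - 2 * s) * (U + t)\<^sup>2 \<le> q + 2 * t * (s * U) + t\<^sup>2"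
proof -
  have "(1 - s)\<^sup>2 > 0" using assms by simp
  then show den: "0 < a + 1 - 2 * s" using assms(2) by (simp add: power2_eq_square algebra_simps)
  \<comment> \<open>The defect is a perfect square, so equality requires
    \<open>(a - s) * U = (1 - s) * t\<close>; this dictates the test weights in
    \<open>unstable_append_0\<close>.\<close>
  have "(a + 1 - 2 * s) * (a * U\<^sup>2 + 2 * t * (s * U) + t\<^sup>2) - (a - s\<^sup>2) * (U + t)\<^sup>2
      = ((a - s) * U - (1 - s) * t)\<^sup>2"
    by (simp add: power2_eq_square algebra_simps)
  then have "(a - s\<^sup>2) * (U + t)\<^sup>2 \<le> (a + 1 - 2 * s) * (a * U\<^sup>2 + 2 * t * (s * U) + t\<^sup>2)"
    using zero_le_power2[of "(a - s) * U - (1 - s) * t"] by linarith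
  also have "\<dots> \<le> (a + 1 - 2 * s) * (q + 2 * t * (s * U) + t\<^sup>2)"
    using assms(1) den by (intro mult_left_mono) auto
  finally show "(a - s\<^sup>2) / (a + 1 - 2 * s) * (U + t)\<^sup>2 \<le> q + 2 * t * (s * U) + t\<^sup>2"
    using den by (simp add: field_simps)
qed

text \<open>After cross-multiplication the difference of the sides is
  \<open>(1 - s)^2 * (a - b)\<close>, so the gap between \<beta> and \<alpha> survives.\<close>

lemma far_point_strict_mono:
  fixes a b s :: real
  assumes "b < a" "s\<^sup>2 < b" "0 < s" "s < 1"
  shows "(b - s\<^sup>2) / (b + 1 - 2 * s) < (a - s\<^sup>2) / (a + 1 - 2 * s)"
proof -
  have den: "0 < b + 1 - 2 * s" "0 < a + 1 - 2 * s"
    using far_point_bound(1)[of b 0 0 s] far_point_bound(1)[of a 0 0 s] assms by auto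
  have "(1 - s)\<^sup>2 > 0" using assms by simp
  from mult_strict_left_mono[OF assms(1) this] show ?thesis
    using den by (simp add: divide_simps) (simp add: power2_eq_square algebra_simps)
qed

text \<open>Completing the square in \<open>v z\<close> leaves the old form minus \<open>s^2\<close>
  times the squared total mass, which the lower bound by \<open>c\<close> keeps positive.\<close>

lemma pos_def_far_point:
  assumes I: "finite I" "z \<notin> I" and pd: "pos_def I S"
    and c: "\<And>v. c * (\<Sum>x\<in>I. v x)\<^sup>2 \<le> qform I S v" "s\<^sup>2 < c"
  shows "pos_def (insert z I) (extend z (\<lambda>_. s) S)"
  unfolding pos_def_def
proof (intro allI impI)
  fix v :: "'a \<Rightarrow> real"
  assume v: "\<exists>x\<in>insert z I. v x \<noteq> 0"
  let ?U = "\<Sum>x\<in>I. v x"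
  have Q: "qform (insert z I) (extend z (\<lambda>_. s) S) v = (qform I S v - s\<^sup>2 * ?U\<^sup>2) + (v z + s * ?U)\<^sup>2"
    unfolding bform_extend[OF I] by (simp add: power2_eq_square sum_distrib_left[symmetric] algebra_simps)
  show "0 < qform (insert z I) (extend z (\<lambda>_. s) S) v"
  proof (cases "\<exists>x\<in>I. v x \<noteq> 0")
    case True
    then have q: "qform I S v > 0" using pd unfolding pos_def_def by blast
    have "s\<^sup>2 * ?U\<^sup>2 < qform I S v"
    proof (cases "?U = 0")
      case False
      then have "s\<^sup>2 * ?U\<^sup>2 < c * ?U\<^sup>2" using c(2) by simp
      then show ?thesis using c(1)[of v] by linarith
    qed (use q in simp)
    then show ?thesis unfolding Q by (simp add: add_pos_nonneg)
  next
    case False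
    then have "v z \<noteq> 0" "?U = 0" "qform I S v = 0" using v by (auto simp: bform_def)
    then show ?thesis unfolding Q by simp
  qed
qed

lemma unstable_append_0:
  assumes "unstable r" and ne: "r \<noteq> []"
  shows "unstable (r @ [0])"
proof -
  let ?k = "length r"
  obtain T S \<alpha> \<beta> c m where pos: "0 < m" "0 < c" "\<beta> < \<alpha>"
    and T: "strict_similarity {..<?k} T" "pos_def {..<?k} T"
      "\<And>u. \<alpha> * (\<Sum>i<?k. u i)\<^sup>2 \<le> qform {..<?k} T u"
    and S: "\<And>n. fattening r T m c \<beta> (S n)"
    and lim: "\<And>x y. x \<in> pts r \<Longrightarrow> y \<in> pts r \<Longrightarrow> (\<lambda>n::nat. S n x y) \<longlonglongrightarrow> T (fst x) (fst y)"
    using assms unfolding unstable_def by metis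
  \<comment> \<open>\<open>s \<le> m\<close> gives \<open>s * s \<le> m\<close>, the triangle
    inequality through the new point; \<open>s \<le> c\<close> and \<open>s < 1\<close> give
    \<open>s^2 < c\<close>, uniformly in \<open>n\<close>.\<close>
  define s where "s = min (1/2) (min c m)"
  have s: "0 < s" "s < 1" "s \<le> m" using pos by (auto simp: s_def)
  have "s * s \<le> (1/2) * s" using s by (intro mult_right_mono) (auto simp: s_def)
  then have s2: "s\<^sup>2 < s" "s \<le> c" using s by (auto simp: power2_eq_square s_def)
  have sc: "s\<^sup>2 < c" using s2 by simp
  have ss: "s * s < s" using s2(1) unfolding power2_eq_square .
  have S': "strict_similarity (pts r) (S n)" "pos_def (pts r) (S n)"
      "\<And>x y. x \<in> pts r \<Longrightarrow> y \<in> pts r \<Longrightarrow> m \<le> S n x y"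
      "\<And>x y. x \<in> pts r \<Longrightarrow> y \<in> pts r \<Longrightarrow> S n x y \<le> T (fst x) (fst y)"
      "\<And>v. c * (\<Sum>x\<in>pts r. v x)\<^sup>2 \<le> qform (pts r) (S n) v"
      "\<exists>v. (\<Sum>x\<in>pts r. v x) = 1 \<and> qform (pts r) (S n) v \<le> \<beta>" for n
    using S[of n] unfolding fattening_def by auto
  \<comment> \<open>Hence \<open>s^2\<close> lies below \<beta> and \<alpha> as well, and the
    transformation \<open>?f\<close> applies to all three constants.\<close>
  have c\<beta>: "c \<le> \<beta>"
  proof -
    obtain v where v: "(\<Sum>x\<in>pts r. v x) = 1" "qform (pts r) (S 0) v \<le> \<beta>"
      using S'(6) by blast
    have "c * (\<Sum>x\<in>pts r. v x)\<^sup>2 \<le> qform (pts r) (S 0) v" by (rule S'(5))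
    then show ?thesis using v by simp
  qed
  let ?f = "\<lambda>a. (a - s\<^sup>2) / (a + 1 - 2 * s)"
  let ?z = "(?k, 0::nat)"
  let ?T = "extend ?k (\<lambda>_. s) T" and ?S = "\<lambda>n. extend ?z (\<lambda>_. s) (S n)"
  have pts: "pts (r @ [0]) = insert ?z (pts r)"
    by (auto simp: pts_def nth_append less_Suc_eq split: if_splits)
  have z: "?z \<notin> pts r" by (simp add: pts_def)
  have k: "{..<length (r @ [0])} = insert ?k {..<?k}" by auto
  have k': "?k \<notin> {..<?k}" by simp
  have den: "0 < c + 1 - 2 * s" "0 < \<beta> + 1 - 2 * s"
    using far_point_bound(1)[of c 0 0 s] far_point_bound(1)[of \<beta> 0 0 s] sc c\<beta> s by auto
  have "0 < ?f c" using den sc by simp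
  have mul: "s * t \<le> s" if "t \<le> 1" for t using mult_left_mono[OF that, of s] s by simp
  have mT: "m \<le> T i j" if "i < ?k" "j < ?k" for i j
  proof -
    have "(i, 0) \<in> pts r" "(j, 0) \<in> pts r" using that by (auto simp: pts_def)
    then show ?thesis using S'(3,4)[of "(i, 0)" "(j, 0)" 0] by simp
  qed
  have T': "strict_similarity {..<length (r @ [0])} ?T"
    unfolding k
  proof (rule strict_similarity_extend[OF T(1)])
    show "s * s \<le> T i j" if "i \<in> {..<?k}" "j \<in> {..<?k}" for i j
      using mT[of i j] that ss s(3) by simp
    show "s * T i j \<le> s" if "i \<in> {..<?k}" "j \<in> {..<?k}" for i j
      using T(1) that unfolding strict_similarity_def by (intro mul similarityD(4)) auto
  qed (use s in auto)
  have S1: "strict_similarity (pts (r @ [0])) (?S n)" for n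
    unfolding pts
  proof (rule strict_similarity_extend[OF S'(1) z])
    show "s * s \<le> S n x y" if "x \<in> pts r" "y \<in> pts r" for x y
      using S'(3)[OF that, of n] ss s(3) by simp
    show "s * S n x y \<le> s" if "x \<in> pts r" "y \<in> pts r" for x y
      using S'(1) that unfolding strict_similarity_def by (intro mul similarityD(4)) auto
  qed (use s in auto)
  have m1: "m \<le> 1"
    using mT[of 0 0] ne T(1) similarityD(1)[of "{..<?k}" T 0 0] unfolding strict_similarity_def by simp
  have fat: "fattening (r @ [0]) ?T (min s m) (?f c) (?f \<beta>) (?S n)" for n
    unfolding fattening_def
  proof (intro conjI allI ballI)
    show "strict_similarity (pts (r @ [0])) (?S n)" by (rule S1)
    show "pos_def (pts (r @ [0])) (?S n)"
      unfolding pts by (rule pos_def_far_point[OF finite_pts z S'(2) S'(5) sc])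
    fix x y assume xy: "x \<in> pts (r @ [0])" "y \<in> pts (r @ [0])"
    show "min s m \<le> ?S n x y"
      using xy S'(3)[of x y n] m1 s unfolding pts extend_def by auto
    show "?S n x y \<le> ?T (fst x) (fst y)"
    proof -
      have "fst x = ?k \<longleftrightarrow> x = ?z" "fst y = ?k \<longleftrightarrow> y = ?z"
        using xy unfolding pts by (auto simp: pts_def)
      then show ?thesis using xy S'(4)[of x y n] unfolding pts extend_def by auto
    qed
  next
    fix v :: "nat \<times> nat \<Rightarrow> real"
    have cS: "c * (\<Sum>x\<in>pts r. v x)\<^sup>2 \<le> qform (pts r) (S n) v" by (rule S'(5))
    show "?f c * (\<Sum>x\<in>pts (r @ [0]). v x)\<^sup>2 \<le> qform (pts (r @ [0])) (?S n) v"
      using far_point_bound(2)[OF cS sc s(1,2), of "v ?z"]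
      unfolding pts bform_extend[OF finite_pts z] sum.insert[OF finite_pts z]
      by (simp add: sum_distrib_left[symmetric] add.commute)
  next
    obtain v where v: "(\<Sum>x\<in>pts r. v x) = 1" "qform (pts r) (S n) v \<le> \<beta>"
      using S'(6) by blast
    \<comment> \<open>The equality case of \<open>far_point_bound\<close> for
      \<open>a = \<beta>\<close>, normalized by \<open>U + t = 1\<close>.\<close>
    define U t where "U = (1 - s) / (\<beta> + 1 - 2 * s)" and "t = (\<beta> - s) / (\<beta> + 1 - 2 * s)"
    define w where "w x = (if x = ?z then t else U * v x)" for x
    have w: "w ?z = t" "\<And>x. x \<in> pts r \<Longrightarrow> w x = U * v x" using z by (auto simp: w_def)
    have sumw: "(\<Sum>x\<in>pts r. w x) = U"
      using v(1) w(2) by (simp add: sum_distrib_left[symmetric])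
    have qw: "qform (pts r) (S n) w = U\<^sup>2 * qform (pts r) (S n) v"
    proof -
      have "qform (pts r) (S n) w = qform (pts r) (S n) (\<lambda>x. U * v x)"
        using w(2) by (intro bform_cong) auto
      then show ?thesis by (simp add: bform_scale_left bform_scale_right power2_eq_square)
    qed
    have "U + t = 1" using den(2) by (simp add: U_def t_def divide_simps)
    moreover have "U\<^sup>2 * \<beta> + 2 * t * (s * U) + t\<^sup>2 = ?f \<beta>"
    proof -
      let ?d = "\<beta> + 1 - 2 * s"
      have U: "U * ?d = 1 - s" "t * ?d = \<beta> - s" using den(2) by (auto simp: U_def t_def)
      have "(U\<^sup>2 * \<beta> + 2 * t * (s * U) + t\<^sup>2) * ?d\<^sup>2 = (U * ?d)\<^sup>2 * \<beta> + 2 * (t * ?d) * (s * (U * ?d)) + (t * ?d)\<^sup>2"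
        by (simp add: power2_eq_square algebra_simps)
      also have "\<dots> = (\<beta> - s\<^sup>2) * ?d"
        unfolding U by (simp add: power2_eq_square algebra_simps)
      finally have "(U\<^sup>2 * \<beta> + 2 * t * (s * U) + t\<^sup>2) * ?d * ?d = (\<beta> - s\<^sup>2) * ?d"
        by (simp only: power2_eq_square mult.assoc)
      then show ?thesis using den(2) by (simp only: eq_divide_eq mult_right_cancel less_irrefl) auto
    qed
    moreover have "U\<^sup>2 * qform (pts r) (S n) v \<le> U\<^sup>2 * \<beta>" using v(2) by (intro mult_left_mono) auto
    ultimately show "\<exists>v. (\<Sum>x\<in>pts (r @ [0]). v x) = 1 \<and> qform (pts (r @ [0])) (?S n) v \<le> ?f \<beta>"
      unfolding pts bform_extend[OF finite_pts z] sum.insert[OF finite_pts z]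
      by (intro exI[of _ w]) (simp add: w(1) sumw qw sum_distrib_left[symmetric])
  qed
  show ?thesis
    unfolding unstable_def
  proof (intro exI conjI allI ballI)
    show "0 < min s m" "0 < ?f c" using s pos \<open>0 < ?f c\<close> by auto
    show "?f \<beta> < ?f \<alpha>" using far_point_strict_mono[OF pos(3) _ s(1,2)] sc c\<beta> by simp
    show "strict_similarity {..<length (r @ [0])} ?T" by (rule T')
    show "pos_def {..<length (r @ [0])} ?T"
      unfolding k by (rule pos_def_far_point[OF _ k' T(2,3)]) (use sc c\<beta> pos in auto)
    show "?f \<alpha> * (\<Sum>i<length (r @ [0]). u i)\<^sup>2 \<le> qform {..<length (r @ [0])} ?T u" for u
      using far_point_bound(2)[OF T(3)[of u] _ s(1,2), of "u ?k"] sc c\<beta> pos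
      unfolding k bform_extend[OF finite_lessThan k'] sum.insert[OF finite_lessThan k']
      by (simp add: sum_distrib_left[symmetric] add.commute)
    show "fattening (r @ [0]) ?T (min s m) (?f c) (?f \<beta>) (?S n)" for n by (rule fat)
    fix x y assume xy: "x \<in> pts (r @ [0])" "y \<in> pts (r @ [0])"
    have "fst x = ?k \<longleftrightarrow> x = ?z" "fst y = ?k \<longleftrightarrow> y = ?z"
      using xy unfolding pts by (auto simp: pts_def)
    then show "(\<lambda>n. ?S n x y) \<longlonglongrightarrow> ?T (fst x) (fst y)"
      using xy lim[of x y] unfolding pts extend_def by auto
  qed
qed

text \<open>The new point is a leaf attached to \<open>(i, 0)\<close> by an edge of length
  \<open>- ln (1 - \<delta> n)\<close>, which tends to 0. The old weights extended by 0 still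
  witness \<beta>, while \<open>T\<close> and \<alpha> are unchanged; only the uniform constants are
  halved.\<close>

lemma unstable_increase:
  assumes "unstable r" and i: "i < length r"
  shows "unstable (r[i := Suc (r ! i)])"
proof -
  let ?k = "length r" and ?r = "r[i := Suc (r ! i)]"
  obtain T S \<alpha> \<beta> c m where pos: "0 < m" "0 < c" "\<beta> < \<alpha>"
    and T: "strict_similarity {..<?k} T" "pos_def {..<?k} T"
      "\<And>u. \<alpha> * (\<Sum>i<?k. u i)\<^sup>2 \<le> qform {..<?k} T u"
    and S: "\<And>n. fattening r T m c \<beta> (S n)"
    and lim: "\<And>x y. x \<in> pts r \<Longrightarrow> y \<in> pts r \<Longrightarrow> (\<lambda>n::nat. S n x y) \<longlonglongrightarrow> T (fst x) (fst y)"
    using assms unfolding unstable_def by metis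
  have S': "strict_similarity (pts r) (S n)" "pos_def (pts r) (S n)"
      "\<And>x y. x \<in> pts r \<Longrightarrow> y \<in> pts r \<Longrightarrow> m \<le> S n x y"
      "\<And>x y. x \<in> pts r \<Longrightarrow> y \<in> pts r \<Longrightarrow> S n x y \<le> T (fst x) (fst y)"
      "\<And>v. c * (\<Sum>x\<in>pts r. v x)\<^sup>2 \<le> qform (pts r) (S n) v"
      "\<exists>v. (\<Sum>x\<in>pts r. v x) = 1 \<and> qform (pts r) (S n) v \<le> \<beta>" for n
    using S[of n] unfolding fattening_def by auto
  have sim: "similarity (pts r) (S n)" for n using S'(1) unfolding strict_similarity_def by blast
  let ?e = "(i, 0::nat)" and ?z = "(i, Suc (r ! i))"
  \<comment> \<open>The shift by 2 gives \<open>\<delta> n \<le> 1 / 2\<close> already for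
    \<open>n = 0\<close>.\<close>
  define \<delta> where "\<delta> n = 1 / real (n + 2)" for n :: nat
  have \<delta>: "0 < \<delta> n" "\<delta> n \<le> 1 / 2" for n by (auto simp: \<delta>_def field_simps)
  have \<delta>_lim: "\<delta> \<longlonglongrightarrow> 0"
  proof -
    have "(\<lambda>n. 1 / real (Suc (Suc n))) \<longlonglongrightarrow> 0" by (intro LIMSEQ_Suc lim_1_over_n)
    then show ?thesis unfolding \<delta>_def by simp
  qed
  have e: "?e \<in> pts r" using i by (simp add: pts_def)
  have z: "?z \<notin> pts r" by (simp add: pts_def)
  have pts: "pts ?r = insert ?z (pts r)"
    using i by (auto simp: pts_def nth_list_update split: if_splits)
  define h where "h n x = (1 - \<delta> n) * S n ?e x" for n x
  let ?S = "\<lambda>n. extend ?z (h n) (S n)"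
  have e_bd: "0 < S n ?e x" "S n ?e x \<le> 1" if "x \<in> pts r" for n x
    using similarityD(3,4)[OF sim e that] by auto
  have strict: "strict_similarity (pts ?r) (?S n)" for n
    unfolding pts
  proof (rule strict_similarity_extend[OF S'(1) z])
    fix x y assume x: "x \<in> pts r" and y: "y \<in> pts r"
    have le: "(1 - \<delta> n) * S n ?e x \<le> (1 - \<delta> n) * 1"
      using e_bd[OF x] \<delta>[of n] by (intro mult_left_mono) auto
    show "0 < h n x \<and> h n x < 1"
    proof
      show "0 < h n x" using e_bd[OF x] \<delta>[of n] unfolding h_def by auto
      show "h n x < 1" unfolding h_def by (rule order_le_less_trans[OF le]) (use \<delta>(1)[of n] in simp)
    qed
    have "(1 - \<delta> n) * (S n ?e x * S n x y) \<le> (1 - \<delta> n) * S n ?e y"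
      using similarityD(5)[OF sim e x y] \<delta>[of n] by (intro mult_left_mono) auto
    then show "h n x * S n x y \<le> h n y" unfolding h_def by (simp add: mult_ac)
    have "h n x * h n y = ((1 - \<delta> n) * (1 - \<delta> n)) * (S n x ?e * S n ?e y)"
      unfolding h_def using similarityD(2)[OF sim x e] by (simp add: mult_ac)
    also have "\<dots> \<le> 1 * (S n x ?e * S n ?e y)"
      using e_bd[OF x] e_bd[OF y] similarityD(2)[OF sim x e] \<delta>[of n]
      by (intro mult_right_mono mult_le_one) (auto intro: mult_nonneg_nonneg less_imp_le)
    also have "\<dots> \<le> S n x y" using similarityD(5)[OF sim x e y] by simp
    finally show "h n x * h n y \<le> S n x y" .
  qed
  \<comment> \<open>Moving the mass of the new point to \<open>?e\<close> and completing the square costs at most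
    \<open>\<delta> n / 2\<close> of the old quadratic form.\<close>
  have Q: "\<exists>u. (\<Sum>x\<in>pts r. u x) = (\<Sum>x\<in>pts ?r. v x) \<and>
      (\<forall>x\<in>pts r. x \<noteq> ?e \<longrightarrow> u x = v x) \<and> u ?e = v ?e + v ?z \<and>
      (\<exists>t. t \<ge> 0 \<and> ((\<forall>x\<in>pts r. u x = 0) \<longrightarrow> t = 2 * \<delta> n * (v ?z)\<^sup>2) \<and>
        qform (pts ?r) (?S n) v \<ge> (1 - \<delta> n / 2) * qform (pts r) (S n) u + t)" for n v
  proof -
    define ind where "ind x = (if x = ?e then 1 else 0 :: real)" for x :: "nat \<times> nat"
    define u where "u x = v x + v ?z * ind x" for x
    have ind_sum: "(\<Sum>x\<in>pts r. f x * ind x) = f ?e" for f :: "nat \<times> nat \<Rightarrow> real"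
    proof -
      have "(\<Sum>x\<in>pts r. f x * ind x) = (\<Sum>x\<in>pts r. if x = ?e then f x else 0)"
        by (intro sum.cong) (auto simp: ind_def)
      then show ?thesis using e finite_pts by simp
    qed
    define H where "H = bform (pts r) (S n) u ind"
    have H: "H = (\<Sum>x\<in>pts r. S n ?e x * u x)"
    proof -
      have "H = (\<Sum>x\<in>pts r. \<Sum>y\<in>pts r. (S n x y * u x) * ind y)" by (simp add: H_def bform_def)
      also have "\<dots> = (\<Sum>x\<in>pts r. S n x ?e * u x)"
        by (intro sum.cong refl) (rule ind_sum)
      also have "\<dots> = (\<Sum>x\<in>pts r. S n ?e x * u x)"
        using similarityD(2)[OF sim _ e] by (intro sum.cong) auto
      finally show ?thesis .
    qed
    have ii: "qform (pts r) (S n) ind = 1"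
    proof -
      have "qform (pts r) (S n) ind = (\<Sum>x\<in>pts r. (\<Sum>y\<in>pts r. (S n x y) * ind y) * ind x)"
        by (simp add: bform_def sum_distrib_left sum_distrib_right mult_ac)
      then show ?thesis unfolding ind_sum using similarityD(1)[OF sim e e] by simp
    qed
    have "H\<^sup>2 \<le> qform (pts r) (S n) u * 1"
      unfolding H_def ii[symmetric]
      by (rule bform_Cauchy_Schwarz[OF S'(2)]) (rule similarityD(2)[OF sim])
    then have H2: "H\<^sup>2 \<le> qform (pts r) (S n) u" by simp
    have swap: "bform (pts r) (S n) ind u = H"
      unfolding H_def by (rule bform_sym) (rule similarityD(2)[OF sim])
    have "qform (pts r) (S n) v = qform (pts r) (S n) (\<lambda>x. u x + (- v ?z) * ind x)"
      by (rule bform_cong) (simp_all add: u_def)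
    also have "\<dots> = qform (pts r) (S n) u - 2 * v ?z * H + (v ?z)\<^sup>2"
      unfolding bform_add_left bform_add_right bform_scale_left bform_scale_right ii swap H_def[symmetric]
      by (simp add: power2_eq_square algebra_simps)
    finally have qv: "qform (pts r) (S n) v = qform (pts r) (S n) u - 2 * v ?z * H + (v ?z)\<^sup>2" .
    have hv: "(\<Sum>x\<in>pts r. h n x * v x) = (1 - \<delta> n) * (H - v ?z)"
    proof -
      have "(\<Sum>x\<in>pts r. h n x * v x) = (\<Sum>x\<in>pts r. (1 - \<delta> n) * (S n ?e x * u x))
          - (\<Sum>x\<in>pts r. ((1 - \<delta> n) * v ?z * S n ?e x) * ind x)"
        unfolding sum_subtractf[symmetric] by (intro sum.cong) (auto simp: h_def u_def algebra_simps)
      also have "\<dots> = (1 - \<delta> n) * H - (1 - \<delta> n) * v ?z * S n ?e ?e"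
        unfolding ind_sum H by (simp add: sum_distrib_left)
      finally show ?thesis using similarityD(1)[OF sim e e] by (simp add: algebra_simps)
    qed
    define t where "t = 2 * \<delta> n * (v ?z - H / 2)\<^sup>2"
    have "qform (pts ?r) (?S n) v = qform (pts r) (S n) u + t - \<delta> n / 2 * H\<^sup>2"
      unfolding pts bform_extend[OF finite_pts z] hv qv t_def
      by (simp add: power2_eq_square algebra_simps)
    also have "\<dots> \<ge> qform (pts r) (S n) u + t - \<delta> n / 2 * qform (pts r) (S n) u"
      using H2 \<delta>(1)[of n] by (intro diff_left_mono mult_left_mono) auto
    finally have "qform (pts ?r) (?S n) v \<ge> (1 - \<delta> n / 2) * qform (pts r) (S n) u + t"
      by (simp add: algebra_simps)
    moreover have "(\<Sum>x\<in>pts r. u x) = (\<Sum>x\<in>pts ?r. v x)"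
      unfolding pts sum.insert[OF finite_pts z] u_def sum.distrib
      using ind_sum[of "\<lambda>_. v ?z"] by simp
    moreover have "t \<ge> 0" using \<delta>(1)[of n] by (simp add: t_def)
    moreover have "t = 2 * \<delta> n * (v ?z)\<^sup>2" if "\<forall>x\<in>pts r. u x = 0"
      using that unfolding t_def H by simp
    moreover have "\<forall>x\<in>pts r. x \<noteq> ?e \<longrightarrow> u x = v x" "u ?e = v ?e + v ?z"
      by (auto simp: u_def ind_def)
    ultimately show ?thesis by blast
  qed
  have fat: "fattening ?r T (m / 2) (c / 2) \<beta> (?S n)" for n
    unfolding fattening_def
  proof (intro conjI allI ballI)
    show "strict_similarity (pts ?r) (?S n)" by (rule strict)
    have half: "1 / 2 \<le> 1 - \<delta> n / 2" using \<delta>(2)[of n] by simp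
    show "pos_def (pts ?r) (?S n)"
      unfolding pos_def_def
    proof (intro allI impI)
      fix v :: "nat \<times> nat \<Rightarrow> real"
      assume v: "\<exists>x\<in>pts ?r. v x \<noteq> 0"
      obtain u t where u: "\<forall>x\<in>pts r. x \<noteq> ?e \<longrightarrow> u x = v x" "u ?e = v ?e + v ?z" and
        t: "t \<ge> 0" "(\<forall>x\<in>pts r. u x = 0) \<longrightarrow> t = 2 * \<delta> n * (v ?z)\<^sup>2"
        "qform (pts ?r) (?S n) v \<ge> (1 - \<delta> n / 2) * qform (pts r) (S n) u + t"
        using Q[where n = n and v = v] by (elim exE conjE) (rule that)
      show "0 < qform (pts ?r) (?S n) v"
      proof (cases "\<exists>x\<in>pts r. u x \<noteq> 0")
        case True
        then have "0 < (1 - \<delta> n / 2) * qform (pts r) (S n) u"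
          using S'(2)[of n] half unfolding pos_def_def by (intro mult_pos_pos) auto
        then show ?thesis using t by linarith
      next
        case False
        \<comment> \<open>If all the moved mass cancels, the old form gives nothing and positivity
          comes from \<open>t\<close>. It is nonzero, since with \<open>v ?z = 0\<close> nothing was
          moved and \<open>v\<close> would vanish with \<open>u\<close>.\<close>
        have "v ?z \<noteq> 0"
        proof
          assume "v ?z = 0"
          then have "v x = 0" if "x \<in> pts r" for x
            using u False that e by (metis add.right_neutral)
          then show False using v \<open>v ?z = 0\<close> unfolding pts by auto
        qed
        then have "t > 0" using t(2) False \<delta>(1)[of n] by simp
        moreover have "qform (pts r) (S n) u = 0" using False by (simp add: bform_def)
        ultimately show ?thesis using t(3) by simp
      qed
    qed
    show "c / 2 * (\<Sum>x\<in>pts ?r. v x)\<^sup>2 \<le> qform (pts ?r) (?S n) v" for v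
    proof -
      obtain u t where u: "(\<Sum>x\<in>pts r. u x) = (\<Sum>x\<in>pts ?r. v x)" "t \<ge> 0"
        "qform (pts ?r) (?S n) v \<ge> (1 - \<delta> n / 2) * qform (pts r) (S n) u + t"
        using Q[where n = n and v = v] by (elim exE conjE) (rule that)
      have "1 / 2 * qform (pts r) (S n) u \<le> (1 - \<delta> n / 2) * qform (pts r) (S n) u"
        using half pos_def_nonneg[OF S'(2)] by (rule mult_right_mono)
      moreover have "c * (\<Sum>x\<in>pts r. u x)\<^sup>2 \<le> qform (pts r) (S n) u" by (rule S'(5))
      ultimately show ?thesis using u by simp
    qed
    show "\<exists>v. (\<Sum>x\<in>pts ?r. v x) = 1 \<and> qform (pts ?r) (?S n) v \<le> \<beta>"
    proof -
      obtain v where v: "(\<Sum>x\<in>pts r. v x) = 1" "qform (pts r) (S n) v \<le> \<beta>"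
        using S'(6) by blast
      let ?w = "\<lambda>x. if x = ?z then 0 else v x"
      have w: "?w x = v x" if "x \<in> pts r" for x using that z by auto
      then have "qform (pts r) (S n) ?w = qform (pts r) (S n) v" by (intro bform_cong)
      moreover have "(\<Sum>x\<in>pts r. ?w x) = (\<Sum>x\<in>pts r. v x)" using w by (intro sum.cong) auto
      ultimately show ?thesis
        unfolding pts bform_extend[OF finite_pts z] sum.insert[OF finite_pts z]
        using v by (intro exI[of _ ?w]) simp
    qed
    fix x y assume xy: "x \<in> pts ?r" "y \<in> pts ?r"
    have hm: "m / 2 \<le> h n x" "h n x \<le> S n ?e x" if "x \<in> pts r" for x
    proof -
      have "1 / 2 * S n ?e x \<le> h n x" "h n x \<le> 1 * S n ?e x"
        unfolding h_def using e_bd[OF that] \<delta>[of n] by (auto intro: mult_right_mono)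
      then show "m / 2 \<le> h n x" "h n x \<le> S n ?e x" using S'(3)[OF e that, of n] by auto
    qed
    have m1: "m \<le> 1" using S'(3)[OF e e, of n] similarityD(1)[OF sim e e] by simp
    show "m / 2 \<le> ?S n x y"
      using xy hm(1)[of x] hm(1)[of y] m1 S'(3)[of x y n] pos(1) unfolding pts extend_def by auto
    have Te: "T i i = 1" using T(1) i similarityD(1)[of "{..<?k}" T i i] unfolding strict_similarity_def by simp
    have hT: "h n x \<le> T i (fst x)" if "x \<in> pts r" for x
      using hm(2)[OF that] S'(4)[OF e that, of n] by simp
    have hT': "h n x \<le> T (fst x) i" if "x \<in> pts r" for x
      using hm(2)[OF that] S'(4)[OF that e, of n] similarityD(2)[OF sim e that] by simp
    show "?S n x y \<le> T (fst x) (fst y)"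
      using xy S'(4)[of x y n] Te hT[of x] hT[of y] hT'[of x] hT'[of y] unfolding pts extend_def by auto
  qed
  show ?thesis
    unfolding unstable_def
  proof (intro exI conjI allI ballI)
    show "0 < m / 2" "0 < c / 2" "\<beta> < \<alpha>" using pos by auto
    show "strict_similarity {..<length ?r} T" "pos_def {..<length ?r} T" using T by auto
    show "\<alpha> * (\<Sum>i<length ?r. u i)\<^sup>2 \<le> qform {..<length ?r} T u" for u using T(3) by simp
    show "fattening ?r T (m / 2) (c / 2) \<beta> (?S n)" for n by (rule fat)
    fix x y assume xy: "x \<in> pts ?r" "y \<in> pts ?r"
    have h_lim: "(\<lambda>n. h n x) \<longlonglongrightarrow> T i (fst x)" "(\<lambda>n. h n x) \<longlonglongrightarrow> T (fst x) i" if "x \<in> pts r" for x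
    proof -
      have "(\<lambda>n. h n x) \<longlonglongrightarrow> (1 - 0) * T (fst ?e) (fst x)"
        unfolding h_def by (intro tendsto_intros \<delta>_lim lim e that)
      then show "(\<lambda>n. h n x) \<longlonglongrightarrow> T i (fst x)" by simp
      moreover have "T i (fst x) = T (fst x) i"
        using T(1) that i unfolding strict_similarity_def by (intro similarityD(2)) (auto simp: pts_def)
      ultimately show "(\<lambda>n. h n x) \<longlonglongrightarrow> T (fst x) i" by simp
    qed
    have Te: "T i i = 1" using T(1) i similarityD(1)[of "{..<?k}" T i i] unfolding strict_similarity_def by simp
    have ne: "w \<noteq> ?z" if "w \<in> pts r" for w using that z by auto
    show "(\<lambda>n. ?S n x y) \<longlonglongrightarrow> T (fst x) (fst y)"
      using xy lim[of x y] h_lim[of x] h_lim[of y] Te ne[of x] ne[of y] unfolding pts extend_def by auto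
  qed
qed

section \<open>Metric spaces realizing a given similarity\<close>

definition realize :: "('i \<Rightarrow> 'a) \<Rightarrow> 'i set \<Rightarrow> ('i \<Rightarrow> 'i \<Rightarrow> real) \<Rightarrow> 'a metric" where
  "realize f I S = metric (f ` I, \<lambda>x y. if x \<in> f ` I \<and> y \<in> f ` I
     then - ln (S (inv_into I f x) (inv_into I f y)) else 0)"

context
  fixes f :: "'i \<Rightarrow> 'a" and I :: "'i set" and S :: "'i \<Rightarrow> 'i \<Rightarrow> real"
  assumes inj: "inj_on f I" and S: "strict_similarity I S"
begin

lemma similarity_of_strict: "similarity I S"
  using S unfolding strict_similarity_def by blast

lemma Metric_space_realize: "Metric_space (f ` I) (\<lambda>x y. if x \<in> f ` I \<and> y \<in> f ` I
     then - ln (S (inv_into I f x) (inv_into I f y)) else 0)" (is "Metric_space _ ?d")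
proof
  note sim = similarity_of_strict
  have d: "?d (f x) (f y) = - ln (S x y)" if "x \<in> I" "y \<in> I" for x y
    using that inj by simp
  \<comment> \<open>Nonnegativity and symmetry are demanded of all arguments, also off the carrier,
    where the distance is set to 0.\<close>
  show "0 \<le> ?d x y" for x y
    using similarityD(3,4)[OF sim] by (auto simp: ln_le_zero_iff inj)
  show "?d x y = ?d y x" for x y
    using similarityD(2)[OF sim] inj by auto
  fix x y assume "x \<in> f ` I" "y \<in> f ` I"
  then obtain x' y' where x': "x = f x'" "x' \<in> I" "y = f y'" "y' \<in> I" by blast
  show "?d x y = 0 \<longleftrightarrow> x = y"
    using S similarityD(1,3)[OF sim x'(2,4)] x' inj
    unfolding strict_similarity_def by (force simp: d ln_eq_zero_iff inj_on_eq_iff)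
  fix z assume "z \<in> f ` I"
  then obtain z' where z': "z = f z'" "z' \<in> I" by blast
  have "ln (S x' y' * S y' z') \<le> ln (S x' z')"
    using similarityD(5)[OF sim x'(2,4) z'(2)] similarityD(3)[OF sim] x' z' by (subst ln_le_cancel_iff) auto
  moreover have "ln (S x' y' * S y' z') = ln (S x' y') + ln (S y' z')"
    using similarityD(3)[OF sim] x' z' by (simp add: ln_mult_pos)
  ultimately show "?d x z \<le> ?d x y + ?d y z"
    unfolding x' z' using d x'(2,4) z'(2) by simp
qed

lemma mspace_realize: "mspace (realize f I S) = f ` I"
  unfolding realize_def using Metric_space.mspace_metric[OF Metric_space_realize] .

lemma mdist_realize:
  assumes "x \<in> I" "y \<in> I" shows "mdist (realize f I S) (f x) (f y) = - ln (S x y)"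
  unfolding realize_def Metric_space.mdist_metric[OF Metric_space_realize] using assms inj by simp

lemma sim_realize: "x \<in> I \<Longrightarrow> y \<in> I \<Longrightarrow> sim (realize f I S) (f x) (f y) = S x y"
  unfolding sim_def using similarityD(3)[OF similarity_of_strict] by (simp add: mdist_realize)

lemma sum_realize: "(\<Sum>x\<in>mspace (realize f I S). h x) = (\<Sum>x\<in>I. h (f x))"
  unfolding mspace_realize by (simp add: sum.reindex[OF inj])

lemma qform_realize:
  "qform (mspace (realize f I S)) (sim (realize f I S)) v = qform I S (\<lambda>x. v (f x))"
  unfolding bform_def sum_realize by (intro sum.cong refl) (simp add: sim_realize)

lemma card_realize: "card (mspace (realize f I S)) = card I"
  unfolding mspace_realize by (rule card_image[OF inj])

context
  assumes fin: "finite I" and pd: "pos_def I S"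
begin

lemma finite_realize: "finite (mspace (realize f I S))"
  unfolding mspace_realize using fin by simp

lemma positive_definite_realize: "positive_definite_space (realize f I S)"
  unfolding positive_definite_space_iff[OF finite_realize] pos_def_def qform_realize
  using pd unfolding pos_def_def mspace_realize by auto

lemma magnitude_realize_le:
  assumes "\<alpha> > 0" "\<And>u. \<alpha> * (\<Sum>x\<in>I. u x)\<^sup>2 \<le> qform I S u"
  shows "magnitude (realize f I S) \<le> 1 / \<alpha>"
  by (rule magnitude_le[OF finite_realize positive_definite_realize])
    (use assms in \<open>auto simp: sum_realize qform_realize\<close>)

lemma magnitude_realize_ge:
  assumes "\<beta> > 0" "(\<Sum>x\<in>I. v x) = 1" "qform I S v \<le> \<beta>"
  shows "1 / \<beta> \<le> magnitude (realize f I S)"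
proof -
  let ?v = "\<lambda>a. v (inv_into I f a)"
  have q: "qform I S (\<lambda>x. ?v (f x)) = qform I S v" using inj by (intro bform_cong) auto
  have s: "(\<Sum>x\<in>I. ?v (f x)) = (\<Sum>x\<in>I. v x)" using inj by (intro sum.cong) auto
  have "1 \<le> magnitude (realize f I S) * qform I S v"
    using magnitude_bound[OF finite_realize positive_definite_realize, of ?v]
    unfolding sum_realize qform_realize q s assms(2) by simp
  also have "\<dots> \<le> magnitude (realize f I S) * \<beta>"
    using assms(3) magnitude_nonneg[OF finite_realize positive_definite_realize] by (rule mult_left_mono)
  finally show ?thesis using assms(1) by (simp add: field_simps)
qed

end

end

text \<open>The map \<open>p\<close> does not increase distances and shrinks them by at most
  \<open>2 * \<eta>\<close>. The cross-distance first maps a point by \<open>p\<close> and then adds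
  a bridge of length \<eta>; crossing twice pays for the whole distortion.\<close>

lemma gromov_hausdorff_distance_realize_le:
  fixes f :: "'i \<Rightarrow> 'a" and g :: "'j \<Rightarrow> 'b"
  assumes inj: "inj_on f I" "inj_on g J" and S: "strict_similarity I S" "strict_similarity J T"
    and fin: "finite I" "I \<noteq> {}" and p: "p ` I = J" and \<eta>: "\<eta> > 0"
    and le: "\<And>x y. x \<in> I \<Longrightarrow> y \<in> I \<Longrightarrow> S x y \<le> T (p x) (p y)"
    and ge: "\<And>x y. x \<in> I \<Longrightarrow> y \<in> I \<Longrightarrow> ln (T (p x) (p y)) - ln (S x y) \<le> 2 * \<eta>"
  shows "gromov_hausdorff_distance (realize f I S) (realize g J T) \<le> 2 * \<eta>"
proof -
  let ?Y = "realize f I S" and ?X = "realize g J T"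
  let ?P = "\<lambda>a. g (p (inv_into I f a))"
  define c where "c a b = mdist ?X (?P a) b + \<eta>" for a b
  have mY: "mspace ?Y = f ` I" and mX: "mspace ?X = g ` J"
    using mspace_realize inj S by metis+
  have P: "?P a \<in> mspace ?X" if "a \<in> mspace ?Y" for a
    using that p inv_into_into[of a f I] unfolding mX mY by auto
  have d1: "mdist ?X (?P a) (?P a') \<le> mdist ?Y a a'" "mdist ?Y a a' \<le> mdist ?X (?P a) (?P a') + 2 * \<eta>"
    if a: "a \<in> mspace ?Y" "a' \<in> mspace ?Y" for a a'
  proof -
    obtain x x' where x: "a = f x" "x \<in> I" "a' = f x'" "x' \<in> I" using a unfolding mY by auto
    have P: "?P a = g (p x)" "?P a' = g (p x')" using x inj by auto
    have pJ: "p x \<in> J" "p x' \<in> J" using x p by auto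
    have dX: "mdist ?X (?P a) (?P a') = - ln (T (p x) (p x'))"
      unfolding P using mdist_realize[OF inj(2) S(2) pJ] .
    have dY: "mdist ?Y a a' = - ln (S x x')" unfolding x using mdist_realize[OF inj(1) S(1) x(2,4)] .
    have "0 < S x x'" using similarityD(3)[OF similarity_of_strict[OF inj(1) S(1)] x(2,4)] .
    then have "ln (S x x') \<le> ln (T (p x) (p x'))" using le[OF x(2,4)] by simp
    then show "mdist ?X (?P a) (?P a') \<le> mdist ?Y a a'" unfolding dX dY by simp
    show "mdist ?Y a a' \<le> mdist ?X (?P a) (?P a') + 2 * \<eta>"
      using ge[OF x(2,4)] unfolding dX dY by simp
  qed
  have glue: "gluing ?Y ?X c"
    unfolding gluing_def
  proof (intro conjI ballI allI)
    show "0 < c a b" for a b using \<eta> unfolding c_def by (intro add_nonneg_pos) auto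
    fix a a' b assume a: "a \<in> mspace ?Y" "a' \<in> mspace ?Y" and b: "b \<in> mspace ?X"
    show "c a b \<le> mdist ?Y a a' + c a' b"
      using mdist_triangle[OF P[OF a(1)] P[OF a(2)] b] d1(1)[OF a] unfolding c_def by linarith
    show "mdist ?Y a a' \<le> c a b + c a' b"
      using mdist_triangle[OF P[OF a(1)] b P[OF a(2)]] d1(2)[OF a] mdist_commute[of ?X b "?P a'"]
      unfolding c_def by linarith
  next
    fix a b b' assume a: "a \<in> mspace ?Y" and b: "b \<in> mspace ?X" "b' \<in> mspace ?X"
    show "c a b \<le> c a b' + mdist ?X b b'"
      using mdist_triangle[OF P[OF a] b(2,1)] mdist_commute[of ?X b b'] unfolding c_def by linarith
    show "mdist ?X b b' \<le> c a b + c a b'"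
      using mdist_triangle[OF b(1) P[OF a] b(2)] mdist_commute[of ?X b "?P a"] \<eta> unfolding c_def by linarith
  qed
  have cP: "c a (?P a) < 2 * \<eta>" if "a \<in> mspace ?Y" for a
    using \<eta> unfolding c_def by (simp add: mdist_self[OF P[OF that]])
  show ?thesis
  proof (rule gromov_hausdorff_distance_le[OF _ _ _ _ glue])
    show "finite (mspace ?Y)" "finite (mspace ?X)" "mspace ?Y \<noteq> {}" "mspace ?X \<noteq> {}"
      unfolding mX mY using fin p by auto
    show "\<forall>a\<in>mspace ?Y. \<exists>b\<in>mspace ?X. c a b < 2 * \<eta>" using cP P by blast
    show "\<forall>b\<in>mspace ?X. \<exists>a\<in>mspace ?Y. c a b < 2 * \<eta>"
    proof
      fix b assume "b \<in> mspace ?X"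
      then obtain x where x: "x \<in> I" "b = g (p x)" unfolding mX using p by auto
      then have "b = ?P (f x)" "f x \<in> mspace ?Y" unfolding mY using inj by auto
      then show "\<exists>a\<in>mspace ?Y. c a b < 2 * \<eta>" using cP by metis
    qed
  qed (use \<eta> in simp)
qed

lemma clustered_realize:
  fixes f :: "nat \<times> nat \<Rightarrow> 'a"
  assumes inj: "inj_on f (pts r)" and S: "strict_similarity (pts r) S" and \<epsilon>: "\<epsilon> > 0"
    and near: "\<And>x y. x \<in> pts r \<Longrightarrow> y \<in> pts r \<Longrightarrow> - ln (S x y) < \<epsilon> \<longleftrightarrow> fst x = fst y"
  shows "clustered_in_type r (realize f (pts r) S)"
proof -
  let ?Y = "realize f (pts r) S"
  let ?E = "{(x, y). x \<in> mspace ?Y \<and> y \<in> mspace ?Y \<and> mdist ?Y x y < \<epsilon>}"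
  let ?C = "\<lambda>i. f ` {(i, j) |j. j \<le> r ! i}"
  have mY: "mspace ?Y = f ` pts r" using mspace_realize[OF inj S] .
  have E: "(f x, f y) \<in> ?E \<longleftrightarrow> fst x = fst y" if "x \<in> pts r" "y \<in> pts r" for x y
    using that near[OF that] mdist_realize[OF inj S that] unfolding mY by auto
  have equiv: "equiv (mspace ?Y) ?E"
  proof (rule equivI)
    show "?E \<subseteq> mspace ?Y \<times> mspace ?Y" by blast
    show "refl_on (mspace ?Y) ?E"
    proof (rule refl_onI)
      fix a assume "a \<in> mspace ?Y"
      then show "(a, a) \<in> ?E" using \<epsilon> by (simp add: mdist_self)
    qed
    show "sym ?E" by (auto simp: sym_def mdist_commute)
    show "trans ?E"
    proof (rule transI)
      fix a b c assume ab: "(a, b) \<in> ?E" and bc: "(b, c) \<in> ?E"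
      obtain x where x: "x \<in> pts r" "a = f x" using ab unfolding mY by auto
      obtain y where y: "y \<in> pts r" "b = f y" using ab unfolding mY by auto
      obtain z where z: "z \<in> pts r" "c = f z" using bc unfolding mY by auto
      have "fst x = fst y" "fst y = fst z"
        using ab bc E[OF x(1) y(1)] E[OF y(1) z(1)] unfolding x(2) y(2) z(2) by blast+
      then show "(a, c) \<in> ?E" using E[OF x(1) z(1)] unfolding x(2) z(2) by simp
    qed
  qed
  have cls: "?E `` {f (i, j)} = ?C i" if "(i, j) \<in> pts r" for i j
  proof (rule Set.set_eqI)
    fix b
    show "b \<in> ?E `` {f (i, j)} \<longleftrightarrow> b \<in> ?C i"
    proof
      assume b: "b \<in> ?E `` {f (i, j)}"
      then obtain y where y: "y \<in> pts r" "b = f y" unfolding mY by auto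
      then have "fst y = i" using E[OF that y(1)] b by auto
      then have "y \<in> {(i, j) |j. j \<le> r ! i}" using y(1) by (cases y) (auto simp: pts_def)
      then show "b \<in> ?C i" using y(2) by blast
    next
      assume "b \<in> ?C i"
      then obtain j' where j': "b = f (i, j')" "j' \<le> r ! i" by blast
      then have "(i, j') \<in> pts r" using that by (auto simp: pts_def)
      then show "b \<in> ?E `` {f (i, j)}" using E[OF that] j' by auto
    qed
  qed
  have C_sub: "{(i, j) |j. j \<le> r ! i} \<subseteq> pts r" if "i < length r" for i
    using that by (auto simp: pts_def)
  let ?Cs = "map ?C [0..<length r]"
  have "distinct ?Cs"
  proof -
    have "inj_on ?C {..<length r}"
    proof (rule inj_onI)
      fix i i' assume i: "i \<in> {..<length r}" "i' \<in> {..<length r}" and eq: "?C i = ?C i'"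
      have "f (i, 0) \<in> ?C i'" unfolding eq[symmetric] by blast
      then obtain j where j: "f (i, 0) = f (i', j)" "j \<le> r ! i'" by blast
      have "(i, 0) \<in> pts r" "(i', j) \<in> pts r" using i j by (auto simp: pts_def)
      then show "i = i'" using inj j(1) by (auto dest: inj_onD)
    qed
    then show ?thesis by (simp add: distinct_map lessThan_atLeast0)
  qed
  moreover have "set ?Cs = mspace ?Y // ?E"
  proof
    show "set ?Cs \<subseteq> mspace ?Y // ?E"
    proof
      fix A assume "A \<in> set ?Cs"
      then obtain i where i: "i < length r" "A = ?C i" by auto
      then have p: "(i, 0) \<in> pts r" by (simp add: pts_def)
      have "?E `` {f (i, 0)} \<in> mspace ?Y // ?E"
        by (rule quotientI) (use p mY in auto)
      then show "A \<in> mspace ?Y // ?E" unfolding cls[OF p] i(2) .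
    qed
    show "mspace ?Y // ?E \<subseteq> set ?Cs"
    proof
      fix A assume "A \<in> mspace ?Y // ?E"
      then obtain x where x: "x \<in> pts r" "A = ?E `` {f x}" unfolding mY by (elim quotientE) auto
      obtain i j where ij: "x = (i, j)" by (cases x)
      then have "A = ?C i" using cls[of i j] x by simp
      moreover have "i < length r" using x ij by (simp add: pts_def)
      ultimately show "A \<in> set ?Cs" by auto
    qed
  qed
  moreover have "map card ?Cs = map (\<lambda>s. s + 1) r"
  proof (rule nth_equalityI)
    fix i assume "i < length (map card ?Cs)"
    then have i: "i < length r" by simp
    have "card (?C i) = card {(i, j) |j. j \<le> r ! i}"
      by (rule card_image) (rule inj_on_subset[OF inj C_sub[OF i]])
    moreover have "card (Pair i ` {..r ! i}) = r ! i + 1"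
      by (subst card_image) (auto simp: inj_on_def)
    moreover have "{(i, j) |j. j \<le> r ! i} = Pair i ` {..r ! i}" by auto
    ultimately show "map card ?Cs ! i = map (\<lambda>s. s + 1) r ! i" using i by simp
  qed simp
  ultimately show ?thesis
    unfolding clustered_in_type_def Let_def using \<epsilon> equiv by blast
qed

text \<open>The point types are arbitrary infinite types, so they have room for every finite index
  set.\<close>

lemma infinite_injection:
  obtains f :: "nat \<times> nat \<Rightarrow> 'a::infinite" where "inj f"
proof -
  obtain g :: "nat \<Rightarrow> 'a" where "inj g" using infinite_countable_subset[OF infinite_UNIV] by blast
  then have "inj (g \<circ> prod_encode)" using inj_prod_encode[of UNIV] by (rule inj_compose)
  then show thesis by (rule that)
qed

lemma unstable_counterexample:
  assumes "unstable r" "r \<noteq> []"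
  shows "\<exists>(X :: 'a::infinite metric) (Xs :: nat \<Rightarrow> 'b::infinite metric).
    positive_definite_space X \<and> card (mspace X) = length r \<and>
    (\<forall>n. positive_definite_space (Xs n) \<and> clustered_in_type r (Xs n)) \<and>
    (\<lambda>n. gromov_hausdorff_distance (Xs n) X) \<longlonglongrightarrow> 0 \<and>
    \<not> (\<lambda>n. magnitude (Xs n)) \<longlonglongrightarrow> magnitude X"
proof -
  let ?k = "length r"
  obtain T S \<alpha> \<beta> c m where pos: "0 < m" "0 < c" "\<beta> < \<alpha>"
    and T: "strict_similarity {..<?k} T" "pos_def {..<?k} T"
      "\<And>u. \<alpha> * (\<Sum>i<?k. u i)\<^sup>2 \<le> qform {..<?k} T u"
    and S: "\<And>n. fattening r T m c \<beta> (S n)"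
    and lim: "\<And>x y. x \<in> pts r \<Longrightarrow> y \<in> pts r \<Longrightarrow> (\<lambda>n::nat. S n x y) \<longlonglongrightarrow> T (fst x) (fst y)"
    using assms unfolding unstable_def by metis
  have S': "strict_similarity (pts r) (S n)" "pos_def (pts r) (S n)"
      "\<And>x y. x \<in> pts r \<Longrightarrow> y \<in> pts r \<Longrightarrow> S n x y \<le> T (fst x) (fst y)"
      "\<And>v. c * (\<Sum>x\<in>pts r. v x)\<^sup>2 \<le> qform (pts r) (S n) v"
      "\<exists>v. (\<Sum>x\<in>pts r. v x) = 1 \<and> qform (pts r) (S n) v \<le> \<beta>" for n
    using S[of n] unfolding fattening_def by auto
  have \<beta>: "\<beta> > 0"
  proof -
    obtain v where v: "(\<Sum>x\<in>pts r. v x) = 1" "qform (pts r) (S 0) v \<le> \<beta>" using S'(5) by blast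
    have "c * (\<Sum>x\<in>pts r. v x)\<^sup>2 \<le> qform (pts r) (S 0) v" by (rule S'(4))
    then show ?thesis using v pos(2) by simp
  qed
  have simS: "similarity (pts r) (S n)" for n using S'(1) unfolding strict_similarity_def by blast
  have simT: "similarity {..<?k} T" using T(1) unfolding strict_similarity_def by blast
  have fst_pts: "fst ` pts r = {..<?k}" by (force simp: pts_def)
  have fst_lt: "fst x < ?k" if "x \<in> pts r" for x using that by (auto simp: pts_def)
  have T_pos: "0 < T (fst x) (fst y)" if "x \<in> pts r" "y \<in> pts r" for x y
    using similarityD(3)[OF simT] fst_lt that by auto
  obtain f :: "nat \<times> nat \<Rightarrow> 'a" where f: "inj f" using infinite_injection by blast
  define g :: "nat \<Rightarrow> 'a" where "g i = f (i, 0)" for i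
  have injg: "inj_on g A" for A using f by (auto simp: g_def inj_on_def)
  obtain f' :: "nat \<times> nat \<Rightarrow> 'b" where f': "inj f'" using infinite_injection by blast
  have injf': "inj_on f' A" for A using f' by (rule inj_on_subset) simp
  \<comment> \<open>The sum dominates every single logarithmic gap and still tends to 0; the second
    summand makes it strictly positive, as the bridges of the gluing require.\<close>
  define \<eta> where "\<eta> n = (\<Sum>x\<in>pts r. \<Sum>y\<in>pts r. ln (T (fst x) (fst y)) - ln (S n x y)) + 1 / real (Suc n)" for n
  have diff_nn: "0 \<le> ln (T (fst x) (fst y)) - ln (S n x y)" if "x \<in> pts r" "y \<in> pts r" for x y n
    using S'(3)[OF that, of n] similarityD(3)[OF simS that, of n] by simp
  have \<eta>_pos: "\<eta> n > 0" for n
    unfolding \<eta>_def using diff_nn by (intro add_nonneg_pos sum_nonneg) auto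
  have \<eta>_bd: "ln (T (fst x) (fst y)) - ln (S n x y) \<le> \<eta> n" if "x \<in> pts r" "y \<in> pts r" for x y n
  proof -
    have "ln (T (fst x) (fst y)) - ln (S n x y) \<le> (\<Sum>y\<in>pts r. ln (T (fst x) (fst y)) - ln (S n x y))"
      using that diff_nn finite_pts
      by (intro member_le_sum[of y _ "\<lambda>y. ln (T (fst x) (fst y)) - ln (S n x y)"]) auto
    also have "\<dots> \<le> (\<Sum>x\<in>pts r. \<Sum>y\<in>pts r. ln (T (fst x) (fst y)) - ln (S n x y))"
      using that diff_nn finite_pts
      by (intro member_le_sum[of x _ "\<lambda>x. \<Sum>y\<in>pts r. ln (T (fst x) (fst y)) - ln (S n x y)"] sum_nonneg) auto
    finally show ?thesis unfolding \<eta>_def by (rule order_trans) simp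
  qed
  have "\<eta> \<longlonglongrightarrow> (\<Sum>x\<in>pts r. \<Sum>y\<in>pts r. ln (T (fst x) (fst y)) - ln (T (fst x) (fst y))) + 0"
    unfolding \<eta>_def
    by (intro tendsto_add tendsto_sum tendsto_diff tendsto_const tendsto_ln lim LIMSEQ_Suc lim_1_over_n)
      (auto dest: T_pos)
  then have \<eta>_lim: "\<eta> \<longlonglongrightarrow> 0" by simp
  \<comment> \<open>The smallest distance in the limit, with 1 inserted for a one-point limit. Since
    \<open>S n x y \<le> T (fst x) (fst y)\<close>, distances between clusters are never below
    \<epsilon>; only those within clusters need large \<open>n\<close>.\<close>
  obtain \<epsilon> where \<epsilon>: "\<epsilon> > 0" "\<And>i j. i < ?k \<Longrightarrow> j < ?k \<Longrightarrow> i \<noteq> j \<Longrightarrow> \<epsilon> \<le> - ln (T i j)"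
  proof -
    let ?A = "insert 1 ((\<lambda>(i, j). - ln (T i j)) ` {(i, j) \<in> {..<?k} \<times> {..<?k}. i \<noteq> j})"
    have A: "finite ?A" "?A \<noteq> {}"
      by (auto intro: finite_subset[of _ "{..<?k} \<times> {..<?k}"])
    have "Min ?A \<in> ?A" using A by (rule Min_in)
    moreover have "- ln (T i j) > 0" if "i < ?k" "j < ?k" "i \<noteq> j" for i j
      using T(1) that similarityD(3)[OF simT, of i j] unfolding strict_similarity_def by simp
    ultimately have "Min ?A > 0" by auto
    moreover have "Min ?A \<le> - ln (T i j)" if "i < ?k" "j < ?k" "i \<noteq> j" for i j
      using A(1) that by (intro Min_le) auto
    ultimately show thesis using that by blast
  qed
  have "\<forall>\<^sub>F n in sequentially. \<eta> n < \<epsilon>" using \<eta>_lim \<epsilon>(1) by (rule order_tendstoD)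
  \<comment> \<open>Every member of the sequence has to be clustered, so the first \<open>N\<close>
    are dropped.\<close>
  then obtain N where N: "\<And>n. n \<ge> N \<Longrightarrow> \<eta> n < \<epsilon>" unfolding eventually_sequentially by blast
  let ?X = "realize g {..<?k} T" and ?Xs = "\<lambda>n. realize f' (pts r) (S (n + N))"
  have ne: "pts r \<noteq> {}" using assms(2) by (auto simp: pts_def intro!: exI[of _ 0])
  show ?thesis
  proof (intro exI[of _ ?X] exI[of _ ?Xs] conjI allI)
    show "positive_definite_space ?X"
      by (rule positive_definite_realize[OF injg T(1) _ T(2)]) simp
    show "card (mspace ?X) = ?k" using card_realize[OF injg T(1)] by simp
    show "positive_definite_space (?Xs n)" for n
      by (rule positive_definite_realize[OF injf' S'(1) finite_pts S'(2)])
    show "clustered_in_type r (?Xs n)" for n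
    proof (rule clustered_realize[OF injf' S'(1) \<epsilon>(1)])
      fix x y assume xy: "x \<in> pts r" "y \<in> pts r"
      show "- ln (S (n + N) x y) < \<epsilon> \<longleftrightarrow> fst x = fst y"
      proof (cases "fst x = fst y")
        case True
        then have "T (fst x) (fst y) = 1"
          using similarityD(1)[OF simT, of "fst x" "fst x"] fst_lt[OF xy(1)] by simp
        then show ?thesis using \<eta>_bd[OF xy, of "n + N"] N[of "n + N"] True by simp
      next
        case False
        then show ?thesis
          using \<epsilon>(2)[OF fst_lt[OF xy(1)] fst_lt[OF xy(2)] False] diff_nn[OF xy, of "n + N"] by simp
      qed
    qed
    show "(\<lambda>n. gromov_hausdorff_distance (?Xs n) ?X) \<longlonglongrightarrow> 0"
    proof (rule tendsto_sandwich)
      have fX: "finite (mspace ?X)" "mspace ?X \<noteq> {}"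
        using mspace_realize[OF injg T(1)] assms(2) by auto
      have "finite (mspace (?Xs n))" "mspace (?Xs n) \<noteq> {}" for n
        using mspace_realize[OF injf' S'(1)] finite_pts ne by auto
      then show "\<forall>\<^sub>F n in sequentially. 0 \<le> gromov_hausdorff_distance (?Xs n) ?X"
        using fX by (intro always_eventually allI gromov_hausdorff_distance_nonneg)
      have "gromov_hausdorff_distance (?Xs n) ?X \<le> 2 * \<eta> (n + N)" for n
      proof (rule gromov_hausdorff_distance_realize_le[OF injf' injg S'(1) T(1) finite_pts ne fst_pts \<eta>_pos])
        show "S (n + N) x y \<le> T (fst x) (fst y)" if "x \<in> pts r" "y \<in> pts r" for x y
          by (rule S'(3)[OF that])
        show "ln (T (fst x) (fst y)) - ln (S (n + N) x y) \<le> 2 * \<eta> (n + N)"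
          if "x \<in> pts r" "y \<in> pts r" for x y
          using \<eta>_bd[OF that, of "n + N"] \<eta>_pos[of "n + N"] by simp
      qed
      then show "\<forall>\<^sub>F n in sequentially. gromov_hausdorff_distance (?Xs n) ?X \<le> 2 * \<eta> (n + N)"
        by simp
      show "(\<lambda>n. 2 * \<eta> (n + N)) \<longlonglongrightarrow> 0"
        using tendsto_mult_right_zero[OF LIMSEQ_ignore_initial_segment[OF \<eta>_lim]] .
    qed simp
    show "\<not> (\<lambda>n. magnitude (?Xs n)) \<longlonglongrightarrow> magnitude ?X"
    proof
      assume conv: "(\<lambda>n. magnitude (?Xs n)) \<longlonglongrightarrow> magnitude ?X"
      have "1 / \<beta> \<le> magnitude (?Xs n)" for n
      proof -
        obtain v where v: "(\<Sum>x\<in>pts r. v x) = 1" "qform (pts r) (S (n + N)) v \<le> \<beta>"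
          using S'(5) by blast
        show ?thesis by (rule magnitude_realize_ge[OF injf' S'(1) finite_pts S'(2) \<beta> v])
      qed
      then have "1 / \<beta> \<le> magnitude ?X" using conv by (intro LIMSEQ_le_const) auto
      also have "magnitude ?X \<le> 1 / \<alpha>"
        by (rule magnitude_realize_le[OF injg T(1) _ T(2) _ T(3)]) (use \<beta> pos in auto)
      finally show False using \<beta> pos by (simp add: field_simps)
    qed
  qed
qed

section \<open>The four minimal unstable types\<close>

definition two_scale :: "real \<Rightarrow> nat \<Rightarrow> nat \<Rightarrow> real" where
  "two_scale \<sigma> i j = (if i = j then 1 else \<sigma>)"

text \<open>All entries \<open>A, A', B, E, C\<close> will lie between \<open>a\<^sup>2\<close> and \<open>a\<close> for some \<open>a < 1\<close>, which makes the triangle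
  inequality automatic. Entries are grouped by membership in \<open>P\<close> (both, neither, or one point), and
  \<open>A, E\<close> refer to pairs in the same cluster.\<close>

definition kern :: "(nat \<times> nat) set \<Rightarrow> real \<Rightarrow> real \<Rightarrow> real \<Rightarrow> real \<Rightarrow> real \<Rightarrow> real \<Rightarrow>
    nat \<times> nat \<Rightarrow> nat \<times> nat \<Rightarrow> real" where
  "kern P \<sigma> A A' B E C x y = (if x = y then 1 else two_scale \<sigma> (fst x) (fst y) *
     (if x \<in> P \<and> y \<in> P then if fst x = fst y then A else A'
      else if x \<notin> P \<and> y \<notin> P then B else if fst x = fst y then E else C))"

lemma qform_two_scale:
  "qform {..<k} (two_scale \<sigma>) u = (1 - \<sigma>) * (\<Sum>i<k. (u i)\<^sup>2) + \<sigma> * (\<Sum>i<k. u i)\<^sup>2"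
proof -
  have "two_scale \<sigma> i j * u i * u j = \<sigma> * (u i * u j) + (if j = i then (1 - \<sigma>) * (u j)\<^sup>2 else 0)" for i j
    by (auto simp: two_scale_def power2_eq_square algebra_simps)
  then have "qform {..<k} (two_scale \<sigma>) u
      = (\<Sum>i<k. \<Sum>j<k. \<sigma> * (u i * u j)) + (\<Sum>i<k. (1 - \<sigma>) * (u i)\<^sup>2)"
    unfolding bform_def by (simp add: sum.distrib)
  moreover have "(\<Sum>i<k. u i)\<^sup>2 = (\<Sum>i<k. \<Sum>j<k. u i * u j)"
    by (simp add: power2_eq_square sum_product)
  ultimately show ?thesis by (simp only: sum_distrib_left add.commute)
qed

text \<open>The constant in the last claim is attained by uniform weights, so it is the exact
  reciprocal of the magnitude of the limit space.\<close>

lemma two_scale_properties: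
  assumes \<sigma>: "0 < \<sigma>" "\<sigma> < 1" and k: "k \<ge> 1"
  shows "strict_similarity {..<k} (two_scale \<sigma>)" and "pos_def {..<k} (two_scale \<sigma>)"
    and "((1 - \<sigma>) / real k + \<sigma>) * (\<Sum>i<k. u i)\<^sup>2 \<le> qform {..<k} (two_scale \<sigma>) u"
proof -
  have "\<sigma> * \<sigma> \<le> \<sigma>" using \<sigma> by (simp add: mult_left_le)
  moreover have "\<sigma> * \<sigma> \<le> 1" using \<sigma> by (simp add: mult_le_one)
  ultimately show "strict_similarity {..<k} (two_scale \<sigma>)"
    using \<sigma> by (auto simp: strict_similarity_def similarity_def two_scale_def)
  show "pos_def {..<k} (two_scale \<sigma>)"
    unfolding pos_def_def qform_two_scale
  proof (intro allI impI)
    fix u :: "nat \<Rightarrow> real"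
    assume "\<exists>i\<in>{..<k}. u i \<noteq> 0"
    then have "(\<Sum>i<k. (u i)\<^sup>2) > 0" by (auto intro: sum_pos2)
    then show "0 < (1 - \<sigma>) * (\<Sum>i<k. (u i)\<^sup>2) + \<sigma> * (\<Sum>i<k. u i)\<^sup>2"
      using \<sigma> by (intro add_pos_nonneg) auto
  qed
  have "(\<Sum>i<k. u i)\<^sup>2 \<le> real k * (\<Sum>i<k. (u i)\<^sup>2)"
    using sum_squared_le_sum_of_squares[of u "{..<k}"] by (simp add: mult.commute)
  then have "(\<Sum>i<k. u i)\<^sup>2 / real k \<le> (\<Sum>i<k. (u i)\<^sup>2)" using k by (simp add: field_simps)
  then have "(1 - \<sigma>) * ((\<Sum>i<k. u i)\<^sup>2 / real k) \<le> (1 - \<sigma>) * (\<Sum>i<k. (u i)\<^sup>2)"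
    using \<sigma> by (intro mult_left_mono) auto
  then show "((1 - \<sigma>) / real k + \<sigma>) * (\<Sum>i<k. u i)\<^sup>2 \<le> qform {..<k} (two_scale \<sigma>) u"
    unfolding qform_two_scale by (simp add: algebra_simps)
qed

lemma kern_properties:
  assumes \<sigma>: "0 < \<sigma>" "\<sigma> < 1" and a: "1 / 2 \<le> a" "a < 1"
    and bd: "\<And>s. s \<in> {A, A', B, E, C} \<Longrightarrow> a\<^sup>2 \<le> s \<and> s \<le> a"
  shows "strict_similarity I (kern P \<sigma> A A' B E C)"
    and "\<sigma> / 4 \<le> kern P \<sigma> A A' B E C x y" and "kern P \<sigma> A A' B E C x y \<le> two_scale \<sigma> (fst x) (fst y)"
proof -
  let ?S = "kern P \<sigma> A A' B E C"
  define \<kappa> where "\<kappa> x y = (if x \<in> P \<and> y \<in> P then if fst x = fst y then A else A'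
      else if x \<notin> P \<and> y \<notin> P then B else if fst x = fst y then E else C)" for x y :: "nat \<times> nat"
  have \<kappa>: "a\<^sup>2 \<le> \<kappa> x y" "\<kappa> x y \<le> a" "\<kappa> x y = \<kappa> y x" for x y
    using bd unfolding \<kappa>_def by auto
  have S: "?S x y = (if x = y then 1 else two_scale \<sigma> (fst x) (fst y) * \<kappa> x y)" for x y
    by (simp add: kern_def \<kappa>_def)
  have \<sigma>\<sigma>: "\<sigma> * \<sigma> \<le> \<sigma>" "\<sigma> * \<sigma> \<le> 1" using \<sigma> by (auto simp: mult_left_le mult_le_one)
  have sc: "\<sigma> \<le> two_scale \<sigma> i j" "two_scale \<sigma> i j \<le> 1" "two_scale \<sigma> i j = two_scale \<sigma> j i" for i j
    using \<sigma> by (auto simp: two_scale_def)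
  have a2: "1 / 4 \<le> a\<^sup>2" using power_mono[OF a(1), of 2] by (simp add: power2_eq_square)
  have \<kappa>0: "0 < \<kappa> x y" "1 / 4 \<le> \<kappa> x y" for x y using \<kappa>(1)[of x y] a2 by linarith+
  have sc0: "0 < two_scale \<sigma> i j" for i j using sc(1)[of i j] \<sigma> by linarith
  have lt: "two_scale \<sigma> (fst x) (fst y) * \<kappa> x y < 1" for x y
  proof -
    have "two_scale \<sigma> (fst x) (fst y) * \<kappa> x y \<le> 1 * a"
      using sc(2) \<kappa>(2) \<kappa>0(1)[of x y] by (intro mult_mono) auto
    then show ?thesis using a by simp
  qed
  have pos: "0 < ?S x y" for x y unfolding S using \<kappa>0 sc0 by simp
  have le1: "?S x y \<le> 1" for x y unfolding S using lt[of x y] by simp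
  have sym: "?S x y = ?S y x" for x y unfolding S using \<kappa>(3)[of x y] sc(3)[of "fst x"] by simp
  have tri: "?S x y * ?S y z \<le> ?S x z" for x y z
  proof (cases "x = y \<or> y = z \<or> x = z")
    case True
    have xx: "?S x x = 1" for x by (simp add: S)
    have "?S x y * ?S y z \<le> 1"
      using le1[of x y] le1[of y z] pos[of x y] pos[of y z] by (intro mult_le_one) auto
    with True show ?thesis using xx[of x] xx[of y] xx[of z] by (elim disjE) simp_all
  next
    case False
    have "two_scale \<sigma> i j * two_scale \<sigma> j l \<le> two_scale \<sigma> i l" for i j l
      using \<sigma> \<sigma>\<sigma> by (auto simp: two_scale_def)
    moreover have "\<kappa> x y * \<kappa> y z \<le> a * a"
      using \<kappa>(2) \<kappa>0(1)[of x y] \<kappa>0(1)[of y z] a by (intro mult_mono) auto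
    then have "\<kappa> x y * \<kappa> y z \<le> \<kappa> x z" using \<kappa>(1)[of x z] by (simp add: power2_eq_square)
    ultimately have "(two_scale \<sigma> (fst x) (fst y) * two_scale \<sigma> (fst y) (fst z)) * (\<kappa> x y * \<kappa> y z)
        \<le> two_scale \<sigma> (fst x) (fst z) * \<kappa> x z"
      using \<kappa>0(1)[of x y] \<kappa>0(1)[of y z] sc0[of "fst x" "fst z"] by (intro mult_mono) auto
    then show ?thesis using False unfolding S by (simp add: mult_ac)
  qed
  show "strict_similarity I ?S"
    unfolding strict_similarity_def similarity_def
  proof (intro conjI ballI impI)
    show "?S x y < 1" if "x \<noteq> y" for x y using that lt by (simp add: S)
  qed (use pos le1 sym tri in \<open>auto simp: S\<close>)
  show "\<sigma> / 4 \<le> ?S x y"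
  proof -
    have "\<sigma> * (1 / 4) \<le> two_scale \<sigma> (fst x) (fst y) * \<kappa> x y"
      using sc(1) \<kappa>0(2) \<sigma> sc0 by (intro mult_mono) (auto intro: less_imp_le)
    then show ?thesis using \<sigma> unfolding S by auto
  qed
  show "?S x y \<le> two_scale \<sigma> (fst x) (fst y)"
  proof -
    have "two_scale \<sigma> (fst x) (fst y) * \<kappa> x y \<le> two_scale \<sigma> (fst x) (fst y) * 1"
      using sc0[of "fst x" "fst y"] \<kappa>(2)[of x y] a by (intro mult_left_mono) auto
    then show ?thesis unfolding S by (auto simp: two_scale_def)
  qed
qed

text \<open>Reduces a type to three algebraic checks on one form for small \<open>t\<close>:
  definiteness, a uniform lower bound, and a test vector whose energy stays below the value of the
  limit space.\<close>

lemma unstable_kern: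
  fixes a A A' B E C :: "real \<Rightarrow> real"
  assumes r: "r \<noteq> []" and \<sigma>: "0 < \<sigma>" "\<sigma> < 1" and c: "0 < c" "\<beta> < (1 - \<sigma>) / real (length r) + \<sigma>"
    and d: "0 < d"
    and a: "\<And>t. 0 < t \<Longrightarrow> t \<le> d \<Longrightarrow> 1 / 2 \<le> a t \<and> a t < 1"
    and bd: "\<And>t s. 0 < t \<Longrightarrow> t \<le> d \<Longrightarrow> s \<in> {A t, A' t, B t, E t, C t} \<Longrightarrow> (a t)\<^sup>2 \<le> s \<and> s \<le> a t"
    and cont: "isCont A 0" "isCont A' 0" "isCont B 0" "isCont E 0" "isCont C 0"
    and one: "A 0 = 1" "A' 0 = 1" "B 0 = 1" "E 0 = 1" "C 0 = 1"
    and pd: "\<And>t v. 0 < t \<Longrightarrow> t \<le> d \<Longrightarrow>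
      qform (pts r) (kern P \<sigma> (A t) (A' t) (B t) (E t) (C t)) v \<le> 0 \<Longrightarrow> \<forall>x\<in>pts r. v x = 0"
    and lower: "\<And>t v. 0 < t \<Longrightarrow> t \<le> d \<Longrightarrow>
      c * (\<Sum>x\<in>pts r. v x)\<^sup>2 \<le> qform (pts r) (kern P \<sigma> (A t) (A' t) (B t) (E t) (C t)) v"
    and test: "\<And>t. 0 < t \<Longrightarrow> t \<le> d \<Longrightarrow> \<exists>v. (\<Sum>x\<in>pts r. v x) = 1 \<and>
      qform (pts r) (kern P \<sigma> (A t) (A' t) (B t) (E t) (C t)) v \<le> \<beta>"
  shows "unstable r"
proof -
  let ?S = "\<lambda>t. kern P \<sigma> (A t) (A' t) (B t) (E t) (C t)"
  define t where "t n = d / real (Suc n)" for n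
  have t: "0 < t n" "t n \<le> d" for n
    using d unfolding t_def by (auto simp: field_simps)
  have "(\<lambda>n. d * (1 / real (Suc n))) \<longlonglongrightarrow> d * 0"
    by (intro tendsto_mult tendsto_const LIMSEQ_Suc lim_1_over_n)
  then have t_lim: "t \<longlonglongrightarrow> 0" unfolding t_def by simp
  have lims: "(\<lambda>n. A (t n)) \<longlonglongrightarrow> 1" "(\<lambda>n. A' (t n)) \<longlonglongrightarrow> 1" "(\<lambda>n. B (t n)) \<longlonglongrightarrow> 1"
    "(\<lambda>n. E (t n)) \<longlonglongrightarrow> 1" "(\<lambda>n. C (t n)) \<longlonglongrightarrow> 1"
    using cont[THEN isCont_tendsto_compose, OF t_lim] one by simp_all
  have k: "length r \<ge> 1" using r by (cases r) auto
  show ?thesis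
    unfolding unstable_def
  proof (intro exI conjI allI ballI)
    show "0 < \<sigma> / 4" using \<sigma> by simp
    show "strict_similarity {..<length r} (two_scale \<sigma>)" "pos_def {..<length r} (two_scale \<sigma>)"
      by (rule two_scale_properties[OF \<sigma> k])+
    show "((1 - \<sigma>) / real (length r) + \<sigma>) * (\<Sum>i<length r. u i)\<^sup>2 \<le> qform {..<length r} (two_scale \<sigma>) u" for u
      by (rule two_scale_properties[OF \<sigma> k])
    show "fattening r (two_scale \<sigma>) (\<sigma> / 4) c \<beta> (?S (t n))" for n
      unfolding fattening_def
    proof (intro conjI allI ballI)
      note at = a[OF t, of n]
      note kp = kern_properties[OF \<sigma> at[THEN conjunct1] at[THEN conjunct2] bd[OF t]]
      show "strict_similarity (pts r) (?S (t n))" by (rule kp)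
      show "pos_def (pts r) (?S (t n))"
        unfolding pos_def_def using pd[OF t] by (meson not_le)
      show "\<sigma> / 4 \<le> ?S (t n) x y" for x y by (rule kp(2))
      show "?S (t n) x y \<le> two_scale \<sigma> (fst x) (fst y)" for x y by (rule kp(3))
      show "c * (\<Sum>x\<in>pts r. v x)\<^sup>2 \<le> qform (pts r) (?S (t n)) v" for v by (rule lower[OF t])
      show "\<exists>v. (\<Sum>x\<in>pts r. v x) = 1 \<and> qform (pts r) (?S (t n)) v \<le> \<beta>" by (rule test[OF t])
    qed
    fix x y assume "x \<in> pts r" "y \<in> pts r"
    have "(\<lambda>n. two_scale \<sigma> (fst x) (fst y) * s n) \<longlonglongrightarrow> two_scale \<sigma> (fst x) (fst y)"
      if "s \<longlonglongrightarrow> 1" for s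
      using tendsto_mult[OF tendsto_const that, of "two_scale \<sigma> (fst x) (fst y)"] by simp
    moreover have "(\<lambda>n. if x \<in> P \<and> y \<in> P then if fst x = fst y then A (t n) else A' (t n)
        else if x \<notin> P \<and> y \<notin> P then B (t n) else if fst x = fst y then E (t n) else C (t n)) \<longlonglongrightarrow> 1"
      using lims by (cases "x \<in> P"; cases "y \<in> P"; cases "fst x = fst y") simp_all
    ultimately show "(\<lambda>n. ?S (t n) x y) \<longlonglongrightarrow> two_scale \<sigma> (fst x) (fst y)"
      unfolding kern_def by (cases "x = y") (simp_all add: two_scale_def)
  qed (use c in auto)
qed

section \<open>The forms of the four minimal types, written out\<close>

lemma pts_type_4: "pts [4] = {(0,0), (0,1), (0,2), (0,3), (0,4)}"
  by (auto simp: pts_def le_Suc_eq numeral_eq_Suc)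

lemma sum_type_4:
  fixes v :: "nat \<times> nat \<Rightarrow> real"
  shows "(\<Sum>x\<in>pts [4]. v x) = v (0,0) + v (0,1) + v (0,2) + v (0,3) + v (0,4)"
  unfolding pts_type_4 by simp

lemma qform_type_4:
  "qform (pts [4]) (kern {(0,0), (0,1), (0,2)} \<sigma> A A' B E C) v
   = (v (0,0))\<^sup>2 + (v (0,1))\<^sup>2 + (v (0,2))\<^sup>2 + (v (0,3))\<^sup>2 + (v (0,4))\<^sup>2
     + 2 * A * (v (0,0) * v (0,1) + v (0,0) * v (0,2) + v (0,1) * v (0,2)) + 2 * B * (v (0,3) * v (0,4))
     + 2 * E * (v (0,0) + v (0,1) + v (0,2)) * (v (0,3) + v (0,4))"
  unfolding bform_def pts_type_4 by (simp add: kern_def two_scale_def power2_eq_square algebra_simps)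

lemma pts_type_30: "pts [3,0] = {(0,0), (0,1), (0,2), (0,3), (1,0)}"
  by (auto simp: pts_def le_Suc_eq less_Suc_eq numeral_eq_Suc)

lemma sum_type_30:
  fixes v :: "nat \<times> nat \<Rightarrow> real"
  shows "(\<Sum>x\<in>pts [3,0]. v x) = v (0,0) + v (0,1) + v (0,2) + v (0,3) + v (1,0)"
  unfolding pts_type_30 by simp

lemma qform_type_30:
  "qform (pts [3,0]) (kern {(0,0), (0,1), (1,0)} \<sigma> A A' B E C) v
   = (v (0,0))\<^sup>2 + (v (0,1))\<^sup>2 + (v (0,2))\<^sup>2 + (v (0,3))\<^sup>2 + (v (1,0))\<^sup>2
     + 2 * A * (v (0,0) * v (0,1)) + 2 * B * (v (0,2) * v (0,3))
     + 2 * E * (v (0,0) + v (0,1)) * (v (0,2) + v (0,3))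
     + 2 * (\<sigma> * A') * v (1,0) * (v (0,0) + v (0,1)) + 2 * (\<sigma> * C) * v (1,0) * (v (0,2) + v (0,3))"
  unfolding bform_def pts_type_30 by (simp add: kern_def two_scale_def power2_eq_square algebra_simps)

lemma pts_type_21: "pts [2,1] = {(0,0), (0,1), (0,2), (1,0), (1,1)}"
  by (auto simp: pts_def le_Suc_eq less_Suc_eq numeral_eq_Suc)

lemma sum_type_21:
  fixes v :: "nat \<times> nat \<Rightarrow> real"
  shows "(\<Sum>x\<in>pts [2,1]. v x) = v (0,0) + v (0,1) + v (0,2) + v (1,0) + v (1,1)"
  unfolding pts_type_21 by simp

lemma qform_type_21:
  "qform (pts [2,1]) (kern {(0,0), (0,1), (1,0)} \<sigma> A A' B E C) v
   = (v (0,0))\<^sup>2 + (v (0,1))\<^sup>2 + (v (0,2))\<^sup>2 + (v (1,0))\<^sup>2 + (v (1,1))\<^sup>2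
     + 2 * A * (v (0,0) * v (0,1)) + 2 * E * ((v (0,0) + v (0,1)) * v (0,2) + v (1,0) * v (1,1))
     + 2 * (\<sigma> * A') * ((v (0,0) + v (0,1)) * v (1,0)) + 2 * (\<sigma> * B) * (v (0,2) * v (1,1))
     + 2 * (\<sigma> * C) * ((v (0,0) + v (0,1)) * v (1,1) + v (0,2) * v (1,0))"
  unfolding bform_def pts_type_21 by (simp add: kern_def two_scale_def power2_eq_square algebra_simps)

lemma pts_type_111: "pts [1,1,1] = {(0,0), (1,0), (2,0), (0,1), (1,1), (2,1)}"
  by (auto simp: pts_def le_Suc_eq less_Suc_eq numeral_eq_Suc)

lemma sum_type_111:
  fixes v :: "nat \<times> nat \<Rightarrow> real"
  shows "(\<Sum>x\<in>pts [1,1,1]. v x)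
    = v (0,0) + v (1,0) + v (2,0) + v (0,1) + v (1,1) + v (2,1)"
  unfolding pts_type_111 by simp

lemma qform_type_111:
  "qform (pts [1,1,1]) (kern {(0,0), (1,0), (2,0)} \<sigma> A A' B E C) v
   = (v (0,0))\<^sup>2 + (v (1,0))\<^sup>2 + (v (2,0))\<^sup>2 + (v (0,1))\<^sup>2 + (v (1,1))\<^sup>2 + (v (2,1))\<^sup>2
     + 2 * E * (v (0,0) * v (0,1) + v (1,0) * v (1,1) + v (2,0) * v (2,1))
     + 2 * (\<sigma> * A') * (v (0,0) * v (1,0) + v (0,0) * v (2,0) + v (1,0) * v (2,0))
     + 2 * (\<sigma> * B) * (v (0,1) * v (1,1) + v (0,1) * v (2,1) + v (1,1) * v (2,1))
     + 2 * (\<sigma> * C) * (v (0,0) * v (1,1) + v (0,0) * v (2,1) + v (1,0) * v (0,1) + v (1,0) * v (2,1)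
         + v (2,0) * v (0,1) + v (2,0) * v (1,1))"
  unfolding bform_def pts_type_111 by (simp add: kern_def two_scale_def power2_eq_square algebra_simps)

section \<open>Verification of the four families\<close>

lemma square_le_small:
  fixes t :: real
  assumes "0 < t" "t \<le> 1 / 1000"
  shows "1000 * t\<^sup>2 \<le> t"
  using mult_right_mono[of "1000 * t" 1 t] assms by (simp add: power2_eq_square)

text \<open>A deformation of K_{2,3}: the first-order distances 9, 8, 5 are of negative type but
  degenerate, since \<open>(1/3, 1/3, 1/3, -1/2, -1/2)\<close> has first-order energy 0. The term
  \<open>4 * t^2\<close> in \<open>?B\<close> gives it the energy \<open>2 * t^2\<close>.\<close>

lemma unstable_4: "unstable [4]"
proof -
  let ?P = "{(0,0), (0,1), (0,2)} :: (nat \<times> nat) set"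
  let ?A = "\<lambda>t::real. 1 - 9 * t" and ?B = "\<lambda>t::real. 1 - 8 * t + 4 * t\<^sup>2" and ?E = "\<lambda>t::real. 1 - 5 * t"
  let ?Q = "\<lambda>t. qform (pts [4]) (kern ?P (1/2) (?A t) (?A t) (?B t) (?E t) (?E t))"
  have Q: "?Q t v = 3 * t * ((v (0,0) - v (0,1))\<^sup>2 + (v (0,1) - v (0,2))\<^sup>2 + (v (0,0) - v (0,2))\<^sup>2)
      + (4 * t - 2 * t\<^sup>2) * (v (0,3) - v (0,4))\<^sup>2
      + 2 * (t * (v (0,0) + v (0,1) + v (0,2))
          - (1 + 2 * t) / 2 * (v (0,0) + v (0,1) + v (0,2) + v (0,3) + v (0,4)))\<^sup>2
      + (1 / 2 - 6 * t) * (v (0,0) + v (0,1) + v (0,2) + v (0,3) + v (0,4))\<^sup>2" for t v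
    unfolding qform_type_4 by (simp add: power2_eq_square field_simps)
  show ?thesis
  proof (rule unstable_kern[where r = "[4]" and P = ?P and \<sigma> = "1/2" and A = ?A and A' = ?A and B = ?B
        and E = ?E and C = ?E and a = ?E and c = "1/4" and \<beta> = "1/2" and d = "1/1000"])
    fix t :: real assume t: "0 < t" "t \<le> 1 / 1000"
    have t2: "1000 * t\<^sup>2 \<le> t" "t\<^sup>2 \<ge> 0"
      using square_le_small[OF t] by auto
    show "1 / 2 \<le> ?E t \<and> ?E t < 1" using t by simp
    show "(?E t)\<^sup>2 \<le> s \<and> s \<le> ?E t" if "s \<in> {?A t, ?A t, ?B t, ?E t, ?E t}" for s
    proof -
      have "(?E t)\<^sup>2 = 1 - 10 * t + 25 * t\<^sup>2" by (simp add: power2_eq_square algebra_simps)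
      then show ?thesis using that t t2 by auto
    qed
    fix v :: "nat \<times> nat \<Rightarrow> real"
    let ?V = "v (0,0) + v (0,1) + v (0,2) + v (0,3) + v (0,4)"
    let ?R = "t * (v (0,0) + v (0,1) + v (0,2)) - (1 + 2 * t) / 2 * ?V"
    have co: "0 < 3 * t" "0 < 4 * t - 2 * t\<^sup>2" "1 / 4 \<le> 1 / 2 - 6 * t" using t t2 by auto
    have ge: "?Q t v \<ge> 3 * t * ((v (0,0) - v (0,1))\<^sup>2 + (v (0,1) - v (0,2))\<^sup>2 + (v (0,0) - v (0,2))\<^sup>2)
      + (4 * t - 2 * t\<^sup>2) * (v (0,3) - v (0,4))\<^sup>2 + 2 * ?R\<^sup>2 + 1 / 4 * ?V\<^sup>2"
      unfolding Q using mult_right_mono[OF co(3), of "?V\<^sup>2"] by simp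
    have nn: "0 \<le> 3 * t * ((v (0,0) - v (0,1))\<^sup>2 + (v (0,1) - v (0,2))\<^sup>2 + (v (0,0) - v (0,2))\<^sup>2)"
      "0 \<le> (4 * t - 2 * t\<^sup>2) * (v (0,3) - v (0,4))\<^sup>2" "0 \<le> 2 * ?R\<^sup>2" "0 \<le> 1 / 4 * ?V\<^sup>2"
      using co by auto
    show "1 / 4 * (\<Sum>x\<in>pts [4]. v x)\<^sup>2 \<le> ?Q t v"
      unfolding sum_type_4 using ge nn by linarith
    show "\<forall>x\<in>pts [4]. v x = 0" if "?Q t v \<le> 0"
    proof -
      have z: "3 * t * ((v (0,0) - v (0,1))\<^sup>2 + (v (0,1) - v (0,2))\<^sup>2 + (v (0,0) - v (0,2))\<^sup>2) = 0"
        "(4 * t - 2 * t\<^sup>2) * (v (0,3) - v (0,4))\<^sup>2 = 0" "2 * ?R\<^sup>2 = 0" "1 / 4 * ?V\<^sup>2 = 0"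
        using ge nn that by linarith+
      have "(v (0,0) - v (0,1))\<^sup>2 + (v (0,1) - v (0,2))\<^sup>2 + (v (0,0) - v (0,2))\<^sup>2 = 0"
        using z(1) co(1) by (simp only: mult_eq_0_iff) auto
      then have "v (0,0) = v (0,1)" "v (0,1) = v (0,2)"
        by (smt (verit) power2_eq_square zero_le_power2 zero_eq_power2)+
      moreover have "v (0,3) = v (0,4)" using z(2) co(2) by simp
      moreover have V: "?V = 0" using z(4) by simp
      moreover have "t * (v (0,0) + v (0,1) + v (0,2)) = 0" using z(3) unfolding V by simp
      ultimately show ?thesis unfolding pts_type_4 using t by auto
    qed
    \<comment> \<open>The mass along the null direction that makes the square \<open>?R\<close>
      vanish for total mass 1. What remains is \<open>1 / 2 - 6 * t\<close>, against 1 for the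
      one-point limit.\<close>
    define X where "X = (1 + 2 * t) / (2 * t)"
    define w :: "nat \<times> nat \<Rightarrow> real" where "w x = (if x \<in> ?P then X / 3 else (1 - X) / 2)" for x
    have w: "w (0,0) = X / 3" "w (0,1) = X / 3" "w (0,2) = X / 3" "w (0,3) = (1 - X) / 2" "w (0,4) = (1 - X) / 2"
      by (simp_all add: w_def)
    have "t * X = (1 + 2 * t) / 2" using t by (simp add: X_def)
    then have "?Q t w = 1 / 2 - 6 * t" unfolding Q w by (simp add: field_simps)
    moreover have "(\<Sum>x\<in>pts [4]. w x) = 1" unfolding sum_type_4 w by simp
    ultimately show "\<exists>v. (\<Sum>x\<in>pts [4]. v x) = 1 \<and> ?Q t v \<le> 1 / 2"
      using t by (intro exI[of _ w]) simp
  qed (auto intro!: continuous_intros)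
qed

text \<open>The first cluster is a 4-cycle with sides \<open>- ln (1 - t)\<close>. Its alternating
  vector has second-order energy, but by symmetry it does not interact with uniform weights on the
  cycle. The distant point is closer to one pair of opposite corners and couples to it at first
  order.\<close>

lemma unstable_30: "unstable [3,0]"
proof -
  let ?P = "{(0,0), (0,1), (1,0)} :: (nat \<times> nat) set"
  let ?A = "\<lambda>t::real. (1 - t)\<^sup>2" and ?E = "\<lambda>t::real. 1 - t"
  let ?Q = "\<lambda>t. qform (pts [3,0]) (kern ?P (1/2) (?A t) (?A t) (?A t) (?E t) (?E t))"
  have Q: "?Q t v = (1 - (1 - t)\<^sup>2) / 2 * (v (0,0) - v (0,1))\<^sup>2 + (1 - (1 - t)\<^sup>2) / 2 * (v (0,2) - v (0,3))\<^sup>2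
      + (t * ((v (0,0) + v (0,1) - (v (0,2) + v (0,3))) / 2) - (1 - t) / 2 * v (1,0))\<^sup>2
      + ((1 - t / 2) * (v (0,0) + v (0,1) + (v (0,2) + v (0,3))) + (1 - t) / 2 * v (1,0))\<^sup>2
      + (1 - (1 - t)\<^sup>2 / 2) * (v (1,0))\<^sup>2" for t v
    unfolding qform_type_30 by (simp add: power2_eq_square field_simps)
  show ?thesis
  proof (rule unstable_kern[where r = "[3,0]" and P = ?P and \<sigma> = "1/2" and A = ?A and A' = ?A and B = ?A
        and E = ?E and C = ?E and a = ?E and c = "1/2" and \<beta> = "7/10" and d = "1/1000"])
    fix t :: real assume t: "0 < t" "t \<le> 1 / 1000"
    have t2: "1000 * t\<^sup>2 \<le> t" "t\<^sup>2 \<ge> 0" using square_le_small[OF t] by auto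
    have g: "(1 - t)\<^sup>2 = 1 - 2 * t + t\<^sup>2" by (simp add: power2_eq_square algebra_simps)
    show "1 / 2 \<le> ?E t \<and> ?E t < 1" using t by simp
    show "(?E t)\<^sup>2 \<le> s \<and> s \<le> ?E t" if "s \<in> {?A t, ?A t, ?A t, ?E t, ?E t}" for s
      using that t t2 g by auto
    fix v :: "nat \<times> nat \<Rightarrow> real"
    define u z where "u = v (0,0) + v (0,1) + (v (0,2) + v (0,3))" and "z = v (1,0)"
    define W where "W = (1 - t / 2) * u + (1 - t) / 2 * z"
    let ?R = "t * ((v (0,0) + v (0,1) - (v (0,2) + v (0,3))) / 2) - (1 - t) / 2 * z"
    have co: "0 < (1 - (1 - t)\<^sup>2) / 2" "1 / 2 \<le> 1 - (1 - t)\<^sup>2 / 2" using t t2 g by auto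
    have Q': "?Q t v = (1 - (1 - t)\<^sup>2) / 2 * (v (0,0) - v (0,1))\<^sup>2
        + (1 - (1 - t)\<^sup>2) / 2 * (v (0,2) - v (0,3))\<^sup>2 + ?R\<^sup>2 + W\<^sup>2 + (1 - (1 - t)\<^sup>2 / 2) * z\<^sup>2"
      unfolding Q u_def z_def W_def ..
    have nn: "0 \<le> (1 - (1 - t)\<^sup>2) / 2 * (v (0,0) - v (0,1))\<^sup>2"
        "0 \<le> (1 - (1 - t)\<^sup>2) / 2 * (v (0,2) - v (0,3))\<^sup>2" "0 \<le> ?R\<^sup>2" "0 \<le> W\<^sup>2"
        "0 \<le> (1 - (1 - t)\<^sup>2 / 2) * z\<^sup>2"
      using co by (auto simp del: zero_le_divide_iff)
    have z2: "1 / 2 * z\<^sup>2 \<le> (1 - (1 - t)\<^sup>2 / 2) * z\<^sup>2" using co(2) by (intro mult_right_mono) auto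
    show "1 / 2 * (\<Sum>x\<in>pts [3,0]. v x)\<^sup>2 \<le> ?Q t v"
    proof -
      have s: "(\<Sum>x\<in>pts [3,0]. v x) = u + z" unfolding sum_type_30 u_def z_def by simp
      have "(1 - t / 2)\<^sup>2 = 1 - t + t\<^sup>2 / 4" by (simp add: power2_eq_square field_simps)
      then have "3 / 4 \<le> (1 - t / 2)\<^sup>2" using t t2 by linarith
      then have "3 / 4 * (u + z)\<^sup>2 \<le> (1 - t / 2)\<^sup>2 * (u + z)\<^sup>2" by (rule mult_right_mono) simp
      also have "\<dots> = (W + z / 2)\<^sup>2"
        unfolding W_def power_mult_distrib[symmetric] by (rule arg_cong[where f = "\<lambda>x. x\<^sup>2"]) (simp add: field_simps)
      \<comment> \<open>Cauchy-Schwarz with weights 1 and \<open>1 / 2\<close>; the ratio of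
        \<open>3 / 4\<close> to \<open>3 / 2\<close> is the constant \<open>c\<close>.\<close>
      also have "\<dots> \<le> 3 / 2 * (W\<^sup>2 + 1 / 2 * z\<^sup>2)"
        using zero_le_power2[of "W - z"] by (simp add: power2_eq_square field_simps)
      finally have "3 / 4 * (u + z)\<^sup>2 \<le> 3 / 2 * (W\<^sup>2 + 1 / 2 * z\<^sup>2)" .
      moreover have "1 / 2 * X \<le> p + q + r + w + y"
        if "3 / 4 * X \<le> 3 / 2 * (w + 1 / 2 * y')" "0 \<le> p" "0 \<le> q" "0 \<le> r" "1 / 2 * y' \<le> y"
        for X p q r w y y' :: real using that by argo
      ultimately show ?thesis unfolding s Q' using nn(1-3) z2 by blast
    qed
    show "\<forall>x\<in>pts [3,0]. v x = 0" if "?Q t v \<le> 0"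
    proof -
      have zero: "(1 - (1 - t)\<^sup>2) / 2 * (v (0,0) - v (0,1))\<^sup>2 = 0"
        "(1 - (1 - t)\<^sup>2) / 2 * (v (0,2) - v (0,3))\<^sup>2 = 0" "?R\<^sup>2 = 0" "W\<^sup>2 = 0"
        "(1 - (1 - t)\<^sup>2 / 2) * z\<^sup>2 = 0"
        using nn that unfolding Q' by linarith+
      have "v (0,0) = v (0,1)" using zero(1) co(1) by (simp only: mult_eq_0_iff) auto
      moreover have "v (0,2) = v (0,3)" using zero(2) co(1) by (simp only: mult_eq_0_iff) auto
      moreover have z: "z = 0" using zero(5) co(2) by (simp only: mult_eq_0_iff) auto
      moreover have "u = 0" using zero(4) t unfolding W_def z by simp
      moreover have "v (0,0) + v (0,1) = v (0,2) + v (0,3)" using zero(3) t unfolding z by simp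
      ultimately show ?thesis unfolding pts_type_30 u_def z_def by simp
    qed
    \<comment> \<open>The alternating mass \<open>x\<close> cancels the square containing it. As
      \<open>t\<close> tends to 0 the rest becomes \<open>(u + z / 2)^2 + z^2 / 2\<close>, minimal
      at \<open>u = 1/3\<close>, \<open>z = 2/3\<close> with value \<open>2/3\<close>; the limit
      space has \<open>3/4\<close>, and \<beta> lies between.\<close>
    define x where "x = (1 - t) / (3 * t)"
    define w :: "nat \<times> nat \<Rightarrow> real" where
      "w p = (if p = (1,0) then 2 / 3 else if p \<in> ?P then (1 / 6 + x) / 2 else (1 / 6 - x) / 2)" for p
    have w: "w (0,0) = (1 / 6 + x) / 2" "w (0,1) = (1 / 6 + x) / 2" "w (0,2) = (1 / 6 - x) / 2"
      "w (0,3) = (1 / 6 - x) / 2" "w (1,0) = 2 / 3"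
      by (simp_all add: w_def)
    have tx: "t * x = (1 - t) / 3" using t by (simp add: x_def)
    have "?Q t w = (t * x - (1 - t) / 3)\<^sup>2 + ((1 - t / 2) / 3 + (1 - t) / 3)\<^sup>2 + (1 - (1 - t)\<^sup>2 / 2) * (4 / 9)"
      unfolding Q w by (simp add: power2_eq_square field_simps)
    also have "\<dots> = (6 - 2 * t + t\<^sup>2 / 4) / 9"
      unfolding tx by (simp add: power2_eq_square field_simps)
    also have "\<dots> \<le> 7 / 10" using t t2 by simp
    finally have "?Q t w \<le> 7 / 10" .
    moreover have "(\<Sum>x\<in>pts [3,0]. w x) = 1" unfolding sum_type_30 w by simp
    ultimately show "\<exists>v. (\<Sum>x\<in>pts [3,0]. v x) = 1 \<and> ?Q t v \<le> 7 / 10" by blast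
  qed (auto intro!: continuous_intros)
qed

text \<open>Let both clusters have mass 0 and \<open>v (0,0) = v (0,1)\<close>, with sum
  \<open>q\<close>. The coefficients 28, 31, 16 turn the first-order form into the square
  \<open>2 * t * (3 * q - 4 * v (1,0))^2\<close>, whose null direction has
  \<open>q : v (1,0) = 4 : 3\<close>. The term \<open>512 * t^2\<close> gives it the energy
  \<open>(16 * t * q)^2\<close>.\<close>

lemma unstable_21: "unstable [2,1]"
proof -
  let ?P = "{(0,0), (0,1), (1,0)} :: (nat \<times> nat) set"
  let ?A = "\<lambda>t::real. 1 - 28 * t + 512 * t\<^sup>2" and ?B = "\<lambda>t::real. 1 - 31 * t" and ?E = "\<lambda>t::real. 1 - 16 * t"
  let ?Q = "\<lambda>t. qform (pts [2,1]) (kern ?P (4/5) (?A t) (?B t) (?B t) (?E t) (?E t))"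
  have Q: "?Q t v = (14 * t - 256 * t\<^sup>2) * (v (0,0) - v (0,1))\<^sup>2
      + 2 * t * (3 * (v (0,0) + v (0,1)) - 4 * v (1,0)
          + (4 * (v (1,0) + v (1,1)) - 3 * (v (0,0) + v (0,1) + v (0,2))) / 2)\<^sup>2
      + (16 * t * (v (0,0) + v (0,1)) - 7 / 16 * (v (0,0) + v (0,1) + v (0,2)))\<^sup>2
      + 207 / 256 * (v (0,0) + v (0,1) + v (0,2))\<^sup>2 + (v (1,0) + v (1,1))\<^sup>2
      + 8 / 5 * (1 - 31 * t) * ((v (0,0) + v (0,1) + v (0,2)) * (v (1,0) + v (1,1)))
      - t * (4 * (v (1,0) + v (1,1)) - 3 * (v (0,0) + v (0,1) + v (0,2)))\<^sup>2 / 2" for t v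
    unfolding qform_type_21 by (simp add: power2_eq_square field_simps)
  show ?thesis
  proof (rule unstable_kern[where r = "[2,1]" and P = ?P and \<sigma> = "4/5" and A = ?A and A' = ?B and B = ?B
        and E = ?E and C = ?E and a = ?E and c = "1/2" and \<beta> = "17/20" and d = "1/1000"])
    fix t :: real assume t: "0 < t" "t \<le> 1 / 1000"
    have t2: "1000 * t\<^sup>2 \<le> t" "t\<^sup>2 \<ge> 0" using square_le_small[OF t] by auto
    show "1 / 2 \<le> ?E t \<and> ?E t < 1" using t by simp
    show "(?E t)\<^sup>2 \<le> s \<and> s \<le> ?E t" if "s \<in> {?A t, ?B t, ?B t, ?E t, ?E t}" for s
    proof -
      have "(?E t)\<^sup>2 = 1 - 32 * t + 256 * t\<^sup>2" by (simp add: power2_eq_square algebra_simps)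
      then show ?thesis using that t t2 by auto
    qed
    fix v :: "nat \<times> nat \<Rightarrow> real"
    define q U Z where "q = v (0,0) + v (0,1)" and "U = v (0,0) + v (0,1) + v (0,2)"
      and "Z = v (1,0) + v (1,1)"
    let ?w = "3 * q - 4 * v (1,0) + (4 * Z - 3 * U) / 2"
    let ?R = "207 / 256 * U\<^sup>2 + Z\<^sup>2 + 8 / 5 * (1 - 31 * t) * (U * Z) - t * (4 * Z - 3 * U)\<^sup>2 / 2"
    have Q': "?Q t v = (14 * t - 256 * t\<^sup>2) * (v (0,0) - v (0,1))\<^sup>2 + 2 * t * ?w\<^sup>2
        + (16 * t * q - 7 / 16 * U)\<^sup>2 + ?R"
      unfolding Q q_def U_def Z_def by simp
    have co: "0 < 14 * t - 256 * t\<^sup>2" using t t2 by simp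
    have nn: "0 \<le> (14 * t - 256 * t\<^sup>2) * (v (0,0) - v (0,1))\<^sup>2" "0 \<le> 2 * t * ?w\<^sup>2"
      "0 \<le> (16 * t * q - 7 / 16 * U)\<^sup>2" "0 \<le> (U + Z)\<^sup>2" "0 \<le> U\<^sup>2" "0 \<le> Z\<^sup>2"
      using co t by auto
    \<comment> \<open>The remainder for cluster masses \<open>U\<close>, \<open>Z\<close>, where
      \<open>207 / 256 = 1 - (7 / 16)^2\<close> records the loss along the null direction. The
      margin \<open>1 / 100\<close> forces \<open>U = Z = 0\<close> in the proof of
      definiteness.\<close>
    have R: "1 / 2 * (U + Z)\<^sup>2 + 1 / 100 * (U\<^sup>2 + Z\<^sup>2) \<le> ?R"
    proof -
      have R_eq: "?R = 207 / 256 * U\<^sup>2 + Z\<^sup>2 + 8 / 5 * (U * Z) - 188 / 5 * (t * (U * Z)) - 8 * (t * Z\<^sup>2)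
          - 9 / 2 * (t * U\<^sup>2)"
        by (simp add: power2_eq_square field_simps)
      have 1: "t * (U * Z) \<le> 1 / 2000 * U\<^sup>2 + 1 / 2000 * Z\<^sup>2"
      proof -
        have "t * (U * Z) \<le> t * ((U\<^sup>2 + Z\<^sup>2) / 2)"
          using zero_le_power2[of "U - Z"] t
          by (intro mult_left_mono) (simp_all add: power2_eq_square field_simps)
        also have "\<dots> \<le> 1 / 1000 * ((U\<^sup>2 + Z\<^sup>2) / 2)" using t by (intro mult_right_mono) auto
        finally show ?thesis by simp
      qed
      have 2: "t * Z\<^sup>2 \<le> 1 / 1000 * Z\<^sup>2" "t * U\<^sup>2 \<le> 1 / 1000 * U\<^sup>2"
        using t(2) by (intro mult_right_mono; simp)+
      have 3: "0 \<le> 1 / 4 * U\<^sup>2 + 3 / 5 * (U * Z) + 9 / 25 * Z\<^sup>2"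
        using zero_le_power2[of "1 / 2 * U + 3 / 5 * Z"] by (simp add: power2_eq_square field_simps)
      have 4: "(U + Z)\<^sup>2 = U\<^sup>2 + 2 * (U * Z) + Z\<^sup>2"
        by (simp add: power2_eq_square algebra_simps)
      have "1 / 2 * (a + 2 * c + b) + 1 / 100 * (a + b)
          \<le> 207 / 256 * a + b + 8 / 5 * c - 188 / 5 * tc - 8 * tb - 9 / 2 * ta"
        if "tc \<le> 1 / 2000 * a + 1 / 2000 * b" "tb \<le> 1 / 1000 * b" "ta \<le> 1 / 1000 * a"
          "0 \<le> 1 / 4 * a + 3 / 5 * c + 9 / 25 * b" "0 \<le> a" "0 \<le> b"
        for a b c ta tb tc :: real using that by argo
      from this[OF 1 2 3 nn(5,6)] show ?thesis unfolding R_eq 4 .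
    qed
    show "1 / 2 * (\<Sum>x\<in>pts [2,1]. v x)\<^sup>2 \<le> ?Q t v"
    proof -
      have s: "(\<Sum>x\<in>pts [2,1]. v x) = U + Z" unfolding sum_type_21 U_def Z_def by simp
      have "X \<le> p + q' + r' + R"
        if "0 \<le> p" "0 \<le> q'" "0 \<le> r'" "0 \<le> a" "0 \<le> b" "X + 1 / 100 * (a + b) \<le> R"
        for X p q' r' a b R :: real using that by argo
      from this[OF nn(1-3,5,6) R] show ?thesis unfolding s Q' .
    qed
    show "\<forall>x\<in>pts [2,1]. v x = 0" if "?Q t v \<le> 0"
    proof -
      have zero: "(14 * t - 256 * t\<^sup>2) * (v (0,0) - v (0,1))\<^sup>2 = 0" "2 * t * ?w\<^sup>2 = 0"
        "(16 * t * q - 7 / 16 * U)\<^sup>2 = 0" "U\<^sup>2 = 0" "Z\<^sup>2 = 0"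
      proof -
        have "p = 0 \<and> q' = 0 \<and> r' = 0 \<and> a = 0 \<and> b = 0"
          if "0 \<le> p" "0 \<le> q'" "0 \<le> r'" "0 \<le> a" "0 \<le> b" "0 \<le> X"
            "1 / 2 * X + 1 / 100 * (a + b) \<le> R" "p + q' + r' + R \<le> 0"
          for X p q' r' a b R :: real using that by argo
        from this[OF nn(1-3,5,6,4) R that[unfolded Q']]
        show "(14 * t - 256 * t\<^sup>2) * (v (0,0) - v (0,1))\<^sup>2 = 0" "2 * t * ?w\<^sup>2 = 0"
          "(16 * t * q - 7 / 16 * U)\<^sup>2 = 0" "U\<^sup>2 = 0" "Z\<^sup>2 = 0" by blast+
      qed
      have UZ: "U = 0" "Z = 0" using zero by simp_all
      have "v (0,0) = v (0,1)" using zero(1) co by (simp only: mult_eq_0_iff) auto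
      moreover have q: "q = 0" using zero(3) t unfolding UZ by simp
      moreover have "v (1,0) = 0" using zero(2) t unfolding UZ q by simp
      ultimately show ?thesis using UZ unfolding pts_type_21 q_def U_def Z_def by simp
    qed
    \<comment> \<open>With \<open>U = 1\<close> and \<open>Z = 0\<close>, \<open>s\<close> cancels
      the square containing \<open>7 / 16\<close> and \<open>z\<close> the one containing
      \<open>3 * q - 4 * v (1,0)\<close>. At most \<open>207 / 256\<close> remains, below
      \<open>17 / 20\<close>, while the limit space has \<open>9 / 10\<close>.\<close>
    define s where "s = 7 / (256 * t)"
    define z where "z = (3 * s - 3 / 2) / 4"
    define w :: "nat \<times> nat \<Rightarrow> real" where
      "w p = (if p = (1,0) then z else if p = (1,1) then - z else if p \<in> ?P then s / 2 else 1 - s)" for p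
    have w: "w (0,0) = s / 2" "w (0,1) = s / 2" "w (0,2) = 1 - s" "w (1,0) = z" "w (1,1) = - z"
      by (simp_all add: w_def)
    have ts: "t * s = 7 / 256" using t by (simp add: s_def)
    have "?Q t w = 2 * t * (3 * s - 4 * z - 3 / 2)\<^sup>2 + (16 * (t * s) - 7 / 16)\<^sup>2 + 207 / 256 - t * 9 / 2"
      unfolding Q w by (simp add: mult.assoc)
    also have "3 * s - 4 * z - 3 / 2 = 0" by (simp add: z_def field_simps)
    also have "2 * t * 0\<^sup>2 + (16 * (t * s) - 7 / 16)\<^sup>2 + 207 / 256 - t * 9 / 2 \<le> 17 / 20"
      unfolding ts using t by simp
    finally have "?Q t w \<le> 17 / 20" .
    moreover have "(\<Sum>x\<in>pts [2,1]. w x) = 1" unfolding sum_type_21 w by simp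
    ultimately show "\<exists>v. (\<Sum>x\<in>pts [2,1]. v x) = 1 \<and> ?Q t v \<le> 17 / 20" by blast
  qed (auto intro!: continuous_intros)
qed

text \<open>Move mass \<open>x0\<close>, \<open>x1\<close>, \<open>x2\<close> inside the three
  clusters. Since \<open>- 7 - 6 + 2 * 4 = - 5\<close> and 5 times the similarity \<open>4/5\<close>
  is 4, the first-order energy is \<open>4 * t\<close> times the sum of the squared differences, so
  equal moves are null; the term \<open>- t^2\<close> in \<open>?E\<close> gives them second-order
  energy. Having 7 and 6 different breaks the symmetry between \<open>?P\<close> and its complement,
  which would otherwise prevent any interaction with uniform mass.\<close>

lemma unstable_111: "unstable [1,1,1]"
proof -
  let ?P = "{(0,0), (1,0), (2,0)} :: (nat \<times> nat) set"
  let ?A = "\<lambda>t::real. 1 - 7 * t" and ?B = "\<lambda>t::real. 1 - 6 * t" and ?E = "\<lambda>t::real. 1 - 4 * t - t\<^sup>2"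
    and ?C = "\<lambda>t::real. 1 - 4 * t"
  let ?Q = "\<lambda>t. qform (pts [1,1,1]) (kern ?P (4/5) (?A t) (?A t) (?B t) (?E t) (?C t))"
  let ?k = "\<lambda>t::real. 4 + 2 / 3 * t" and ?l = "\<lambda>t::real. (56 / 5 + 2 * t) / 3"
  let ?f = "\<lambda>t (d::real) e. t * (?k t * d\<^sup>2 - ?l t * (d * e))"
  have identity: "x0\<^sup>2 + x1\<^sup>2 + x2\<^sup>2 + y0\<^sup>2 + y1\<^sup>2 + y2\<^sup>2 + 2 * (1 - 4 * t - t\<^sup>2) * (x0 * y0 + x1 * y1 + x2 * y2)
      + 2 * (4 / 5 * (1 - 7 * t)) * (x0 * x1 + x0 * x2 + x1 * x2)
      + 2 * (4 / 5 * (1 - 6 * t)) * (y0 * y1 + y0 * y2 + y1 * y2)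
      + 2 * (4 / 5 * (1 - 4 * t)) * (x0 * y1 + x0 * y2 + x1 * y0 + x1 * y2 + x2 * y0 + x2 * y1)
    = u0\<^sup>2 + u1\<^sup>2 + u2\<^sup>2 + 2 * (4 / 5 * (1 - 6 * t)) * (u0 * u1 + u0 * u2 + u1 * u2)
      + ?f t (x0 - x1) (u0 - u1) + ?f t (x0 - x2) (u0 - u2) + ?f t (x1 - x2) (u1 - u2)
      + 2 / 3 * (t * (x0 + x1 + x2) - (2 / 5 + t / 2) * (u0 + u1 + u2))\<^sup>2
      - 2 / 3 * (2 / 5 + t / 2)\<^sup>2 * (u0 + u1 + u2)\<^sup>2"
    if "u0 = x0 + y0" "u1 = x1 + y1" "u2 = x2 + y2" for x0 x1 x2 y0 y1 y2 u0 u1 u2 t :: real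
  proof -
    \<comment> \<open>\<open>1\<close> treats a single cluster and \<open>2\<close> a pair of
      clusters, both in terms of the moved mass \<open>x\<close> and the cluster mass
      \<open>x + y\<close>.\<close>
    have 1: "x\<^sup>2 + y\<^sup>2 + 2 * (1 - 4 * t - t\<^sup>2) * (x * y) = (x + y)\<^sup>2 + (8 * t + 2 * t\<^sup>2) * (x\<^sup>2 - x * (x + y))"
      for x y :: real by (simp add: power2_eq_square algebra_simps)
    have 2: "(1 - 7 * t) * (x * x') + (1 - 6 * t) * (y * y') + (1 - 4 * t) * (x * y' + x' * y)
        = (1 - 6 * t) * ((x + y) * (x' + y')) - 5 * t * (x * x') + 2 * t * (x * (x' + y') + x' * (x + y))"
      for x y x' y' :: real by (simp add: algebra_simps)
    have "x0\<^sup>2 + x1\<^sup>2 + x2\<^sup>2 + y0\<^sup>2 + y1\<^sup>2 + y2\<^sup>2 + 2 * (1 - 4 * t - t\<^sup>2) * (x0 * y0 + x1 * y1 + x2 * y2)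
        + 2 * (4 / 5 * (1 - 7 * t)) * (x0 * x1 + x0 * x2 + x1 * x2)
        + 2 * (4 / 5 * (1 - 6 * t)) * (y0 * y1 + y0 * y2 + y1 * y2)
        + 2 * (4 / 5 * (1 - 4 * t)) * (x0 * y1 + x0 * y2 + x1 * y0 + x1 * y2 + x2 * y0 + x2 * y1)
      = (x0\<^sup>2 + y0\<^sup>2 + 2 * (1 - 4 * t - t\<^sup>2) * (x0 * y0)) + (x1\<^sup>2 + y1\<^sup>2 + 2 * (1 - 4 * t - t\<^sup>2) * (x1 * y1))
        + (x2\<^sup>2 + y2\<^sup>2 + 2 * (1 - 4 * t - t\<^sup>2) * (x2 * y2))
        + 8 / 5 * ((1 - 7 * t) * (x0 * x1) + (1 - 6 * t) * (y0 * y1) + (1 - 4 * t) * (x0 * y1 + x1 * y0))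
        + 8 / 5 * ((1 - 7 * t) * (x0 * x2) + (1 - 6 * t) * (y0 * y2) + (1 - 4 * t) * (x0 * y2 + x2 * y0))
        + 8 / 5 * ((1 - 7 * t) * (x1 * x2) + (1 - 6 * t) * (y1 * y2) + (1 - 4 * t) * (x1 * y2 + x2 * y1))"
      by (simp add: field_simps)
    also have "\<dots> = (u0\<^sup>2 + (8 * t + 2 * t\<^sup>2) * (x0\<^sup>2 - x0 * u0)) + (u1\<^sup>2 + (8 * t + 2 * t\<^sup>2) * (x1\<^sup>2 - x1 * u1))
        + (u2\<^sup>2 + (8 * t + 2 * t\<^sup>2) * (x2\<^sup>2 - x2 * u2))
        + 8 / 5 * ((1 - 6 * t) * (u0 * u1) - 5 * t * (x0 * x1) + 2 * t * (x0 * u1 + x1 * u0))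
        + 8 / 5 * ((1 - 6 * t) * (u0 * u2) - 5 * t * (x0 * x2) + 2 * t * (x0 * u2 + x2 * u0))
        + 8 / 5 * ((1 - 6 * t) * (u1 * u2) - 5 * t * (x1 * x2) + 2 * t * (x1 * u2 + x2 * u1))"
      unfolding 1 2 that ..
    also have "\<dots> = u0\<^sup>2 + u1\<^sup>2 + u2\<^sup>2 + 2 * (4 / 5 * (1 - 6 * t)) * (u0 * u1 + u0 * u2 + u1 * u2)
      + ?f t (x0 - x1) (u0 - u1) + ?f t (x0 - x2) (u0 - u2) + ?f t (x1 - x2) (u1 - u2)
      + 2 / 3 * (t * (x0 + x1 + x2) - (2 / 5 + t / 2) * (u0 + u1 + u2))\<^sup>2
      - 2 / 3 * (2 / 5 + t / 2)\<^sup>2 * (u0 + u1 + u2)\<^sup>2"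
      by (simp add: power2_eq_square field_simps)
    finally show ?thesis .
  qed
  show ?thesis
  proof (rule unstable_kern[where r = "[1,1,1]" and P = ?P and \<sigma> = "4/5" and A = ?A and A' = ?A and B = ?B
        and E = ?E and C = ?C and a = ?C and c = "1/2" and \<beta> = "4/5" and d = "1/1000"])
    fix t :: real assume t: "0 < t" "t \<le> 1 / 1000"
    have t2: "1000 * t\<^sup>2 \<le> t" "t\<^sup>2 \<ge> 0" using square_le_small[OF t] by auto
    show "1 / 2 \<le> ?C t \<and> ?C t < 1" using t by simp
    show "(?C t)\<^sup>2 \<le> s \<and> s \<le> ?C t" if "s \<in> {?A t, ?A t, ?B t, ?E t, ?C t}" for s
    proof -
      have "(?C t)\<^sup>2 = 1 - 8 * t + 16 * t\<^sup>2" by (simp add: power2_eq_square algebra_simps)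
      then show ?thesis using that t t2 by auto
    qed
    \<comment> \<open>Completing the square in \<open>e\<close>: \<open>?l t \<le> 15 / 4\<close>
      leaves more than \<open>1 / 4\<close> of \<open>?k t\<close>, and the loss
      \<open>t * e^2\<close> involves cluster masses only, where the form has room of order
      1.\<close>
    have f: "t * (1 / 4 * d\<^sup>2) - t * e\<^sup>2 \<le> ?f t d e" for d e :: real
    proof -
      have "(?l t)\<^sup>2 \<le> (15 / 4)\<^sup>2" using t by (intro power_mono) auto
      moreover have "(15 / 4 :: real)\<^sup>2 = 225 / 16" by (simp add: power2_eq_square)
      ultimately have "1 / 4 \<le> ?k t - (?l t)\<^sup>2 / 4" using t by linarith
      then have "1 / 4 * d\<^sup>2 \<le> (?k t - (?l t)\<^sup>2 / 4) * d\<^sup>2" by (rule mult_right_mono) simp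
      moreover have "(e - ?l t / 2 * d)\<^sup>2 = e\<^sup>2 - ?l t * (d * e) + (?l t)\<^sup>2 / 4 * d\<^sup>2"
        by (simp add: power2_eq_square field_simps)
      moreover have "(e - ?l t / 2 * d)\<^sup>2 \<ge> 0" by simp
      ultimately have "1 / 4 * d\<^sup>2 - e\<^sup>2 \<le> ?k t * d\<^sup>2 - ?l t * (d * e)"
        unfolding left_diff_distrib by linarith
      then have "t * (1 / 4 * d\<^sup>2 - e\<^sup>2) \<le> ?f t d e" using t by (intro mult_left_mono) auto
      then show ?thesis by (simp add: right_diff_distrib)
    qed
    fix v :: "nat \<times> nat \<Rightarrow> real"
    define x0 x1 x2 where "x0 = v (0,0)" and "x1 = v (1,0)" and "x2 = v (2,0)"
    define u0 u1 u2 where "u0 = v (0,0) + v (0,1)" and "u1 = v (1,0) + v (1,1)" and "u2 = v (2,0) + v (2,1)"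
    define U where "U = u0 + u1 + u2"
    let ?R = "t * (x0 + x1 + x2) - (2 / 5 + t / 2) * U"
    let ?N = "u0\<^sup>2 + u1\<^sup>2 + u2\<^sup>2" and ?D = "(x0 - x1)\<^sup>2 + (x0 - x2)\<^sup>2 + (x1 - x2)\<^sup>2"
    have Q: "?Q t v = ?N + 2 * (4 / 5 * (1 - 6 * t)) * (u0 * u1 + u0 * u2 + u1 * u2)
      + ?f t (x0 - x1) (u0 - u1) + ?f t (x0 - x2) (u0 - u2) + ?f t (x1 - x2) (u1 - u2)
      + 2 / 3 * ?R\<^sup>2 - 2 / 3 * (2 / 5 + t / 2)\<^sup>2 * U\<^sup>2"
      unfolding qform_type_111 x0_def x1_def x2_def U_def
      by (rule identity) (simp_all add: u0_def u1_def u2_def)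
    have ge: "1 / 2 * U\<^sup>2 + 1 / 10 * ?N + t * (1 / 4 * ?D) + 2 / 3 * ?R\<^sup>2 \<le> ?Q t v"
    proof -
      have "(2 / 5 + t / 2)\<^sup>2 = 4 / 25 + 2 / 5 * t + t\<^sup>2 / 4" by (simp add: power2_eq_square field_simps)
      then have "(2 / 5 + t / 2)\<^sup>2 \<le> 17 / 100" using t t2 by linarith
      then have "1 / 2 \<le> 4 / 5 - 24 / 5 * t - 2 / 3 * (2 / 5 + t / 2)\<^sup>2 + t" using t by linarith
      then have 1: "1 / 2 * U\<^sup>2 \<le> (4 / 5 - 24 / 5 * t - 2 / 3 * (2 / 5 + t / 2)\<^sup>2 + t) * U\<^sup>2"
        by (rule mult_right_mono) simp
      have 2: "1 / 10 * ?N \<le> (1 / 5 + 24 / 5 * t - 3 * t) * ?N"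
        using t by (intro mult_right_mono) auto
      have "?N + 2 * (4 / 5 * (1 - 6 * t)) * (u0 * u1 + u0 * u2 + u1 * u2)
          - t * (u0 - u1)\<^sup>2 - t * (u0 - u2)\<^sup>2 - t * (u1 - u2)\<^sup>2 - 2 / 3 * (2 / 5 + t / 2)\<^sup>2 * U\<^sup>2
        = (4 / 5 - 24 / 5 * t - 2 / 3 * (2 / 5 + t / 2)\<^sup>2 + t) * U\<^sup>2 + (1 / 5 + 24 / 5 * t - 3 * t) * ?N"
        unfolding U_def by (simp add: power2_eq_square field_simps)
      then show ?thesis
        unfolding Q using 1 2 f[of "x0 - x1" "u0 - u1"] f[of "x0 - x2" "u0 - u2"] f[of "x1 - x2" "u1 - u2"]
        by (simp only: distrib_left)
    qed
    have nn: "0 \<le> U\<^sup>2" "0 \<le> ?N" "0 \<le> t * (1 / 4 * ?D)" "0 \<le> ?R\<^sup>2" using t by auto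
    have lower: "1 / 2 * a \<le> q" and zero: "q \<le> 0 \<Longrightarrow> a = 0 \<and> n = 0 \<and> d = 0 \<and> r = 0"
      if "0 \<le> a" "0 \<le> n" "0 \<le> d" "0 \<le> r" "1 / 2 * a + 1 / 10 * n + d + 2 / 3 * r \<le> q"
      for a n d r q :: real
      using that by argo+
    show "1 / 2 * (\<Sum>x\<in>pts [1,1,1]. v x)\<^sup>2 \<le> ?Q t v"
    proof -
      have s: "(\<Sum>x\<in>pts [1,1,1]. v x) = U"
        unfolding sum_type_111 U_def u0_def u1_def u2_def by simp
      show ?thesis unfolding s by (rule lower[OF nn ge])
    qed
    show "\<forall>x\<in>pts [1,1,1]. v x = 0" if "?Q t v \<le> 0"
    proof -
      have zero: "U\<^sup>2 = 0" "?N = 0" "t * (1 / 4 * ?D) = 0" "?R\<^sup>2 = 0"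
        using zero[OF nn ge that] by blast+
      have U: "U = 0" using zero(1) by simp
      have u: "u0 = 0" "u1 = 0" "u2 = 0" using zero(2) by (simp_all add: add_nonneg_eq_0_iff)
      have "?D = 0" using zero(3) t by simp
      then have "x0 = x1" "x0 = x2" by (simp_all add: add_nonneg_eq_0_iff)
      moreover have "x0 + x1 + x2 = 0" using zero(4) t unfolding U by simp
      ultimately have "x0 = 0" "x1 = 0" "x2 = 0" by auto
      then show ?thesis using u
        unfolding pts_type_111 x0_def x1_def x2_def u0_def u1_def u2_def by simp
    qed
    \<comment> \<open>Chosen to cancel the square of \<open>?R\<close> at uniform cluster masses
      \<open>1/3\<close>. The value then tends to \<open>19/25\<close>, below \<open>4/5\<close>,
      while the limit space has \<open>13/15\<close>.\<close>
    define x where "x = (2 / 5 + t / 2) / (3 * t)"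
    define w :: "nat \<times> nat \<Rightarrow> real" where "w p = (if p \<in> ?P then x else 1 / 3 - x)" for p
    have w: "w (0,0) = x" "w (1,0) = x" "w (2,0) = x" "w (0,1) = 1 / 3 - x" "w (1,1) = 1 / 3 - x"
      "w (2,1) = 1 / 3 - x"
      by (simp_all add: w_def)
    have tx: "t * (x + x + x) = 2 / 5 + t / 2" using t by (simp add: x_def field_simps)
    have "?Q t w = (1/3)\<^sup>2 + (1/3)\<^sup>2 + (1/3)\<^sup>2 + 2 * (4 / 5 * (1 - 6 * t)) * (1/3 * (1/3) + 1/3 * (1/3) + 1/3 * (1/3))
      + ?f t (x - x) (1/3 - 1/3) + ?f t (x - x) (1/3 - 1/3) + ?f t (x - x) (1/3 - 1/3)
      + 2 / 3 * (t * (x + x + x) - (2 / 5 + t / 2) * (1/3 + 1/3 + 1/3))\<^sup>2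
      - 2 / 3 * (2 / 5 + t / 2)\<^sup>2 * (1/3 + 1/3 + 1/3)\<^sup>2"
      unfolding qform_type_111 w by (rule identity) simp_all
    also have "\<dots> \<le> 4 / 5" unfolding tx using t t2 by (simp add: power2_eq_square field_simps)
    finally have "?Q t w \<le> 4 / 5" .
    moreover have "(\<Sum>x\<in>pts [1,1,1]. w x) = 1" unfolding sum_type_111 w by simp
    ultimately show "\<exists>v. (\<Sum>x\<in>pts [1,1,1]. v x) = 1 \<and> ?Q t v \<le> 4 / 5" by blast
  qed (auto intro!: continuous_intros)
qed

section \<open>Reduction to the minimal types\<close>

lemma unstable_append_zeros: "unstable r \<Longrightarrow> r \<noteq> [] \<Longrightarrow> unstable (r @ replicate n 0)"
proof (induction n)
  case (Suc n)
  then have "unstable ((r @ replicate n 0) @ [0])" by (intro unstable_append_0) auto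
  then show ?case by (simp add: replicate_append_same)
qed simp

text \<open>Entries are raised one at a time, by induction on the total deficit. Intermediate lists
  may fail to be decreasing, so \<open>unstable\<close> speaks of arbitrary lists.\<close>

lemma unstable_pointwise_le:
  assumes "unstable b" "length b = length r" "\<And>i. i < length r \<Longrightarrow> b ! i \<le> r ! i"
  shows "unstable r"
  using assms
proof (induction "\<Sum>i<length r. r ! i - b ! i" arbitrary: b rule: less_induct)
  case less
  show ?case
  proof (cases "b = r")
    case False
    then obtain i where i: "i < length r" "b ! i < r ! i"
      using less.prems by (metis le_neq_implies_less nth_equalityI)
    let ?b = "b[i := Suc (b ! i)]"
    have nth: "?b ! j = (if j = i then Suc (b ! i) else b ! j)" if "j < length r" for j
      using that less.prems(2) by (auto simp: nth_list_update)
    have "(\<Sum>j<length r. r ! j - ?b ! j) < (\<Sum>j<length r. r ! j - b ! j)"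
      using i nth by (intro sum_strict_mono_ex1) auto
    then show ?thesis
    proof (rule less.hyps)
      show "unstable ?b" using unstable_increase less.prems(1,2) i(1) by simp
      show "?b ! j \<le> r ! j" if "j < length r" for j
        using nth[OF that] less.prems(3)[OF that] i by auto
    qed (use less.prems(2) in simp)
  qed (use less.prems in simp)
qed

lemma unstable_ge:
  assumes "unstable b" "b \<noteq> []" "length b \<le> length r" "\<And>i. i < length b \<Longrightarrow> b ! i \<le> r ! i"
  shows "unstable r"
proof (rule unstable_pointwise_le)
  show "unstable (b @ replicate (length r - length b) 0)" by (rule unstable_append_zeros[OF assms(1,2)])
  show "(b @ replicate (length r - length b) 0) ! i \<le> r ! i" if "i < length r" for i
    using that assms by (auto simp: nth_append)
qed (use assms(3) in simp)

text \<open>For the order "at least as long and entrywise at least as large", the minimal decreasing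
  lists among those with sum at least 3, the list \<open>[3]\<close> excluded, are
  \<open>[4]\<close>, \<open>[3,0]\<close>, \<open>[2,1]\<close> and \<open>[1,1,1]\<close>.\<close>

lemma unstable_type:
  assumes r: "r \<noteq> []" "sorted_wrt (\<ge>) r" and sum: "sum_list r \<ge> 3" "\<not> (sum_list r = 3 \<and> length r = 1)"
  shows "unstable r"
proof -
  obtain a s where as: "r = a # s" using r(1) by (cases r) auto
  show ?thesis
  proof (cases s)
    case Nil
    then have "4 \<le> a" using sum as by auto
    then show ?thesis unfolding as Nil by (intro unstable_ge[OF unstable_4]) auto
  next
    case (Cons b s')
    have s': "\<forall>x\<in>set s'. x \<le> b" "b \<le> a" using r(2) unfolding as Cons by auto
    have r_eq: "r = a # b # s'" using as Cons by simp
    show ?thesis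
    proof (cases "a \<ge> 3")
      case True
      then show ?thesis unfolding r_eq
        by (intro unstable_ge[OF unstable_30]) (auto simp: nth_Cons' )
    next
      case False
      \<comment> \<open>Otherwise monotonicity makes all entries after \<open>a\<close> zero, and
        the sum would be \<open>a \<le> 2\<close>. The same argument later gives
        \<open>c \<ge> 1\<close>.\<close>
      have b: "b \<ge> 1"
      proof (rule ccontr)
        assume "\<not> b \<ge> 1"
        then have "b = 0" "sum_list s' = 0" using s' by auto
        moreover have "sum_list r = a + (b + sum_list s')" by (simp add: r_eq)
        ultimately show False using sum(1) False by linarith
      qed
      show ?thesis
      proof (cases "a = 2")
        case True
        then show ?thesis using b unfolding r_eq
          by (intro unstable_ge[OF unstable_21]) (auto simp: nth_Cons')
      next
        case False
        then have ab: "a = 1" "b = 1" using \<open>\<not> a \<ge> 3\<close> b s' by auto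
        then obtain c s'' where c: "s' = c # s''" using sum(1) r_eq by (cases s') auto
        have "c \<ge> 1"
        proof (rule ccontr)
          assume "\<not> c \<ge> 1"
          then have "c = 0" "sum_list s'' = 0" using r(2) unfolding r_eq c by auto
          moreover have "sum_list r = a + (b + (c + sum_list s''))" by (simp add: r_eq c)
          ultimately show False using sum(1) ab by linarith
        qed
        then show ?thesis using ab unfolding r_eq c
          by (intro unstable_ge[OF unstable_111]) (auto simp: nth_Cons')
      qed
    qed
  qed
qed

theorem theorem1p1:
  fixes k :: nat and r :: "nat list"
  assumes "k \<ge> 1" and "length r = k" and "sorted_wrt (\<ge>) r"
  shows "(\<forall>(X :: 'a::infinite metric) (Xs :: nat \<Rightarrow> 'b::infinite metric).
            positive_definite_space X \<and> card (mspace X) = k \<and>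
            (\<forall>n. positive_definite_space (Xs n) \<and> clustered_in_type r (Xs n)) \<and>
            (\<lambda>n. gromov_hausdorff_distance (Xs n) X) \<longlonglongrightarrow> 0
            \<longrightarrow> (\<lambda>n. magnitude (Xs n)) \<longlonglongrightarrow> magnitude X)
         \<longleftrightarrow> sum_list r \<le> 2 \<or> (sum_list r = 3 \<and> k = 1)"
proof
  assume stable: "\<forall>(X :: 'a metric) (Xs :: nat \<Rightarrow> 'b metric).
            positive_definite_space X \<and> card (mspace X) = k \<and>
            (\<forall>n. positive_definite_space (Xs n) \<and> clustered_in_type r (Xs n)) \<and>
            (\<lambda>n. gromov_hausdorff_distance (Xs n) X) \<longlonglongrightarrow> 0
            \<longrightarrow> (\<lambda>n. magnitude (Xs n)) \<longlonglongrightarrow> magnitude X"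
  show "sum_list r \<le> 2 \<or> (sum_list r = 3 \<and> k = 1)"
  proof (rule ccontr)
    assume "\<not> ?thesis"
    then have "unstable r" using assms by (intro unstable_type) auto
    then obtain X :: "'a metric" and Xs :: "nat \<Rightarrow> 'b metric" where
      "positive_definite_space X \<and> card (mspace X) = length r \<and>
       (\<forall>n. positive_definite_space (Xs n) \<and> clustered_in_type r (Xs n)) \<and>
       (\<lambda>n. gromov_hausdorff_distance (Xs n) X) \<longlonglongrightarrow> 0 \<and>
       \<not> (\<lambda>n. magnitude (Xs n)) \<longlonglongrightarrow> magnitude X"
      using unstable_counterexample[of r] assms by fastforce
    with stable assms(2) show False by blast
  qed
next
  assume r: "sum_list r \<le> 2 \<or> (sum_list r = 3 \<and> k = 1)"
  show "\<forall>(X :: 'a metric) (Xs :: nat \<Rightarrow> 'b metric).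
            positive_definite_space X \<and> card (mspace X) = k \<and>
            (\<forall>n. positive_definite_space (Xs n) \<and> clustered_in_type r (Xs n)) \<and>
            (\<lambda>n. gromov_hausdorff_distance (Xs n) X) \<longlonglongrightarrow> 0
            \<longrightarrow> (\<lambda>n. magnitude (Xs n)) \<longlonglongrightarrow> magnitude X"
  proof (intro allI impI, elim conjE)
    fix X :: "'a metric" and Xs :: "nat \<Rightarrow> 'b metric"
    assume X: "positive_definite_space X" "card (mspace X) = k"
      and Xs: "\<forall>n. positive_definite_space (Xs n) \<and> clustered_in_type r (Xs n)"
      and lim: "(\<lambda>n. gromov_hausdorff_distance (Xs n) X) \<longlonglongrightarrow> 0"
    have card: "card (mspace (Xs n)) = sum_list r + k" for n
      using Xs card_clustered[of r "Xs n"] assms(2) unfolding positive_definite_space_def by auto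
    show "(\<lambda>n. magnitude (Xs n)) \<longlonglongrightarrow> magnitude X"
    proof (rule magnitude_tendsto[OF X(1) _ _ _ _ lim])
      show "positive_definite_space (Xs n)" for n using Xs by blast
      show "mspace X \<noteq> {}" using X(2) assms(1) by auto
      show "mspace (Xs n) \<noteq> {}" for n using card[of n] assms(1) by auto
      show "(\<forall>n. card (mspace (Xs n)) \<le> card (mspace X) + 2) \<or>
          card (mspace X) = 1 \<and> (\<forall>n. card (mspace (Xs n)) = 4)"
        using r unfolding card X(2) by auto
    qed
  qed
qed

end
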